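(* Let $k\ge 1$ be an integer, let $\mathcal{T}\subset\mathbb{R}^n$ be a nonempty closed set with compact boundary, and let $f_1,\dots,f_m$ be vector fields belonging to $C_b^{k-1}(\Omega\setminus\mathcal{T})$ for every open, bounded subset $\Omega\subset\mathbb{R}^n$. Consider the control system $$\dot y=\sum_{i=1}^m a_i f_i(y),\qquad y(0)=x\in\mathbb{R}^n\setminus\mathcal{T},\qquad a\in A:=\{\pm e_1,\dots,\pm e_m\},$$ where $e_1,\dots,e_m$ is the canonical basis of $\mathbb{R}^m$. If there exists a degree-$k$ control Lyapunov function, then the system is globally asymptotically controllable to $\mathcal{T}$ (GAC to $\mathcal{T}$).
   Context: Function spaces. For an open set $D\subseteq\mathbb{R}^n$ and an integer $j\ge0$, $C_b^{j}(D)$ is the set of vector fields $f:D\to\mathbb{R}^n$ of class $C^j$ such that $f$ and its derivatives up to order $j$ are bounded on $D$ ($C^0$ means continuous). Lie brackets. For $C^1$ vector fields $X,Y$, $[X,Y]:=DY\cdot X-DX\cdot Y$. Iterating this operation gives iterated Lie brackets; the degree of an iterated bracket of $f_1,\dots,f_m$ is the number of vector fields $f_i$ appearing in the formal expression, counted with repetition (e.g. $[[f_2,f_3],f_2]$ has degree $3$). Hamiltonians. $\mathcal{F}^{(1)}:=\{\pm f_i: i=1,\dots,m\}$; for $2\le h\le k$, $\mathcal{F}^{(h)}$ is the family of all iterated Lie brackets of degree $\le h$ of $f_1,\dots,f_m$, where the elements of degree $1$ are understood to be the $\pm f_i$, so that $\mathcal{F}^{(1)}\subseteq\mathcal{F}^{(2)}\subseteq\dots\subseteq\mathcal{F}^{(k)}$.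 Put $\mathcal{F}^{(h)}(x):=\{X(x): X\in\mathcal{F}^{(h)}\}$ and, for $(x,p)\in(\mathbb{R}^n\setminus\mathcal{T})\times\mathbb{R}^n$, $$H^{(h)}(x,p):=\inf_{v\in\mathcal{F}^{(h)}(x)}\langle p,v\rangle .$$ Nonsmooth notions. A continuous function $F:E\to\mathbb{R}$, $E\subset\mathbb{R}^n$, is semiconcave on $E$ if there is $\rho>0$ with $F(z_1)+F(z_2)-2F\left(\frac{z_1+z_2}{2}\right)\le\rho|z_1-z_2|^2$ for all $z_1,z_2\in E$ such that the segment $[z_1,z_2]\subset E$; it is locally semiconcave on $E$ if it is semiconcave on every compact subset of $E$. Locally semiconcave functions on open sets are locally Lipschitz. For a locally Lipschitz $F$ on an open set, $D^*F(x)$ (the set of limiting gradients at $x$) is the set of all $w=\lim_k\nabla F(x_k)$ with $x_k\to x$, $x_k\ne x$, $F$ differentiable at $x_k$. A continuous $F:\overline{\mathbb{R}^n\setminus\mathcal{T}}\to\mathbb{R}$ is positive definite on $\mathbb{R}^n\setminus\mathcal{T}$ if $F>0$ on $\mathbb{R}^n\setminus\mathcal{T}$ and $F=0$ on $\partial\mathcal{T}$; it is proper on $\mathbb{R}^n\setminus\mathcal{T}$ if $F^{-1}(K)$ is compact for every compact $K\subset[0,+\infty)$. Degree-$k$ control Lyapunov function: a continuous function $U:\overline{\mathbb{R}^n\setminus\mathcal{T}}\to\mathbb{R}$ which is locally semiconcave, positive definite and proper on $\mathbb{R}^n\setminus\mathcal{T}$ and satisfies $H^{(k)}(x,D^*U(x))<0$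 for all $x\in\mathbb{R}^n\setminus\mathcal{T}$, meaning $H^{(k)}(x,p)<0$ for every $p\in D^*U(x)$. Global asymptotic controllability. Let $\mathbf{d}(x)$ be the Euclidean distance of $x$ from $\mathcal{T}$. A pair $(y,\alpha)$, with $\alpha:[0,+\infty)\to A$ measurable, is an admissible trajectory-control pair from $x$ if there is $T\le+\infty$ such that $y$ is a solution on $[0,T)$ of the system with control $a=\alpha(t)$ and $y(0)=x$, with values in $\mathbb{R}^n\setminus\mathcal{T}$, and $\lim_{t\to T}\mathbf{d}(y(t))=0$; if $T<+\infty$, $y$ is extended to $[0,+\infty)$ by setting $y(t)=\bar x$ for $t\ge T$, with $\bar x\in\partial\mathcal{T}$ an arbitrary fixed point. $\mathcal{KL}$ is the set of continuous functions $\beta:[0,+\infty)\times[0,+\infty)\to[0,+\infty)$ such that (1) $\beta(0,s)=0$ and $\beta(\cdot,s)$ is strictly increasing and unbounded for each $s\ge0$; (2) $\beta(\delta,\cdot)$ is decreasing (not necessarily strictly) for each $\delta\ge0$; (3) $\beta(\delta,s)\to0$ as $s\to+\infty$ for each $\delta\ge0$. The system is GAC to $\mathcal{T}$ if there is $\beta\in\mathcal{KL}$ such that for every $x\in\mathbb{R}^n\setminus\mathcal{T}$ there is an admissible trajectory-control pair $(y,\alpha)$ from $x$ with $\mathbf{d}(y(t))\le\beta(\mathbf{d}(x),t)$ for all $t\ge0$. *)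

theory Defs
  imports "HOL-Analysis.Analysis"
begin

text \<open>
  The target is a set \<open>T\<close> in \<open>real ^ 'n\<close>, and \<open>f :: 'm \<Rightarrow> real ^ 'n \<Rightarrow> real ^ 'n\<close> is the family
  of vector fields, with \<open>m = CARD('m)\<close>.  Functions whose mathematical domain is \<open>- T\<close> or
  \<open>closure (- T)\<close> are total here; their values outside that domain are never used.
\<close>

section \<open>Function spaces and Lie brackets\<close>

text \<open>
  Meant for open \<open>D\<close>.  A map is of class \<open>C\<^sup>j\<^sup>+\<^sup>1\<close> iff it is differentiable and all its
  directional derivatives \<open>x \<mapsto> Df(x) v\<close> are of class \<open>C\<^sup>j\<close>; by finite dimensionality, bounding these
  for each fixed \<open>v\<close> amounts to bounding the derivative itself.
\<close>

primrec Cb :: "nat \<Rightarrow> (real ^ 'n) set \<Rightarrow> (real ^ 'n \<Rightarrow> real ^ 'n) set" where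
  "Cb 0 D = {f. continuous_on D f \<and> bounded (f ` D)}"
| "Cb (Suc j) D = {f. continuous_on D f \<and> bounded (f ` D) \<and>
      (\<forall>x\<in>D. f differentiable (at x)) \<and>
      (\<forall>v. (\<lambda>x. frechet_derivative f (at x) v) \<in> Cb j D)}"

definition lie_bracket ::
    "(real ^ 'n \<Rightarrow> real ^ 'n) \<Rightarrow> (real ^ 'n \<Rightarrow> real ^ 'n) \<Rightarrow> real ^ 'n \<Rightarrow> real ^ 'n" where
  "lie_bracket X Y = (\<lambda>x. frechet_derivative Y (at x) (X x) - frechet_derivative X (at x) (Y x))"

text \<open>Formal bracket expressions: the degree belongs to the expression, not to its value.\<close>

datatype 'm bracket = Field 'm | Br "'m bracket" "'m bracket"

primrec bracket_degree :: "'m bracket \<Rightarrow> nat" where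
  "bracket_degree (Field i) = 1"
| "bracket_degree (Br b c) = bracket_degree b + bracket_degree c"

primrec bracket_value ::
    "('m \<Rightarrow> real ^ 'n \<Rightarrow> real ^ 'n) \<Rightarrow> 'm bracket \<Rightarrow> real ^ 'n \<Rightarrow> real ^ 'n" where
  "bracket_value f (Field i) = f i"
| "bracket_value f (Br b c) = lie_bracket (bracket_value f b) (bracket_value f c)"

text \<open>
  Signs inside brackets are not needed: brackets are bilinear and antisymmetric, so the brackets of
  degree at least 2 already form a family that is closed under negation on \<open>- T\<close>.
\<close>

definition bracket_family ::
    "('m \<Rightarrow> real ^ 'n \<Rightarrow> real ^ 'n) \<Rightarrow> nat \<Rightarrow> (real ^ 'n \<Rightarrow> real ^ 'n) set" where
  "bracket_family f h =
     {f i | i. True} \<union> {(\<lambda>x. - f i x) | i. True} \<union>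
     {bracket_value f b | b. 2 \<le> bracket_degree b \<and> bracket_degree b \<le> h}"

definition bracket_family_at ::
    "('m \<Rightarrow> real ^ 'n \<Rightarrow> real ^ 'n) \<Rightarrow> nat \<Rightarrow> real ^ 'n \<Rightarrow> (real ^ 'n) set" where
  "bracket_family_at f h x = {X x | X. X \<in> bracket_family f h}"

text \<open>For finite \<open>'m\<close> the infimum is over a nonempty finite set.\<close>

definition hamiltonian ::
    "('m::finite \<Rightarrow> real ^ 'n \<Rightarrow> real ^ 'n) \<Rightarrow> nat \<Rightarrow> real ^ 'n \<Rightarrow> real ^ 'n \<Rightarrow> real" where
  "hamiltonian f h x p = (INF v\<in>bracket_family_at f h x. p \<bullet> v)"

section \<open>Control Lyapunov functions\<close>

definition semiconcave_on :: "(real ^ 'n) set \<Rightarrow> (real ^ 'n \<Rightarrow> real) \<Rightarrow> bool" where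
  "semiconcave_on E F \<longleftrightarrow> continuous_on E F \<and>
     (\<exists>\<rho>>0. \<forall>z\<^sub>1\<in>E. \<forall>z\<^sub>2\<in>E. closed_segment z\<^sub>1 z\<^sub>2 \<subseteq> E \<longrightarrow>
        F z\<^sub>1 + F z\<^sub>2 - 2 * F (midpoint z\<^sub>1 z\<^sub>2) \<le> \<rho> * (norm (z\<^sub>1 - z\<^sub>2))\<^sup>2)"

definition locally_semiconcave_on :: "(real ^ 'n) set \<Rightarrow> (real ^ 'n \<Rightarrow> real) \<Rightarrow> bool" where
  "locally_semiconcave_on E F \<longleftrightarrow>
     continuous_on E F \<and> (\<forall>K. compact K \<and> K \<subseteq> E \<longrightarrow> semiconcave_on K F)"

definition limiting_gradients ::
    "(real ^ 'n) set \<Rightarrow> (real ^ 'n \<Rightarrow> real) \<Rightarrow> real ^ 'n \<Rightarrow> (real ^ 'n) set" where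
  "limiting_gradients E F x =
     {w. \<exists>X G. (\<forall>j. X j \<in> E \<and> X j \<noteq> x \<and> GDERIV F (X j) :> G j) \<and>
               X \<longlonglongrightarrow> x \<and> G \<longlonglongrightarrow> w}"

definition positive_definite_off :: "(real ^ 'n) set \<Rightarrow> (real ^ 'n \<Rightarrow> real) \<Rightarrow> bool" where
  "positive_definite_off T F \<longleftrightarrow> (\<forall>x. x \<notin> T \<longrightarrow> F x > 0) \<and> (\<forall>x\<in>frontier T. F x = 0)"

definition proper_off :: "(real ^ 'n) set \<Rightarrow> (real ^ 'n \<Rightarrow> real) \<Rightarrow> bool" where
  "proper_off T F \<longleftrightarrow>
     (\<forall>K. compact K \<and> K \<subseteq> {0..} \<longrightarrow> compact {x \<in> closure (- T). F x \<in> K})"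

definition control_lyapunov_function ::
    "nat \<Rightarrow> (real ^ 'n) set \<Rightarrow> ('m::finite \<Rightarrow> real ^ 'n \<Rightarrow> real ^ 'n) \<Rightarrow> (real ^ 'n \<Rightarrow> real) \<Rightarrow> bool"
  where
  "control_lyapunov_function k T f U \<longleftrightarrow>
     continuous_on (closure (- T)) U \<and>
     locally_semiconcave_on (- T) U \<and>
     positive_definite_off T U \<and>
     proper_off T U \<and>
     (\<forall>x. x \<notin> T \<longrightarrow> (\<forall>p\<in>limiting_gradients (- T) U x. hamiltonian f k x p < 0))"

section \<open>Trajectories and global asymptotic controllability\<close>

definition control_set :: "(real ^ 'm) set" where
  "control_set = {axis i 1 | i. True} \<union> {- axis i 1 | i. True}"

text \<open>
  Absolute continuity on \<open>{a..b}\<close>; a pair \<open>(u, v)\<close> in \<open>I\<close> stands for the interval from \<open>u\<close> to \<open>v\<close>.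
\<close>

definition abs_continuous_on_interval :: "real \<Rightarrow> real \<Rightarrow> (real \<Rightarrow> real ^ 'n) \<Rightarrow> bool" where
  "abs_continuous_on_interval a b y \<longleftrightarrow>
     (\<forall>\<epsilon>>0. \<exists>\<delta>>0. \<forall>I. finite I \<and> (\<forall>(u, v)\<in>I. a \<le> u \<and> u \<le> v \<and> v \<le> b) \<and>
        disjoint_family_on (\<lambda>(u, v). {u<..<v}) I \<and> (\<Sum>(u, v)\<in>I. v - u) < \<delta>
        \<longrightarrow> (\<Sum>(u, v)\<in>I. norm (y v - y u)) < \<epsilon>)"

text \<open>Caratheodory solutions on \<open>[0, S)\<close>, where \<open>S \<le> \<infinity>\<close>, staying outside \<open>T\<close>.\<close>

definition solution_on ::
    "(real ^ 'n) set \<Rightarrow> ('m::finite \<Rightarrow> real ^ 'n \<Rightarrow> real ^ 'n) \<Rightarrow> ereal \<Rightarrow>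
     (real \<Rightarrow> real ^ 'm) \<Rightarrow> (real \<Rightarrow> real ^ 'n) \<Rightarrow> bool" where
  "solution_on T f S \<alpha> y \<longleftrightarrow>
     (\<forall>t\<ge>0. ereal t < S \<longrightarrow> y t \<notin> T) \<and>
     (\<forall>b\<ge>0. ereal b < S \<longrightarrow> abs_continuous_on_interval 0 b y) \<and>
     (AE t in lebesgue. 0 < t \<and> ereal t < S \<longrightarrow>
        (y has_vector_derivative (\<Sum>i\<in>UNIV. \<alpha> t $ i *\<^sub>R f i (y t))) (at t))"

text \<open>
  The filter \<open>filtercomap ereal (at_left S)\<close> is \<open>t \<rightarrow> S\<close> from the left, uniformly for finite and
  infinite \<open>S\<close>:
\<close>

lemma filtercomap_ereal_at_left:
  "filtercomap ereal (at_left (ereal s)) = at_left s"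
  "filtercomap ereal (at_left \<infinity>) = at_top"
proof -
  have "filtercomap ereal (filtermap ereal F) = F" for F
    by (auto simp: filter_eq_iff eventually_filtercomap eventually_filtermap
             intro: exI[where x = "\<lambda>z. P (real_of_ereal z)" for P] elim: eventually_mono)
  then show "filtercomap ereal (at_left (ereal s)) = at_left s"
    "filtercomap ereal (at_left \<infinity>) = at_top"
    by (simp_all add: at_left_ereal at_left_PInf)
qed

definition admissible_pair ::
    "(real ^ 'n) set \<Rightarrow> ('m::finite \<Rightarrow> real ^ 'n \<Rightarrow> real ^ 'n) \<Rightarrow> real ^ 'n \<Rightarrow>
     (real \<Rightarrow> real ^ 'n) \<Rightarrow> (real \<Rightarrow> real ^ 'm) \<Rightarrow> bool" where
  "admissible_pair T f x y \<alpha> \<longleftrightarrow>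
     \<alpha> \<in> borel_measurable (lebesgue_on {0..}) \<and>
     (\<forall>t\<ge>0. \<alpha> t \<in> control_set) \<and>
     (\<exists>S::ereal. 0 < S \<and> y 0 = x \<and> solution_on T f S \<alpha> y \<and>
        ((\<lambda>t. infdist (y t) T) \<longlongrightarrow> 0) (filtercomap ereal (at_left S)) \<and>
        (S < \<infinity> \<longrightarrow> (\<exists>x'\<in>frontier T. \<forall>t. S \<le> ereal t \<longrightarrow> y t = x')))"

definition class_KL :: "(real \<Rightarrow> real \<Rightarrow> real) set" where
  "class_KL = {\<beta>.
     (\<forall>\<delta>\<ge>0. \<forall>s\<ge>0. \<beta> \<delta> s \<ge> 0) \<and>
     continuous_on ({0..} \<times> {0..}) (\<lambda>(\<delta>, s). \<beta> \<delta> s) \<and>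
     (\<forall>s\<ge>0. \<beta> 0 s = 0 \<and> strict_mono_on {0..} (\<lambda>\<delta>. \<beta> \<delta> s) \<and>
             \<not> bounded ((\<lambda>\<delta>. \<beta> \<delta> s) ` {0..})) \<and>
     (\<forall>\<delta>\<ge>0. antimono_on {0..} (\<beta> \<delta>)) \<and>
     (\<forall>\<delta>\<ge>0. (\<beta> \<delta> \<longlongrightarrow> 0) at_top)}"

definition GAC :: "(real ^ 'n) set \<Rightarrow> ('m::finite \<Rightarrow> real ^ 'n \<Rightarrow> real ^ 'n) \<Rightarrow> bool" where
  "GAC T f \<longleftrightarrow>
     (\<exists>\<beta>\<in>class_KL. \<forall>x. x \<notin> T \<longrightarrow>
        (\<exists>y \<alpha>. admissible_pair T f x y \<alpha> \<and>
           (\<forall>t\<ge>0. infdist (y t) T \<le> \<beta> (infdist x T) t)))"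

end

theory Submission
  imports Defs "HOL-Complex_Analysis.Great_Picard"
begin

text \<open>
  The theorem rests on one local fact and one bookkeeping device.

  The local fact: on every compact annulus \<open>{a \<le> U \<le> b}\<close> with \<open>a > 0\<close> there is a fixed amount
  \<open>\<mu> > 0\<close> such that from each of its points some admissible arc of duration at most 1 lowers \<open>U\<close> by
  \<open>\<mu>\<close> without ever exceeding twice the initial value (\<open>uniform_decrease_step\<close>).  It has two
  ingredients.  A semiconcave \<open>U\<close> lies below a paraboloid at each point,
  \<open>U z \<le> U x + p \<bullet> (z - x) + \<rho> |z - x|\<^sup>2\<close>, with \<open>p\<close> a limiting gradient; by compactness
  some member \<open>B\<close> of the finite bracket family satisfies \<open>p \<bullet> B x \<le> - c\<close> with \<open>c > 0\<close> uniform
  (\<open>uniform_descent_direction\<close>).  And the direction \<open>B\<close> can be followed approximately: if \<open>B\<close>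
  has degree \<open>h\<close>, there is a word of flows of \<open>\<pm> f\<^sub>i\<close>, each run for time \<open>t\<close>, whose end point is
  \<open>x + t\<^sup>h B x + o(t\<^sup>h)\<close>, uniformly in \<open>x\<close> on compact sets (\<open>bracket_word_expansion\<close>).
  Inserting this end point into the paraboloid inequality gives a decrease of order
  \<open>c t\<^sup>h\<close>, because the quadratic term is of order \<open>t\<^bsup>2h\<^esup>\<close>.

  The fields are only of class \<open>C\<^sup>k\<^sup>-\<^sup>1\<close>, so a Taylor expansion of the flows as maps is not available
  to the required order.  Instead a test map \<open>\<phi>\<close> is expanded along a curve: every integration along
  \<open>f\<^sub>i\<close> replaces \<open>\<phi>\<close> by \<open>L\<^sub>i \<phi>\<close>, and \<open>j\<close> such steps use \<open>j\<close> derivatives of \<open>\<phi>\<close> but only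
  \<open>j - 1\<close> derivatives of the fields.  Concatenating flows then multiplies formal series in
  noncommuting letters, a single flow being an exponential, and the bracket formula reduces to the
  ring identity \<open>B C B\<^sup>-\<^sup>1 C\<^sup>-\<^sup>1 - 1 = [B - 1, C - 1] B\<^sup>-\<^sup>1 C\<^sup>-\<^sup>1\<close>.  Every
  estimate holds for all integral curves, as \<open>k = 1\<close> requires: there the fields are merely
  continuous, and integral curves come from Peano's theorem without uniqueness.

  The bookkeeping device is a clock: an increasing bijection \<open>\<tau>\<close> from the positive reals onto the
  reals such that every decrease step lowers \<open>\<tau> \<circ> U\<close> by at least 1 (\<open>decrease_clock\<close>).  Since a
  step takes time at most 1, iterating steps from \<open>x\<close> gives a trajectory on which
  \<open>U (y t) \<le> 2 \<tau>\<^sup>-\<^sup>1 (\<tau> (U x) + 1 - t)\<close>.  It may reach the target in finite total time, and along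
  it \<open>U\<close> tends to 0 in either case.  Comparing \<open>U\<close> with the distance from the target
  turns the right-hand side into a function of class \<open>\<K>\<L>\<close> (\<open>class_KL_of_clock\<close>).
\<close>

section \<open>Lie derivatives of maps of class \<open>C\<^sup>j\<close>\<close>

text \<open>
  The operator \<open>L\<^sub>X\<close>, acting on vector-valued maps; with it
  \<open>lie_bracket X Y = L\<^sub>X Y - L\<^sub>Y X\<close>.
\<close>

definition lie_derivative ::
    "(real ^ 'n \<Rightarrow> real ^ 'n) \<Rightarrow> (real ^ 'n \<Rightarrow> real ^ 'n) \<Rightarrow> real ^ 'n \<Rightarrow> real ^ 'n" where
  "lie_derivative X \<phi> = (\<lambda>x. frechet_derivative \<phi> (at x) (X x))"

lemma frechet_derivative_cong_open:
  assumes "open D" "x \<in> D" "\<And>z. z \<in> D \<Longrightarrow> f z = g z"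
  shows "frechet_derivative f (at x) = frechet_derivative g (at x)"
proof -
  have "(f has_derivative f') (at x) \<longleftrightarrow> (g has_derivative f') (at x)" for f'
    using assms has_derivative_transform_within_open[of f f' x UNIV D g]
      has_derivative_transform_within_open[of g f' x UNIV D f] by auto
  then show ?thesis by (simp add: frechet_derivative_def)
qed

lemma differentiable_cong_open:
  assumes "open D" "x \<in> D" "\<And>z. z \<in> D \<Longrightarrow> f z = g z" "f differentiable (at x)"
  shows "g differentiable (at x)"
  using assms has_derivative_transform_within_open[of f _ x UNIV D g]
  unfolding differentiable_def by metis

lemma lie_derivative_cong:
  assumes "open D" "x \<in> D" "\<And>z. z \<in> D \<Longrightarrow> f z = g z"
  shows "lie_derivative X f x = lie_derivative X g x"
  unfolding lie_derivative_def using frechet_derivative_cong_open[OF assms] by simp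

lemma Cb_continuous: "f \<in> Cb j D \<Longrightarrow> continuous_on D f"
  by (cases j) auto

lemma Cb_bounded: "f \<in> Cb j D \<Longrightarrow> bounded (f ` D)"
  by (cases j) auto

lemma Cb_cong:
  assumes "open D" "f \<in> Cb j D" "\<And>z. z \<in> D \<Longrightarrow> f z = g z"
  shows "g \<in> Cb j D"
  using assms(2,3)
proof (induction j arbitrary: f g)
  case 0
  have "continuous_on D f = continuous_on D g" "f ` D = g ` D"
    by (rule continuous_on_cong[OF refl 0(2)], assumption, rule image_cong[OF refl 0(2)])
  then show ?case using 0(1) by simp
next
  case (Suc j)
  have "(\<lambda>x. frechet_derivative g (at x) v) \<in> Cb j D" for v
  proof (rule Suc.IH)
    show "(\<lambda>x. frechet_derivative f (at x) v) \<in> Cb j D" using Suc.prems(1) by simp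
    show "frechet_derivative f (at z) v = frechet_derivative g (at z) v" if "z \<in> D" for z
      by (rule fun_cong[OF frechet_derivative_cong_open[OF assms(1) that Suc.prems(2)]])
  qed
  moreover have "g differentiable (at x)" if "x \<in> D" for x
    using differentiable_cong_open[OF assms(1) that Suc.prems(2)] Suc.prems(1) that by auto
  moreover have "continuous_on D f = continuous_on D g" "f ` D = g ` D"
    by (rule continuous_on_cong[OF refl Suc.prems(2)], assumption, rule image_cong[OF refl Suc.prems(2)])
  ultimately show ?case using Suc.prems(1) by simp
qed

lemma Cb_Suc_imp_Cb: "f \<in> Cb (Suc j) D \<Longrightarrow> f \<in> Cb j D"
  by (induction j arbitrary: f) auto

lemma Cb_antimono: "i \<le> j \<Longrightarrow> f \<in> Cb j D \<Longrightarrow> f \<in> Cb i D"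
  by (induction j rule: nat_induct_at_least[of i, consumes 1])
     (auto dest: Cb_Suc_imp_Cb simp del: Cb.simps)

lemma Cb_const: "(\<lambda>x. c) \<in> Cb j D"
proof (induction j arbitrary: c)
  case 0 then show ?case by (simp add: image_constant_conv)
next
  case (Suc j) 
  have "bounded ((\<lambda>x. c) ` D)" by (simp add: image_constant_conv)
  then show ?case using Suc[of 0] by (simp add: frechet_derivative_const)
qed

lemma Cb_id:
  assumes "bounded D"
  shows "(\<lambda>x. x) \<in> Cb j D"
  using assms by (cases j) (auto simp: Cb_const frechet_derivative_ident)

lemma Cb_add:
  assumes "open D" "f \<in> Cb j D" "g \<in> Cb j D"
  shows "(\<lambda>x. f x + g x) \<in> Cb j D"
  using assms(2,3)
proof (induction j arbitrary: f g)
  case 0 then show ?case by (auto intro: continuous_intros bounded_plus_comp)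
next
  case (Suc j)
  have eq: "frechet_derivative (\<lambda>x. f x + g x) (at x) v
      = frechet_derivative f (at x) v + frechet_derivative g (at x) v" if "x \<in> D" for x v
  proof -
    have "((\<lambda>x. f x + g x) has_derivative
        (\<lambda>v. frechet_derivative f (at x) v + frechet_derivative g (at x) v)) (at x)"
      using Suc.prems that by (intro has_derivative_add) (auto simp: frechet_derivative_works)
    then show ?thesis by (rule fun_cong[OF frechet_derivative_at, symmetric])
  qed
  have "(\<lambda>x. frechet_derivative (\<lambda>x. f x + g x) (at x) v) \<in> Cb j D" for v
    by (rule Cb_cong[OF assms(1) Suc.IH]) (use Suc.prems eq in auto)
  then show ?case using Suc.prems by (auto intro: continuous_intros bounded_plus_comp)
qed

lemma bounded_scaleR_comp_image:
  assumes "bounded (u ` D)" "bounded (g ` D)"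
  shows "bounded ((\<lambda>x. (u x $ i) *\<^sub>R (g x :: real ^ 'n)) ` (D :: (real ^ 'm) set))"
proof -
  obtain A B where AB: "\<And>x. x \<in> D \<Longrightarrow> norm (u x) \<le> A" "\<And>x. x \<in> D \<Longrightarrow> norm (g x) \<le> B"
    using assms unfolding bounded_iff by auto
  have "norm ((u x $ i) *\<^sub>R g x) \<le> A * B" if "x \<in> D" for x
    using AB[OF that] component_le_norm_cart[of "u x" i]
    by (simp add: mult_mono')
  then show ?thesis unfolding bounded_iff by auto
qed

lemma component_scaleR_has_derivative:
  fixes u g :: "real ^ 'n \<Rightarrow> real ^ 'n"
  assumes "(u has_derivative u') (at x)" "(g has_derivative g') (at x)"
  shows "((\<lambda>x. (u x $ i) *\<^sub>R g x) has_derivative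
    (\<lambda>v. (u x $ i) *\<^sub>R g' v + (u' v $ i) *\<^sub>R g x)) (at x)"
  using assms
  by (auto intro!: has_derivative_scaleR bounded_linear.has_derivative[OF bounded_linear_vec_nth])

text \<open>
  The product rule keeps products in the class.  The scalar factor is a component of a map in
  the class, so that no separate class of scalar functions is needed.
\<close>

lemma Cb_scaleR:
  assumes "open D" "u \<in> Cb j D" "g \<in> Cb j D"
  shows "(\<lambda>x. (u x $ i) *\<^sub>R g x) \<in> Cb j D"
  using assms(2,3)
proof (induction j arbitrary: u g)
  case 0 then show ?case
    by (auto intro!: continuous_intros bounded_scaleR_comp_image)
next
  case (Suc j)
  have der: "((\<lambda>x. (u x $ i) *\<^sub>R g x) has_derivative
    (\<lambda>v. (u x $ i) *\<^sub>R frechet_derivative g (at x) v + (frechet_derivative u (at x) v $ i) *\<^sub>R g x)) (at x)"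
    if "x \<in> D" for x
    using Suc.prems that by (intro component_scaleR_has_derivative)
       (auto simp: frechet_derivative_works)
  have eq: "frechet_derivative (\<lambda>x. (u x $ i) *\<^sub>R g x) (at x) v
      = (u x $ i) *\<^sub>R frechet_derivative g (at x) v + (frechet_derivative u (at x) v $ i) *\<^sub>R g x"
    if "x \<in> D" for x v
    by (rule fun_cong[OF frechet_derivative_at[OF der[OF that]], symmetric])
  have "(\<lambda>x. frechet_derivative (\<lambda>x. (u x $ i) *\<^sub>R g x) (at x) v) \<in> Cb j D" for v
  proof (rule Cb_cong[OF assms(1)])
    show "(\<lambda>x. (u x $ i) *\<^sub>R frechet_derivative g (at x) v + (frechet_derivative u (at x) v $ i) *\<^sub>R g x) \<in> Cb j D"
      using Suc.prems Suc.IH[of u "\<lambda>x. frechet_derivative g (at x) v"]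
        Suc.IH[of "\<lambda>x. frechet_derivative u (at x) v" g] Cb_Suc_imp_Cb[of u j D] Cb_Suc_imp_Cb[of g j D]
      by (intro Cb_add[OF assms(1)]) simp_all
  qed (simp add: eq)
  then show ?case using Suc.prems der
    by (auto intro!: continuous_intros bounded_scaleR_comp_image simp: differentiable_def)
qed

lemma Cb_cmult:
  assumes "open D" "f \<in> Cb j D"
  shows "(\<lambda>x. c *\<^sub>R f x) \<in> Cb j D"
  using Cb_scaleR[OF assms(1) Cb_const[of "vec c"] assms(2)] by simp

lemma Cb_diff:
  assumes "open D" "f \<in> Cb j D" "g \<in> Cb j D"
  shows "(\<lambda>x. f x - g x) \<in> Cb j D"
  using Cb_add[OF assms(1,2) Cb_cmult[OF assms(1,3), of "-1"]] by simp

lemma Cb_sum: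
  assumes "open D" "\<And>i. i \<in> I \<Longrightarrow> f i \<in> Cb j D"
  shows "(\<lambda>x. \<Sum>i\<in>I. f i x) \<in> Cb j D"
  using assms(2)
  by (induction I rule: infinite_finite_induct) (auto simp: Cb_const Cb_add[OF assms(1)])

lemma linear_expand_axis:
  fixes l :: "real ^ 'n \<Rightarrow> 'b::real_vector"
  assumes "linear l"
  shows "l v = (\<Sum>i\<in>UNIV. (v $ i) *\<^sub>R l (axis i 1))"
proof -
  have "l v = l (\<Sum>i\<in>UNIV. (v $ i) *\<^sub>R axis i 1)"
    using basis_expansion[of v] by (simp add: scalar_mult_eq_scaleR)
  also have "\<dots> = (\<Sum>i\<in>UNIV. (v $ i) *\<^sub>R l (axis i 1))"
    using assms by (simp add: linear_sum linear_cmul)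
  finally show ?thesis .
qed

text \<open>
  Expanding \<open>X\<close> in coordinates turns \<open>L\<^sub>X \<phi>\<close> into a sum of products of a component of \<open>X\<close> with
  a directional derivative of \<open>\<phi>\<close> in a fixed direction, and these are the derivatives that the
  class controls.
\<close>

lemma Cb_lie_derivative:
  assumes "open D" "\<phi> \<in> Cb (Suc j) D" "X \<in> Cb j D"
  shows "lie_derivative X \<phi> \<in> Cb j D"
proof -
  have "(\<lambda>x. \<Sum>i\<in>UNIV. (X x $ i) *\<^sub>R frechet_derivative \<phi> (at x) (axis i 1)) \<in> Cb j D"
    using assms by (intro Cb_sum Cb_scaleR) auto
  then show ?thesis
    by (rule Cb_cong[OF assms(1)])
       (use assms in \<open>auto simp: lie_derivative_def
         linear_expand_axis[OF linear_frechet_derivative, symmetric]\<close>)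
qed

text \<open>
  The second difference is the increment over \<open>[0, h]\<close> of
  \<open>s \<mapsto> \<phi>(x + su + hv) - \<phi>(x + su)\<close>, whose derivative is \<open>h A v + o(h)\<close> because
  \<open>z \<mapsto> \<phi>' z u\<close> is differentiable at \<open>x\<close>.
\<close>

lemma second_difference_estimate:
  fixes \<phi> :: "'a::real_normed_vector \<Rightarrow> 'b::real_normed_vector"
  assumes "open D" "x \<in> D" "\<And>z. z \<in> D \<Longrightarrow> (\<phi> has_derivative \<phi>' z) (at z)"
    and A: "((\<lambda>z. \<phi>' z u) has_derivative A) (at x)" and "\<epsilon> > 0"
  shows "\<exists>\<delta>>0. \<forall>h. 0 < h \<and> h < \<delta> \<longrightarrow>
    norm (\<phi> (x + h *\<^sub>R u + h *\<^sub>R v) - \<phi> (x + h *\<^sub>R u) - \<phi> (x + h *\<^sub>R v) + \<phi> x - h\<^sup>2 *\<^sub>R A v) \<le> \<epsilon> * h\<^sup>2"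
proof -
  define c where "c = 2 * norm u + norm v + 1"
  have c: "c > 0" by (simp add: c_def add_nonneg_pos)
  have e: "\<epsilon> / c > 0" using c \<open>\<epsilon> > 0\<close> by simp
  obtain d1 where d1: "d1 > 0" "\<And>w. norm (w - x) < d1 \<Longrightarrow>
      norm (\<phi>' w u - \<phi>' x u - A (w - x)) \<le> \<epsilon> / c * norm (w - x)"
    using A e unfolding has_derivative_at_alt by blast
  obtain d2 where d2: "d2 > 0" "ball x d2 \<subseteq> D"
    using assms(1,2) openE by blast
  define \<delta> where "\<delta> = min d1 d2 / c"
  have \<delta>: "\<delta> > 0" using d1 d2 c by (simp add: \<delta>_def)
  have bl: "linear A" using A has_derivative_linear by blast
  have "norm (\<phi> (x + h *\<^sub>R u + h *\<^sub>R v) - \<phi> (x + h *\<^sub>R u) - \<phi> (x + h *\<^sub>R v) + \<phi> x - h\<^sup>2 *\<^sub>R A v) \<le> \<epsilon> * h\<^sup>2"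
    if h: "0 < h" "h < \<delta>" for h
  proof -
    have hc: "h * c < min d1 d2" using h c by (simp add: \<delta>_def field_simps)
    have small: "norm (s *\<^sub>R u + h *\<^sub>R v) + norm (s *\<^sub>R u) \<le> h * c" if "0 \<le> s" "s \<le> h" for s
    proof -
      have "norm (s *\<^sub>R u + h *\<^sub>R v) + norm (s *\<^sub>R u) \<le> 2 * (s * norm u) + h * norm v"
        using norm_triangle_ineq[of "s *\<^sub>R u" "h *\<^sub>R v"] that h by simp
      also have "\<dots> \<le> 2 * (h * norm u) + h * norm v"
        using that by (simp add: mult_right_mono)
      also have "\<dots> \<le> h * c" using h by (simp add: c_def algebra_simps)
      finally show ?thesis .
    qed
    have inD: "x + s *\<^sub>R u + h *\<^sub>R v \<in> D" "x + s *\<^sub>R u \<in> D"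
      and n1: "norm (s *\<^sub>R u + h *\<^sub>R v) < d1" "norm (s *\<^sub>R u) < d1"
      if "0 \<le> s" "s \<le> h" for s
    proof -
      have b: "norm (s *\<^sub>R u + h *\<^sub>R v) < min d1 d2" "norm (s *\<^sub>R u) < min d1 d2"
        using small[OF that] hc norm_ge_zero[of "s *\<^sub>R u"] norm_ge_zero[of "s *\<^sub>R u + h *\<^sub>R v"]
        by linarith+
      then show "norm (s *\<^sub>R u + h *\<^sub>R v) < d1" "norm (s *\<^sub>R u) < d1" by auto
      have "dist x (x + s *\<^sub>R u + h *\<^sub>R v) = norm (s *\<^sub>R u + h *\<^sub>R v)"
        "dist x (x + s *\<^sub>R u) = norm (s *\<^sub>R u)"
        by (metis add.assoc dist_commute dist_norm add_diff_cancel_left')+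
      then show "x + s *\<^sub>R u + h *\<^sub>R v \<in> D" "x + s *\<^sub>R u \<in> D" using b d2(2) by auto
    qed
    \<comment> \<open>the term \<open>s h A v\<close> is subtracted so that the derivative of \<open>q\<close> is small\<close>
    define q where "q s = \<phi> (x + s *\<^sub>R u + h *\<^sub>R v) - \<phi> (x + s *\<^sub>R u) - (s * h) *\<^sub>R A v" for s
    have q': "(q has_derivative (\<lambda>r. r *\<^sub>R (\<phi>' (x + s *\<^sub>R u + h *\<^sub>R v) u - \<phi>' (x + s *\<^sub>R u) u - h *\<^sub>R A v)))
        (at s within {0..h})" if "s \<in> {0..h}" for s
    proof -
      have D1: "((\<lambda>s. \<phi> (x + s *\<^sub>R u + h *\<^sub>R v)) has_derivative (\<lambda>r. \<phi>' (x + s *\<^sub>R u + h *\<^sub>R v) (r *\<^sub>R u)))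
        (at s within {0..h})"
        by (rule has_derivative_compose[where f = "\<lambda>s. x + s *\<^sub>R u + h *\<^sub>R v", OF _ assms(3)[OF inD(1)[of s]]])
           (use that in \<open>auto intro!: derivative_eq_intros\<close>)
      have D2: "((\<lambda>s. \<phi> (x + s *\<^sub>R u)) has_derivative (\<lambda>r. \<phi>' (x + s *\<^sub>R u) (r *\<^sub>R u)))
        (at s within {0..h})"
        by (rule has_derivative_compose[where f = "\<lambda>s. x + s *\<^sub>R u", OF _ assms(3)[OF inD(2)[of s]]])
           (use that in \<open>auto intro!: derivative_eq_intros\<close>)
      have l: "linear (\<phi>' (x + s *\<^sub>R u + h *\<^sub>R v))" "linear (\<phi>' (x + s *\<^sub>R u))"
        using assms(3) inD that has_derivative_linear by (metis atLeastAtMost_iff)+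
      show ?thesis unfolding q_def
        by (rule has_derivative_eq_rhs[OF has_derivative_diff[OF has_derivative_diff[OF D1 D2]]])
           (auto intro!: derivative_eq_intros simp: linear_cmul[OF l(1)] linear_cmul[OF l(2)] fun_eq_iff
              scaleR_diff_right mult.commute)
    qed
    have "norm (q h - q 0) \<le> (\<epsilon> * h) * norm (h - 0)"
    proof (rule differentiable_bound[OF convex_real_interval(5) q'])
      fix s assume s: "s \<in> {0..h}"
      let ?w1 = "x + s *\<^sub>R u + h *\<^sub>R v" and ?w2 = "x + s *\<^sub>R u"
      have "norm (\<phi>' ?w1 u - \<phi>' ?w2 u - h *\<^sub>R A v) =
        norm ((\<phi>' ?w1 u - \<phi>' x u - A (?w1 - x)) - (\<phi>' ?w2 u - \<phi>' x u - A (?w2 - x)))"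
        using bl by (simp add: linear_add linear_cmul linear_diff algebra_simps)
      also have "\<dots> \<le> \<epsilon> / c * norm (?w1 - x) + \<epsilon> / c * norm (?w2 - x)"
        by (rule order.trans[OF norm_triangle_ineq4 add_mono[OF d1(2) d1(2)]])
           (use n1[of s] s in \<open>simp_all add: add.assoc\<close>)
      also have "\<dots> = \<epsilon> / c * (norm (s *\<^sub>R u + h *\<^sub>R v) + norm (s *\<^sub>R u))"
        by (simp add: algebra_simps)
      also have "\<dots> \<le> \<epsilon> / c * (h * c)"
        using small[of s] s e by (intro mult_left_mono) auto
      also have "\<dots> = \<epsilon> * h" using c by simp
      finally have "norm (\<phi>' ?w1 u - \<phi>' ?w2 u - h *\<^sub>R A v) \<le> \<epsilon> * h" .
      then show "onorm (\<lambda>r. r *\<^sub>R (\<phi>' ?w1 u - \<phi>' ?w2 u - h *\<^sub>R A v)) \<le> \<epsilon> * h"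
        by (intro onorm_le) (auto simp: mult.commute mult_left_mono)
    qed (use h in auto)
    then show ?thesis using h by (simp add: q_def power2_eq_square algebra_simps)
  qed
  then show ?thesis using \<delta> by blast
qed

text \<open>
  The second difference is symmetric in \<open>u\<close> and \<open>v\<close>, so both mixed derivatives are its limit
  after division by \<open>h\<^sup>2\<close>.
\<close>

lemma symmetric_second_derivative:
  fixes \<phi> :: "'a::real_normed_vector \<Rightarrow> 'b::real_normed_vector"
  assumes "open D" "x \<in> D" "\<And>z. z \<in> D \<Longrightarrow> (\<phi> has_derivative \<phi>' z) (at z)"
    and "((\<lambda>z. \<phi>' z u) has_derivative A) (at x)" "((\<lambda>z. \<phi>' z v) has_derivative B) (at x)"
  shows "A v = B u"
proof (rule ccontr)
  assume "A v \<noteq> B u"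
  define \<epsilon> where "\<epsilon> = norm (A v - B u) / 4"
  have e: "\<epsilon> > 0" using \<open>A v \<noteq> B u\<close> by (simp add: \<epsilon>_def)
  obtain d1 where d1: "d1 > 0" "\<And>h. 0 < h \<Longrightarrow> h < d1 \<Longrightarrow>
    norm (\<phi> (x + h *\<^sub>R u + h *\<^sub>R v) - \<phi> (x + h *\<^sub>R u) - \<phi> (x + h *\<^sub>R v) + \<phi> x - h\<^sup>2 *\<^sub>R A v) \<le> \<epsilon> * h\<^sup>2"
    using second_difference_estimate[OF assms(1-4) e] by blast
  obtain d2 where d2: "d2 > 0" "\<And>h. 0 < h \<Longrightarrow> h < d2 \<Longrightarrow>
    norm (\<phi> (x + h *\<^sub>R v + h *\<^sub>R u) - \<phi> (x + h *\<^sub>R v) - \<phi> (x + h *\<^sub>R u) + \<phi> x - h\<^sup>2 *\<^sub>R B u) \<le> \<epsilon> * h\<^sup>2"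
    using second_difference_estimate[OF assms(1-3,5) e] by blast
  define h where "h = min d1 d2 / 2"
  have h: "0 < h" "h < d1" "h < d2" using d1(1) d2(1) by (auto simp: h_def)
  let ?\<Delta> = "\<phi> (x + h *\<^sub>R u + h *\<^sub>R v) - \<phi> (x + h *\<^sub>R u) - \<phi> (x + h *\<^sub>R v) + \<phi> x"
  have "norm (?\<Delta> - h\<^sup>2 *\<^sub>R A v) \<le> \<epsilon> * h\<^sup>2" using d1(2) h by blast
  moreover have "norm (?\<Delta> - h\<^sup>2 *\<^sub>R B u) \<le> \<epsilon> * h\<^sup>2"
    using d2(2)[OF h(1,3)] by (simp add: algebra_simps)
  ultimately have "norm (h\<^sup>2 *\<^sub>R A v - h\<^sup>2 *\<^sub>R B u) \<le> 2 * \<epsilon> * h\<^sup>2"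
    using norm_triangle_ineq4[of "?\<Delta> - h\<^sup>2 *\<^sub>R B u" "?\<Delta> - h\<^sup>2 *\<^sub>R A v"] by (simp add: algebra_simps)
  then have "norm (A v - B u) * h\<^sup>2 \<le> 2 * \<epsilon> * h\<^sup>2"
    by (simp add: scaleR_diff_right[symmetric] mult.commute)
  then have "norm (A v - B u) \<le> 2 * \<epsilon>" using h by simp
  then show False using e by (simp add: \<epsilon>_def)
qed

text \<open>
  The product rule for \<open>z \<mapsto> D\<phi>(z)(Y z)\<close>.  In coordinates only the derivatives of \<open>\<phi>\<close> in fixed
  directions have to be differentiated, as the class \<open>C\<^sup>2\<close> is defined by these.
\<close>

lemma lie_derivative_has_derivative:
  assumes D: "open D" "x \<in> D" and \<phi>: "\<phi> \<in> Cb (Suc (Suc 0)) D" and Y: "Y differentiable (at x)"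
  shows "(lie_derivative Y \<phi> has_derivative (\<lambda>v. frechet_derivative \<phi> (at x) (frechet_derivative Y (at x) v)
    + frechet_derivative (\<lambda>z. frechet_derivative \<phi> (at z) (Y x)) (at x) v)) (at x)"
proof -
  let ?d = "\<lambda>i z. frechet_derivative \<phi> (at z) (axis i 1)"
  have dd: "(?d i has_derivative frechet_derivative (?d i) (at x)) (at x)" for i
    using \<phi> D(2) by (simp add: frechet_derivative_works)
  have dY: "(Y has_derivative frechet_derivative Y (at x)) (at x)"
    using Y by (simp add: frechet_derivative_works)
  have lin: "linear (frechet_derivative \<phi> (at z))" if "z \<in> D" for z
    using \<phi> that by (intro linear_frechet_derivative) simp
  have ex: "frechet_derivative \<phi> (at z) w = (\<Sum>i\<in>UNIV. (w $ i) *\<^sub>R ?d i z)" if "z \<in> D" for z w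
    by (rule linear_expand_axis[OF lin[OF that]])
  have "((\<lambda>z. \<Sum>i\<in>UNIV. (Y x $ i) *\<^sub>R ?d i z) has_derivative
     (\<lambda>v. \<Sum>i\<in>UNIV. (Y x $ i) *\<^sub>R frechet_derivative (?d i) (at x) v)) (at x)"
    using dd by (intro has_derivative_sum has_derivative_scaleR_right)
  then have "((\<lambda>z. frechet_derivative \<phi> (at z) (Y x)) has_derivative
     (\<lambda>v. \<Sum>i\<in>UNIV. (Y x $ i) *\<^sub>R frechet_derivative (?d i) (at x) v)) (at x)"
    by (rule has_derivative_transform_within_open[OF _ D]) (simp add: ex)
  from frechet_derivative_at[OF this]
  have 1: "frechet_derivative (\<lambda>z. frechet_derivative \<phi> (at z) (Y x)) (at x)
     = (\<lambda>v. \<Sum>i\<in>UNIV. (Y x $ i) *\<^sub>R frechet_derivative (?d i) (at x) v)" by simp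
  have "((\<lambda>z. \<Sum>i\<in>UNIV. (Y z $ i) *\<^sub>R ?d i z) has_derivative
     (\<lambda>v. \<Sum>i\<in>UNIV. (Y x $ i) *\<^sub>R frechet_derivative (?d i) (at x) v
        + (frechet_derivative Y (at x) v $ i) *\<^sub>R ?d i x)) (at x)"
    by (intro has_derivative_sum component_scaleR_has_derivative dY dd)
  then have "(lie_derivative Y \<phi> has_derivative
     (\<lambda>v. \<Sum>i\<in>UNIV. (Y x $ i) *\<^sub>R frechet_derivative (?d i) (at x) v
        + (frechet_derivative Y (at x) v $ i) *\<^sub>R ?d i x)) (at x)"
    by (rule has_derivative_transform_within_open[OF _ D]) (simp add: ex lie_derivative_def)
  then show ?thesis
    by (rule has_derivative_eq_rhs) (simp add: 1 ex[OF D(2), of "frechet_derivative Y (at x) _"] sum.distrib add.commute)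
qed

text \<open>
  In \<open>L\<^sub>X L\<^sub>Y \<phi> - L\<^sub>Y L\<^sub>X \<phi>\<close> the second derivatives of \<open>\<phi>\<close> cancel by symmetry; what remains is
  \<open>D\<phi>\<close> applied to the bracket.
\<close>

lemma lie_derivative_lie_bracket:
  assumes D: "open D" "x \<in> D" and \<phi>: "\<phi> \<in> Cb (Suc (Suc 0)) D"
    and X: "X differentiable (at x)" and Y: "Y differentiable (at x)"
  shows "lie_derivative (lie_bracket X Y) \<phi> x
    = lie_derivative X (lie_derivative Y \<phi>) x - lie_derivative Y (lie_derivative X \<phi>) x"
proof -
  let ?H = "\<lambda>w. frechet_derivative (\<lambda>z. frechet_derivative \<phi> (at z) w) (at x)"
  \<comment> \<open>the two second-order terms, with the values of \<open>X\<close> and \<open>Y\<close> at \<open>x\<close> frozen\<close>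
  have sym: "?H (Y x) (X x) = ?H (X x) (Y x)"
    by (rule symmetric_second_derivative[OF D, where \<phi> = \<phi> and \<phi>' = "\<lambda>z. frechet_derivative \<phi> (at z)"])
       (use \<phi> D(2) in \<open>auto simp: frechet_derivative_works\<close>)
  have lin: "linear (frechet_derivative \<phi> (at x))"
    using \<phi> D(2) by (intro linear_frechet_derivative) simp
  show ?thesis
    unfolding lie_derivative_def[of X "lie_derivative Y \<phi>"] lie_derivative_def[of Y "lie_derivative X \<phi>"]
    unfolding frechet_derivative_at[OF lie_derivative_has_derivative[OF D \<phi> X], symmetric]
      frechet_derivative_at[OF lie_derivative_has_derivative[OF D \<phi> Y], symmetric]
    using sym lin by (simp add: lie_derivative_def lie_bracket_def linear_diff)
qed

section \<open>Formal series in noncommuting letters\<close>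

text \<open>
  A word \<open>[i\<^sub>1, \<dots>, i\<^sub>r]\<close> stands for the operator \<open>L\<^sub>i\<^sub>1 \<dots> L\<^sub>i\<^sub>r\<close>.  A wrapper type over the coefficient
  functions makes the series a ring, so that commutator identities are plain ring algebra.
\<close>

typedef 'm ncseries = "UNIV :: ('m list \<Rightarrow> real) set"
  morphisms ncs_nth Abs_ncseries ..

setup_lifting type_definition_ncseries

lemma ncseries_eqI: "(\<And>w. ncs_nth a w = ncs_nth b w) \<Longrightarrow> a = b"
  by (simp add: ncs_nth_inject[symmetric] fun_eq_iff)

instantiation ncseries :: (type) ring_1
begin

lift_definition zero_ncseries :: "'a ncseries" is "\<lambda>w. 0" .
lift_definition one_ncseries :: "'a ncseries" is "\<lambda>w. if w = [] then 1 else 0" .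
lift_definition plus_ncseries :: "'a ncseries \<Rightarrow> 'a ncseries \<Rightarrow> 'a ncseries"
  is "\<lambda>a b w. a w + b w" .
lift_definition uminus_ncseries :: "'a ncseries \<Rightarrow> 'a ncseries" is "\<lambda>a w. - a w" .
lift_definition minus_ncseries :: "'a ncseries \<Rightarrow> 'a ncseries \<Rightarrow> 'a ncseries"
  is "\<lambda>a b w. a w - b w" .
lift_definition times_ncseries :: "'a ncseries \<Rightarrow> 'a ncseries \<Rightarrow> 'a ncseries"
  is "\<lambda>a b w. \<Sum>i\<le>length w. a (take i w) * b (drop i w)" .

instance
proof
  fix a b c :: "'a ncseries"
  show "a * b * c = a * (b * c)"
  proof (rule ncseries_eqI)
    fix w :: "'a list"
    let ?n = "length w"
    define F where "F i j (l::nat) = ncs_nth a (take i w) * ncs_nth b (take j (drop i w)) * ncs_nth c (drop (i + j) w)"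
      for i j l
    have "ncs_nth (a * b * c) w = (\<Sum>j\<le>?n. \<Sum>i\<le>j. F i (j - i) (?n - j))"
      unfolding times_ncseries.rep_eq F_def
      by (intro sum.cong refl) (auto simp: sum_distrib_right min_def drop_take intro!: sum.cong)
    also have "\<dots> = (\<Sum>j\<le>?n. \<Sum>i\<le>?n - j. F j i (?n - j - i))"
      using fps_mult_assoc_lemma[of F ?n ?n] by (simp add: atMost_atLeast0)
    also have "\<dots> = ncs_nth (a * (b * c)) w"
      unfolding times_ncseries.rep_eq F_def
      by (intro sum.cong refl) (auto simp: sum_distrib_left mult.assoc add.commute intro!: sum.cong)
    finally show "ncs_nth (a * b * c) w = ncs_nth (a * (b * c)) w" .
  qed
  show "1 * a = a"
  proof (rule ncseries_eqI)
    fix w :: "'a list"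
    have "ncs_nth (1 * a) w = (\<Sum>i\<le>length w. if i = 0 then ncs_nth a (drop i w) else 0)"
      unfolding times_ncseries.rep_eq one_ncseries.rep_eq by (intro sum.cong refl) auto
    then show "ncs_nth (1 * a) w = ncs_nth a w" by (simp add: sum.delta)
  qed
  show "a * 1 = a"
  proof (rule ncseries_eqI)
    fix w :: "'a list"
    have "ncs_nth (a * 1) w = (\<Sum>i\<le>length w. if i = length w then ncs_nth a (take i w) else 0)"
      unfolding times_ncseries.rep_eq one_ncseries.rep_eq by (intro sum.cong refl) auto
    then show "ncs_nth (a * 1) w = ncs_nth a w" by (simp add: sum.delta)
  qed
  show "(a + b) * c = a * c + b * c" "a * (b + c) = a * b + a * c"
    by (transfer, auto simp: fun_eq_iff algebra_simps sum.distrib)+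
  show "(0::'a ncseries) \<noteq> 1" by transfer (auto simp: fun_eq_iff)
qed (transfer, auto simp: fun_eq_iff)+

end

text \<open>
  The filtration by word length: such a series contributes terms of order \<open>t\<^sup>d\<close> and higher.
\<close>

definition vanishes_below :: "nat \<Rightarrow> 'm ncseries \<Rightarrow> bool" where
  "vanishes_below d c \<longleftrightarrow> (\<forall>w. length w < d \<longrightarrow> ncs_nth c w = 0)"

lemma vanishes_below_antimono: "vanishes_below e c \<Longrightarrow> d \<le> e \<Longrightarrow> vanishes_below d c"
  by (auto simp: vanishes_below_def)

lemma vanishes_below_add: "vanishes_below d a \<Longrightarrow> vanishes_below d b \<Longrightarrow> vanishes_below d (a + b)"
  by (auto simp: vanishes_below_def plus_ncseries.rep_eq)

lemma vanishes_below_diff: "vanishes_below d a \<Longrightarrow> vanishes_below d b \<Longrightarrow> vanishes_below d (a - b)"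
  by (auto simp: vanishes_below_def minus_ncseries.rep_eq)

lemma vanishes_below_mult:
  fixes a b :: "'m ncseries"
  assumes "vanishes_below d a" "vanishes_below e b"
  shows "vanishes_below (d + e) (a * b)"
  unfolding vanishes_below_def times_ncseries.rep_eq
proof (intro allI impI sum.neutral ballI)
  fix w :: "'m list" and i assume "length w < d + e" "i \<in> {..length w}"
  then have "length (take i w) < d \<or> length (drop i w) < e" by auto
  then show "ncs_nth a (take i w) * ncs_nth b (drop i w) = 0"
    using assms by (auto simp: vanishes_below_def)
qed

lemma vanishes_below_mult_right: "vanishes_below d a \<Longrightarrow> vanishes_below d (a * b)"
  using vanishes_below_mult[of d a 0 b] by (simp add: vanishes_below_def)

lemma vanishes_below_0: "vanishes_below d 0"
  by (simp add: vanishes_below_def zero_ncseries.rep_eq)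

lift_definition ncs_letter :: "'m \<Rightarrow> 'm ncseries" is "\<lambda>i w. if w = [i] then 1 else 0" .

text \<open>
  The exponential of \<open>s\<close> times the letter \<open>i\<close>: its words are the powers of that letter.
\<close>

lift_definition ncs_exp :: "real \<Rightarrow> 'm \<Rightarrow> 'm ncseries"
  is "\<lambda>s i w. if set w \<subseteq> {i} then s ^ length w / fact (length w) else 0" .

lemma sum_powers_over_factorials:
  fixes s r :: real
  shows "(\<Sum>k\<le>n. (s ^ k / fact k) * (r ^ (n - k) / fact (n - k))) = (s + r) ^ n / fact n"
proof -
  have "(s + r) ^ n / fact n = (\<Sum>k\<le>n. of_nat (n choose k) * s ^ k * r ^ (n - k) / fact n)"
    unfolding binomial_ring sum_divide_distrib ..
  also have "\<dots> = (\<Sum>k\<le>n. (s ^ k / fact k) * (r ^ (n - k) / fact (n - k)))"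
    by (intro sum.cong refl) (simp add: binomial_fact field_simps)
  finally show ?thesis ..
qed

text \<open>
  On a power of the letter \<open>i\<close> the product is the binomial expansion of \<open>(s - s)\<^sup>n / n!\<close>.
\<close>

lemma ncs_exp_inverse: "ncs_exp s i * ncs_exp (- s) i = 1"
proof (rule ncseries_eqI)
  fix w
  show "ncs_nth (ncs_exp s i * ncs_exp (- s) i) w = ncs_nth 1 w"
  proof (cases "set w \<subseteq> {i}")
    case True
    have sub: "set (take k w) \<subseteq> {i}" "set (drop k w) \<subseteq> {i}" for k
      using True set_take_subset[of k w] set_drop_subset[of k w] by auto
    have "ncs_nth (ncs_exp s i * ncs_exp (- s) i) w =
        (\<Sum>k\<le>length w. (s ^ k / fact k) * ((- s) ^ (length w - k) / fact (length w - k)))"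
      unfolding times_ncseries.rep_eq ncs_exp.rep_eq
      by (intro sum.cong refl) (simp add: sub min_def)
    also have "\<dots> = ncs_nth 1 w"
      unfolding sum_powers_over_factorials by (simp add: one_ncseries.rep_eq power_0_left)
    finally show ?thesis .
  next
    case False
    have "\<not> (set (take k w) \<subseteq> {i} \<and> set (drop k w) \<subseteq> {i})" for k
      using False set_append[of "take k w" "drop k w"] by (metis Un_least append_take_drop_id)
    then have "ncs_nth (ncs_exp s i * ncs_exp (- s) i) w = 0"
      unfolding times_ncseries.rep_eq ncs_exp.rep_eq by (intro sum.neutral) auto
    then show ?thesis using False by (auto simp: one_ncseries.rep_eq)
  qed
qed

lemma ncs_exp_first_order:
  "vanishes_below 2 (ncs_exp 1 i - 1 - ncs_letter i)"
  unfolding vanishes_below_def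
  by (auto simp: less_2_cases_iff length_Suc_conv ncs_exp.rep_eq ncs_letter.rep_eq
      one_ncseries.rep_eq minus_ncseries.rep_eq)

lemma ncs_exp_zeroth_order: "vanishes_below 1 (ncs_exp s i - 1)"
  by (auto simp: vanishes_below_def ncs_exp.rep_eq one_ncseries.rep_eq minus_ncseries.rep_eq)

text \<open>
  A pair \<open>(s, i)\<close> prescribes following \<open>s f\<^sub>i\<close>.  The first letter of the control
  word is followed first, and its operator stands outermost.
\<close>

primrec word_series :: "(real \<times> 'm) list \<Rightarrow> 'm ncseries" where
  "word_series [] = 1"
| "word_series (p # ps) = ncs_exp (fst p) (snd p) * word_series ps"

definition inverse_word :: "(real \<times> 'm) list \<Rightarrow> (real \<times> 'm) list" where
  "inverse_word ps = rev (map (\<lambda>p. (- fst p, snd p)) ps)"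

text \<open>
  The order of the four factors fits the convention \<open>[X, Y] = L\<^sub>X L\<^sub>Y - L\<^sub>Y L\<^sub>X\<close> together with
  the first letter acting outermost; the opposite order would produce the negated bracket.
\<close>

primrec bracket_word :: "'m bracket \<Rightarrow> (real \<times> 'm) list" where
  "bracket_word (Field i) = [(1, i)]"
| "bracket_word (Br b c) =
     bracket_word b @ bracket_word c @ inverse_word (bracket_word b) @ inverse_word (bracket_word c)"

primrec lie_polynomial :: "'m bracket \<Rightarrow> 'm ncseries" where
  "lie_polynomial (Field i) = ncs_letter i"
| "lie_polynomial (Br b c) =
     lie_polynomial b * lie_polynomial c - lie_polynomial c * lie_polynomial b"

lemma word_series_append: "word_series (ps @ qs) = word_series ps * word_series qs"
  by (induction ps) (auto simp: mult.assoc)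

lemma word_series_inverse_word: "word_series ps * word_series (inverse_word ps) = 1"
proof (induction ps)
  case Nil then show ?case by (simp add: inverse_word_def)
next
  case (Cons p ps)
  have "word_series (p # ps) * word_series (inverse_word (p # ps))
      = ncs_exp (fst p) (snd p) * (word_series ps * word_series (inverse_word ps)) * ncs_exp (- fst p) (snd p)"
    by (simp add: inverse_word_def word_series_append mult.assoc)
  then show ?case by (simp add: Cons.IH ncs_exp_inverse)
qed

lemma word_series_zeroth_order: "vanishes_below 1 (word_series ps - 1)"
proof (induction ps)
  case Nil then show ?case by (simp add: vanishes_below_0)
next
  case (Cons p ps)
  have "word_series (p # ps) - 1 = (ncs_exp (fst p) (snd p) - 1) * word_series ps + (word_series ps - 1)"
    by (simp add: algebra_simps)
  then show ?case
    using vanishes_below_add[OF vanishes_below_mult_right[OF ncs_exp_zeroth_order] Cons.IH] by metis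
qed

lemma bracket_degree_pos: "bracket_degree b \<ge> 1"
  by (induction b) auto

lemma bracket_word_sign: "\<forall>p\<in>set (bracket_word b). fst p = 1 \<or> fst p = - 1"
  by (induction b) (auto simp: inverse_word_def)

lemma bracket_word_nonempty: "bracket_word b \<noteq> []"
  by (induction b) auto

lemma lie_polynomial_vanishes_below: "vanishes_below (bracket_degree b) (lie_polynomial b)"
proof (induction b)
  case (Field i) then show ?case by (auto simp: vanishes_below_def ncs_letter.rep_eq)
next
  case (Br b c)
  then show ?case
    using vanishes_below_mult[OF Br.IH(1) Br.IH(2)] vanishes_below_mult[OF Br.IH(2) Br.IH(1)]
    by (auto intro!: vanishes_below_diff simp: add.commute)
qed

lemma lie_polynomial_homogeneous: "length w \<noteq> bracket_degree b \<Longrightarrow> ncs_nth (lie_polynomial b) w = 0"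
proof (induction b arbitrary: w)
  case (Field i) then show ?case by (auto simp: ncs_letter.rep_eq)
next
  case (Br b c)
  have "ncs_nth (lie_polynomial b) (take i w) * ncs_nth (lie_polynomial c) (drop i w) = 0"
    "ncs_nth (lie_polynomial c) (take i w) * ncs_nth (lie_polynomial b) (drop i w) = 0" if "i \<le> length w" for i
  proof -
    have "length (take i w) \<noteq> bracket_degree b \<or> length (drop i w) \<noteq> bracket_degree c"
      "length (take i w) \<noteq> bracket_degree c \<or> length (drop i w) \<noteq> bracket_degree b"
      using Br.prems that by auto
    then show "ncs_nth (lie_polynomial b) (take i w) * ncs_nth (lie_polynomial c) (drop i w) = 0"
      "ncs_nth (lie_polynomial c) (take i w) * ncs_nth (lie_polynomial b) (drop i w) = 0"
      using Br.IH by (metis mult_eq_0_iff)+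
  qed
  then have "(\<Sum>i\<le>length w. ncs_nth (lie_polynomial b) (take i w) * ncs_nth (lie_polynomial c) (drop i w)) = 0"
    "(\<Sum>i\<le>length w. ncs_nth (lie_polynomial c) (take i w) * ncs_nth (lie_polynomial b) (drop i w)) = 0"
    by (auto intro!: sum.neutral)
  then show ?case by (simp add: minus_ncseries.rep_eq times_ncseries.rep_eq)
qed

text \<open>
  For series \<open>B\<close>, \<open>C\<close> with inverses \<open>B'\<close>, \<open>C'\<close>, the series of the commutator word satisfies
  \<open>BCB'C' - 1 = (BC - CB) B'C' = [B - 1, C - 1] B'C'\<close>.  By induction \<open>B - 1\<close> and \<open>C - 1\<close> are the two
  Lie polynomials up to longer words, and \<open>B'C'\<close> is 1 up to nonempty words.
\<close>

theorem bracket_word_series: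
  "vanishes_below (bracket_degree b + 1) (word_series (bracket_word b) - 1 - lie_polynomial b)"
proof (induction b)
  case (Field i) then show ?case using ncs_exp_first_order[of i] by (simp add: numeral_2_eq_2)
next
  case (Br b c)
  let ?d = "bracket_degree b" and ?e = "bracket_degree c"
  define B C B' C' where "B = word_series (bracket_word b)" and "C = word_series (bracket_word c)"
    and "B' = word_series (inverse_word (bracket_word b))" and "C' = word_series (inverse_word (bracket_word c))"
  define p q where "p = lie_polynomial b" and "q = lie_polynomial c"
  define R S where "R = B - 1 - p" and "S = C - 1 - q"
  have vp: "vanishes_below ?d p" and vq: "vanishes_below ?e q"
    by (auto simp: p_def q_def lie_polynomial_vanishes_below)
  have vR: "vanishes_below (?d + 1) R" and vS: "vanishes_below (?e + 1) S"
    using Br.IH by (auto simp: R_def S_def B_def C_def p_def q_def)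
  have inv: "B * B' = 1" "C * C' = 1"
    by (auto simp: B_def B'_def C_def C'_def word_series_inverse_word)
  define r where "r = (p * S + R * q + R * S) - (q * R + S * p + S * R)"
  have W: "word_series (bracket_word (Br b c)) = B * C * (B' * C')"
    by (simp add: word_series_append B_def C_def B'_def C'_def mult.assoc)
  have one: "1 = C * B * (B' * C')"
    using inv by (metis mult.assoc mult.right_neutral)
  have comm: "B * C - C * B = (p * q - q * p) + r"
  proof -
    have "B = 1 + p + R" "C = 1 + q + S" by (auto simp: R_def S_def)
    then show ?thesis by (simp add: r_def algebra_simps)
  qed
  have "word_series (bracket_word (Br b c)) - 1 = (B * C - C * B) * (B' * C')"
    unfolding W by (subst one) (simp add: algebra_simps)
  then have eq: "word_series (bracket_word (Br b c)) - 1 - (p * q - q * p)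
      = (p * q - q * p) * (B' * C' - 1) + r * (B' * C')"
    unfolding comm by (simp add: algebra_simps)
  have v1: "vanishes_below (?d + ?e) (p * q - q * p)"
    using vanishes_below_mult[OF vp vq] vanishes_below_mult[OF vq vp]
    by (auto intro!: vanishes_below_diff simp: add.commute)
  have v2: "vanishes_below 1 (B' * C' - 1)"
    using word_series_zeroth_order[of "inverse_word (bracket_word b) @ inverse_word (bracket_word c)"]
    by (simp add: word_series_append B'_def C'_def)
  have v3: "vanishes_below (?d + ?e + 1) r"
    using vanishes_below_mult[OF vp vS] vanishes_below_mult[OF vR vq] vanishes_below_mult[OF vR vS]
      vanishes_below_mult[OF vS vp] vanishes_below_mult[OF vq vR] vanishes_below_mult[OF vS vR]
    unfolding r_def
    by (intro vanishes_below_diff vanishes_below_add) (auto elim: vanishes_below_antimono)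
  show ?case
    using vanishes_below_add[OF vanishes_below_mult[OF v1 v2] vanishes_below_mult_right[OF v3, of "B' * C'"]]
    unfolding eq[symmetric] by (simp add: p_def q_def)
qed

section \<open>Taylor expansion along a word of flows\<close>

definition word_derivative ::
    "('m \<Rightarrow> real ^ 'n \<Rightarrow> real ^ 'n) \<Rightarrow> 'm list \<Rightarrow> (real ^ 'n \<Rightarrow> real ^ 'n) \<Rightarrow> real ^ 'n \<Rightarrow> real ^ 'n" where
  "word_derivative f w \<phi> = foldr (\<lambda>i. lie_derivative (f i)) w \<phi>"

lemma word_derivative_simps [simp]:
  "word_derivative f [] \<phi> = \<phi>"
  "word_derivative f (i # w) \<phi> = lie_derivative (f i) (word_derivative f w \<phi>)"
  by (simp_all add: word_derivative_def)

lemma word_derivative_append: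
  "word_derivative f (v @ w) \<phi> = word_derivative f v (word_derivative f w \<phi>)"
  by (induction v) auto

text \<open>
  The differential operator of order at most \<open>j\<close> attached to a series, with \<open>t\<close> weighted by the length of the
  word.  The truncation at length \<open>j\<close> is what a map of class \<open>C\<^sup>j\<close> admits.
\<close>

definition series_action ::
    "('m::finite \<Rightarrow> real ^ 'n \<Rightarrow> real ^ 'n) \<Rightarrow> nat \<Rightarrow> real \<Rightarrow> 'm ncseries \<Rightarrow>
     (real ^ 'n \<Rightarrow> real ^ 'n) \<Rightarrow> real ^ 'n \<Rightarrow> real ^ 'n" where
  "series_action f j t c \<phi> x =
     (\<Sum>w | length w \<le> j. (ncs_nth c w * t ^ length w) *\<^sub>R word_derivative f w \<phi> x)"

lemma finite_words: "finite {w :: 'm::finite list. length w \<le> j}"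
  using finite_lists_length_le[of "UNIV :: 'm set" j] by simp

text \<open>
  Splitting each word of length at most \<open>j\<close> in all possible ways.  The truncation order of the
  left factor drops by the length of the right part, as does the smoothness of the map it acts on.
\<close>

lemma series_action_mult:
  "series_action f j t (a * b) \<phi> x =
     (\<Sum>w | length w \<le> j. (ncs_nth b w * t ^ length w) *\<^sub>R
        series_action f (j - length w) t a (word_derivative f w \<phi>) x)"
proof -
  let ?g = "\<lambda>v w. (ncs_nth a v * ncs_nth b w * t ^ (length v + length w)) *\<^sub>R word_derivative f (v @ w) \<phi> x"
  have "series_action f j t (a * b) \<phi> x =
      (\<Sum>u | length u \<le> j. \<Sum>i\<le>length u. ?g (take i u) (drop i u))"
    unfolding series_action_def times_ncseries.rep_eq
    by (intro sum.cong refl) (auto simp: scaleR_sum_left sum_distrib_right intro!: sum.cong)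
  also have "\<dots> = (\<Sum>(u, i)\<in>(SIGMA u:{u. length u \<le> j}. {..length u}). ?g (take i u) (drop i u))"
    by (rule sum.Sigma) (auto simp: finite_words)
  also have "\<dots> = (\<Sum>(w, v)\<in>(SIGMA w:{w. length w \<le> j}. {v. length v \<le> j - length w}). ?g v w)"
    by (rule sum.reindex_bij_witness[of _ "\<lambda>(w, v). (v @ w, length v)" "\<lambda>(u, i). (drop i u, take i u)"]) auto
  also have "\<dots> = (\<Sum>w | length w \<le> j. \<Sum>v | length v \<le> j - length w. ?g v w)"
    by (rule sum.Sigma[symmetric]) (auto simp: finite_words)
  also have "\<dots> = (\<Sum>w | length w \<le> j. (ncs_nth b w * t ^ length w) *\<^sub>R
        series_action f (j - length w) t a (word_derivative f w \<phi>) x)"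
    unfolding series_action_def
    by (intro sum.cong refl)
       (auto simp: scaleR_sum_right word_derivative_append power_add mult_ac intro!: sum.cong)
  finally show ?thesis .
qed

lemma series_action_add:
  "series_action f j t (a + b) \<phi> x = series_action f j t a \<phi> x + series_action f j t b \<phi> x"
  by (simp add: series_action_def plus_ncseries.rep_eq algebra_simps sum.distrib)

lemma series_action_diff:
  "series_action f j t (a - b) \<phi> x = series_action f j t a \<phi> x - series_action f j t b \<phi> x"
  by (simp add: series_action_def minus_ncseries.rep_eq algebra_simps sum_subtractf)

lemma series_action_one:
  fixes f :: "'m::finite \<Rightarrow> real ^ 'n \<Rightarrow> real ^ 'n"
  shows "series_action f j t 1 \<phi> x = \<phi> x"
proof -
  have "series_action f j t 1 \<phi> x = (\<Sum>w\<in>{w :: 'm list. length w \<le> j}. if w = [] then \<phi> x else 0)"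
    unfolding series_action_def by (intro sum.cong refl) (auto simp: one_ncseries.rep_eq)
  then show ?thesis by (simp add: finite_words)
qed

lemma series_action_vanishing:
  "vanishes_below (Suc j) c \<Longrightarrow> series_action f j t c \<phi> x = 0"
  unfolding series_action_def vanishes_below_def by (intro sum.neutral) auto

lemma series_action_exp:
  "series_action f j t (ncs_exp s i) \<phi> x =
     (\<Sum>n\<le>j. (s ^ n / fact n * t ^ n) *\<^sub>R word_derivative f (replicate n i) \<phi> x)"
proof -
  let ?h = "\<lambda>w. (ncs_nth (ncs_exp s i) w * t ^ length w) *\<^sub>R word_derivative f w \<phi> x"
  have "series_action f j t (ncs_exp s i) \<phi> x = (\<Sum>w\<in>(\<lambda>n. replicate n i) ` {..j}. ?h w)"
    unfolding series_action_def
  proof (rule sum.mono_neutral_right[OF finite_words])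
    show "\<forall>w\<in>{w. length w \<le> j} - (\<lambda>n. replicate n i) ` {..j}. ?h w = 0"
    proof
      fix w assume w: "w \<in> {w. length w \<le> j} - (\<lambda>n. replicate n i) ` {..j}"
      have "\<not> set w \<subseteq> {i}"
      proof
        assume "set w \<subseteq> {i}"
        then have "w = replicate (length w) i" by (intro replicate_eqI) auto
        then show False using w by auto
      qed
      then show "?h w = 0" by (simp add: ncs_exp.rep_eq)
    qed
  qed auto
  also have "\<dots> = (\<Sum>n\<le>j. ?h (replicate n i))"
    by (subst sum.reindex) (auto simp: inj_on_def dest: arg_cong[of _ _ length])
  also have "\<dots> = (\<Sum>n\<le>j. (s ^ n / fact n * t ^ n) *\<^sub>R word_derivative f (replicate n i) \<phi> x)"
    by (intro sum.cong refl) (auto simp: ncs_exp.rep_eq)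
  finally show ?thesis .
qed

lemma series_action_homogeneous:
  "series_action f j t (lie_polynomial b) \<phi> x
     = t ^ bracket_degree b *\<^sub>R series_action f j 1 (lie_polynomial b) \<phi> x"
  unfolding series_action_def scaleR_sum_right
proof (intro sum.cong refl)
  fix w
  show "(ncs_nth (lie_polynomial b) w * t ^ length w) *\<^sub>R word_derivative f w \<phi> x =
    t ^ bracket_degree b *\<^sub>R (ncs_nth (lie_polynomial b) w * 1 ^ length w) *\<^sub>R word_derivative f w \<phi> x"
    by (cases "length w = bracket_degree b") (simp_all add: lie_polynomial_homogeneous mult.commute)
qed

definition integral_curve ::
    "('m \<Rightarrow> real ^ 'n \<Rightarrow> real ^ 'n) \<Rightarrow> (real ^ 'n) set \<Rightarrow> real \<Rightarrow> real \<times> 'm \<Rightarrow> (real \<Rightarrow> real ^ 'n) \<Rightarrow> bool" where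
  "integral_curve f C t p y \<longleftrightarrow> (\<forall>\<tau>\<in>{0..t}. y \<tau> \<in> C \<and>
     (y has_vector_derivative fst p *\<^sub>R f (snd p) (y \<tau>)) (at \<tau> within {0..t}))"

text \<open>
  All letters are followed for the same time \<open>t\<close>, which makes \<open>t\<close> the only expansion parameter.
  The relation allows for nonuniqueness: it holds for the end points of all chains of integral
  curves in \<open>C\<close>.
\<close>

primrec steers ::
    "('m \<Rightarrow> real ^ 'n \<Rightarrow> real ^ 'n) \<Rightarrow> (real ^ 'n) set \<Rightarrow> real \<Rightarrow> (real \<times> 'm) list \<Rightarrow>
     real ^ 'n \<Rightarrow> real ^ 'n \<Rightarrow> bool" where
  "steers f C t [] x z \<longleftrightarrow> z = x"
| "steers f C t (p # ps) x z \<longleftrightarrow> (\<exists>y. integral_curve f C t p y \<and> y 0 = x \<and> steers f C t ps (y t) z)"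

text \<open>
  Uniformity over the initial points in \<open>C\<close> and over all chains of integral curves is what the
  compactness arguments need.
\<close>

definition realizes ::
    "('m \<Rightarrow> real ^ 'n \<Rightarrow> real ^ 'n) \<Rightarrow> (real ^ 'n) set \<Rightarrow> (real \<times> 'm) list \<Rightarrow> nat \<Rightarrow>
     (real ^ 'n \<Rightarrow> real ^ 'n) \<Rightarrow> bool" where
  "realizes f C ps h X \<longleftrightarrow> (\<forall>\<epsilon>>0. \<exists>\<delta>>0. \<forall>t x z.
     0 \<le> t \<and> t < \<delta> \<and> x \<in> C \<and> steers f C t ps x z \<longrightarrow>
     norm (z - x - t ^ h *\<^sub>R X x) \<le> \<epsilon> * t ^ h)"

lemma integral_curve_mono: "integral_curve f C t p y \<Longrightarrow> C \<subseteq> C' \<Longrightarrow> integral_curve f C' t p y"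
  by (auto simp: integral_curve_def)

lemma steers_mono: "steers f C t ps x z \<Longrightarrow> C \<subseteq> C' \<Longrightarrow> steers f C' t ps x z"
  by (induction ps arbitrary: x) (auto intro: integral_curve_mono)

lemma integral_curve_restrict:
  assumes "integral_curve f C t p y" "t' \<le> t"
  shows "integral_curve f C t' p y"
proof -
  have "(y has_vector_derivative fst p *\<^sub>R f (snd p) (y \<tau>)) (at \<tau> within {0..t'})"
    if "\<tau> \<in> {0..t'}" for \<tau>
    by (rule has_vector_derivative_within_subset[of y _ _ "{0..t}"])
       (use assms that in \<open>auto simp: integral_curve_def\<close>)
  then show ?thesis using assms by (auto simp: integral_curve_def)
qed

lemma vector_derivative_bound:
  fixes g :: "real \<Rightarrow> 'a::real_normed_vector"
  assumes "\<And>\<tau>. \<tau> \<in> {a..b} \<Longrightarrow> (g has_vector_derivative g' \<tau>) (at \<tau> within {a..b})"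
    and "\<And>\<tau>. \<tau> \<in> {a..b} \<Longrightarrow> norm (g' \<tau>) \<le> B" and "u \<in> {a..b}" "v \<in> {a..b}"
  shows "norm (g v - g u) \<le> B * \<bar>v - u\<bar>"
proof -
  have "norm (g v - g u) \<le> B * norm (v - u)"
  proof (rule differentiable_bound[OF convex_real_interval(5)])
    show "(g has_derivative (\<lambda>r. r *\<^sub>R g' \<tau>)) (at \<tau> within {a..b})" if "\<tau> \<in> {a..b}" for \<tau>
      using assms(1)[OF that] by (simp add: has_vector_derivative_def)
    show "onorm (\<lambda>r. r *\<^sub>R g' \<tau>) \<le> B" if "\<tau> \<in> {a..b}" for \<tau>
      using assms(2)[OF that] by (intro onorm_le) (simp, metis abs_ge_zero mult.commute mult_right_mono)
  qed (use assms in auto)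
  then show ?thesis by simp
qed

lemma integral_curve_lipschitz:
  assumes "integral_curve f C t p y" "\<And>z. z \<in> C \<Longrightarrow> norm (f (snd p) z) \<le> M" "\<bar>fst p\<bar> \<le> 1"
    and "u \<in> {0..t}" "v \<in> {0..t}"
  shows "norm (y v - y u) \<le> M * \<bar>v - u\<bar>"
proof (rule vector_derivative_bound[OF _ _ assms(4,5)])
  fix \<tau> assume \<tau>: "\<tau> \<in> {0..t}"
  show "(y has_vector_derivative fst p *\<^sub>R f (snd p) (y \<tau>)) (at \<tau> within {0..t})"
    using assms(1) \<tau> by (simp add: integral_curve_def)
  have "norm (f (snd p) (y \<tau>)) \<le> M" using assms(1,2) \<tau> by (simp add: integral_curve_def)
  then have "\<bar>fst p\<bar> * norm (f (snd p) (y \<tau>)) \<le> 1 * M" using assms(3) by (intro mult_mono) auto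
  then show "norm (fst p *\<^sub>R f (snd p) (y \<tau>)) \<le> M" by simp
qed

locale Cb_fields =
  fixes f :: "'m::finite \<Rightarrow> real ^ 'n \<Rightarrow> real ^ 'n" and k :: nat and D :: "(real ^ 'n) set"
  assumes open_D: "open D" and fields_Cb: "f i \<in> Cb (k - 1) D"
begin

lemma Cb_word_derivative:
  assumes "\<phi> \<in> Cb j D" "length w \<le> j" "j \<le> k"
  shows "word_derivative f w \<phi> \<in> Cb (j - length w) D"
  using assms(2)
proof (induction w)
  case Nil then show ?case using assms by simp
next
  case (Cons i w)
  have "word_derivative f w \<phi> \<in> Cb (Suc (j - length (i # w))) D"
    using Cons by (simp add: Suc_diff_Suc del: Cb.simps)
  moreover have "f i \<in> Cb (j - length (i # w)) D"
    by (rule Cb_antimono[OF _ fields_Cb]) (use assms(3) in auto)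
  ultimately show ?case using Cb_lie_derivative[OF open_D] by (simp del: Cb.simps)
qed

lemma fields_bounded: "\<exists>M>0. \<forall>i. \<forall>x\<in>D. norm (f i x) \<le> M"
proof -
  have "bounded (\<Union>i. f i ` D)" using Cb_bounded[OF fields_Cb] by (intro bounded_UN) auto
  then obtain M where "M > 0" "\<forall>z\<in>(\<Union>i. f i ` D). norm z \<le> M" using bounded_pos by blast
  then show ?thesis by blast
qed

text \<open>
  Induction on \<open>j\<close>.  With \<open>p = (s, i)\<close>, the derivative of \<open>\<phi>\<close> along the curve is \<open>s L\<^sub>i \<phi>\<close>, and
  the derivative of the Taylor polynomial of \<open>\<phi>\<close> is the Taylor polynomial of \<open>s L\<^sub>i \<phi>\<close>, so the remainder of order
  \<open>j\<close> for \<open>L\<^sub>i \<phi>\<close> integrates to one of order \<open>j + 1\<close> for \<open>\<phi>\<close>.  For \<open>j = 0\<close> this is uniform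
  continuity.
\<close>

lemma integral_curve_expansion:
  assumes C: "compact C" "C \<subseteq> D" and p: "\<bar>fst p\<bar> \<le> 1"
    and "\<phi> \<in> Cb j D" "j \<le> k" "\<epsilon> > 0"
  shows "\<exists>\<delta>>0. \<forall>t y. 0 \<le> t \<and> t < \<delta> \<and> integral_curve f C t p y \<longrightarrow>
    norm (\<phi> (y t) - series_action f j t (ncs_exp (fst p) (snd p)) \<phi> (y 0)) \<le> \<epsilon> * t ^ j"
  using assms(4,5)
proof (induction j arbitrary: \<phi>)
  case 0
  have "uniformly_continuous_on C \<phi>"
    using C Cb_continuous[OF 0(1)] compact_uniformly_continuous continuous_on_subset by blast
  then obtain d where d: "d > 0" "\<And>u v. u \<in> C \<Longrightarrow> v \<in> C \<Longrightarrow> dist v u < d \<Longrightarrow> dist (\<phi> v) (\<phi> u) < \<epsilon>"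
    using \<open>\<epsilon> > 0\<close> unfolding uniformly_continuous_on_def by metis
  obtain M where M: "M > 0" "\<And>i x. x \<in> D \<Longrightarrow> norm (f i x) \<le> M" using fields_bounded by blast
  show ?case
  proof (intro exI[of _ "d / M"] conjI allI impI)
    fix t y assume t: "0 \<le> t \<and> t < d / M \<and> integral_curve f C t p y"
    have "norm (y t - y 0) \<le> M * \<bar>t - 0\<bar>"
      by (rule integral_curve_lipschitz[of f C t p]) (use t M C p in auto)
    also have "\<dots> < d" using t M(1) by (simp add: field_simps)
    finally have "dist (\<phi> (y t)) (\<phi> (y 0)) < \<epsilon>"
      using t by (intro d(2)) (auto simp: integral_curve_def dist_norm)
    then show "norm (\<phi> (y t) - series_action f 0 t (ncs_exp (fst p) (snd p)) \<phi> (y 0)) \<le> \<epsilon> * t ^ 0"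
      by (simp add: series_action_exp dist_norm)
  qed (use d M in auto)
next
  case (Suc j)
  obtain s i where p_eq: "p = (s, i)" by (cases p)
  define \<psi> where "\<psi> = lie_derivative (f i) \<phi>"
  have "f i \<in> Cb j D" by (rule Cb_antimono[OF _ fields_Cb]) (use Suc.prems(2) in auto)
  then have "\<psi> \<in> Cb j D" unfolding \<psi>_def using Cb_lie_derivative[OF open_D Suc.prems(1)] by blast
  then obtain \<delta> where \<delta>: "\<delta> > 0" "\<And>t y. 0 \<le> t \<Longrightarrow> t < \<delta> \<Longrightarrow> integral_curve f C t p y \<Longrightarrow>
    norm (\<psi> (y t) - series_action f j t (ncs_exp s i) \<psi> (y 0)) \<le> \<epsilon> * t ^ j"
    using Suc.IH[of \<psi>] Suc.prems(2) by (auto simp: p_eq)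
  have "norm (\<phi> (y t) - series_action f (Suc j) t (ncs_exp s i) \<phi> (y 0)) \<le> \<epsilon> * t ^ Suc j"
    if t: "0 \<le> t" "t < \<delta>" and y: "integral_curve f C t p y" for t y
  proof -
    \<comment> \<open>\<open>S\<close> is the Taylor polynomial of \<open>\<phi>\<close> along the curve; \<open>S'\<close> is its derivative\<close>
    define S where "S \<tau> = series_action f (Suc j) \<tau> (ncs_exp s i) \<phi> (y 0)" for \<tau>
    define S' where "S' \<tau> = s *\<^sub>R series_action f j \<tau> (ncs_exp s i) \<psi> (y 0)" for \<tau>
    have W: "word_derivative f (replicate (Suc n) i) \<phi> = word_derivative f (replicate n i) \<psi>" for n
      by (simp only: replicate_Suc replicate_append_same[symmetric] word_derivative_append) (simp add: \<psi>_def)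
    have S_eq: "S = (\<lambda>\<tau>. \<phi> (y 0) + (\<Sum>n\<le>j. (s ^ Suc n / fact (Suc n) * \<tau> ^ Suc n) *\<^sub>R
        word_derivative f (replicate n i) \<psi> (y 0)))"
      unfolding S_def series_action_exp sum.atMost_Suc_shift W by simp
    have S'_eq: "S' \<tau> = (\<Sum>n\<le>j. (s ^ Suc n / fact (Suc n) * (real (Suc n) * \<tau> ^ n)) *\<^sub>R
        word_derivative f (replicate n i) \<psi> (y 0))" for \<tau>
      unfolding S'_def series_action_exp scaleR_sum_right
      by (intro sum.cong refl) (simp add: field_simps del: of_nat_Suc)
    have dS: "(S has_vector_derivative S' \<tau>) (at \<tau> within {0..t})" for \<tau>
      unfolding S_eq S'_eq
      by (rule derivative_eq_intros refl | simp add: mult_ac)+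
    define g where "g \<tau> = \<phi> (y \<tau>) - S \<tau>" for \<tau>
    have dg: "(g has_vector_derivative s *\<^sub>R \<psi> (y \<tau>) - S' \<tau>) (at \<tau> within {0..t})" if "\<tau> \<in> {0..t}" for \<tau>
    proof -
      have yC: "y \<tau> \<in> D" and dy: "(y has_vector_derivative s *\<^sub>R f i (y \<tau>)) (at \<tau> within {0..t})"
        using y that C by (auto simp: integral_curve_def p_eq)
      have d\<phi>: "\<phi> differentiable (at (y \<tau>))" using Suc.prems(1) yC by simp
      then have "(\<phi> has_derivative frechet_derivative \<phi> (at (y \<tau>))) (at (y \<tau>))"
        by (simp add: frechet_derivative_works)
      from has_derivative_compose[OF dy[unfolded has_vector_derivative_def] this]
      have "((\<lambda>\<tau>. \<phi> (y \<tau>)) has_vector_derivative s *\<^sub>R \<psi> (y \<tau>)) (at \<tau> within {0..t})"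
        using linear_frechet_derivative[OF d\<phi>]
        by (simp add: has_vector_derivative_def \<psi>_def lie_derivative_def linear_cmul)
      then show ?thesis unfolding g_def using dS by (intro has_vector_derivative_diff) auto
    qed
    have "norm (g t - g 0) \<le> (\<epsilon> * t ^ j) * \<bar>t - 0\<bar>"
    proof (rule vector_derivative_bound[OF dg])
      fix \<tau> assume \<tau>: "\<tau> \<in> {0..t}"
      have "norm (\<psi> (y \<tau>) - series_action f j \<tau> (ncs_exp s i) \<psi> (y 0)) \<le> \<epsilon> * \<tau> ^ j"
        using \<tau> t integral_curve_restrict[OF y] by (intro \<delta>(2)) auto
      also have "\<dots> \<le> \<epsilon> * t ^ j" using \<tau> \<open>\<epsilon> > 0\<close> by (simp add: power_mono)
      finally have b: "norm (\<psi> (y \<tau>) - series_action f j \<tau> (ncs_exp s i) \<psi> (y 0)) \<le> \<epsilon> * t ^ j" .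
      have "norm (s *\<^sub>R \<psi> (y \<tau>) - S' \<tau>) = \<bar>s\<bar> * norm (\<psi> (y \<tau>) - series_action f j \<tau> (ncs_exp s i) \<psi> (y 0))"
        by (simp add: S'_def scaleR_diff_right[symmetric])
      also have "\<dots> \<le> 1 * (\<epsilon> * t ^ j)" using b p by (intro mult_mono) (auto simp: p_eq)
      finally show "norm (s *\<^sub>R \<psi> (y \<tau>) - S' \<tau>) \<le> \<epsilon> * t ^ j" by simp
    qed (use t in auto)
    moreover have "g 0 = 0" by (simp add: g_def S_eq)
    ultimately show ?thesis using t by (simp add: g_def S_def mult_ac)
  qed
  then show ?case using \<delta>(1) by (auto simp: p_eq)
qed

text \<open>
  Expand \<open>\<phi>\<close> from the end point back to the end of the first piece, then expand each word derivative
  occurring there along the first piece.  The word derivative of a word of length \<open>r\<close> is of class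
  \<open>C\<^sup>j\<^sup>-\<^sup>r\<close> and carries the factor \<open>t\<^sup>r\<close>, so all errors are \<open>o(t\<^sup>j)\<close>.
\<close>

lemma word_expansion:
  assumes C: "compact C" "C \<subseteq> D" and "\<phi> \<in> Cb j D" "j \<le> k" "\<epsilon> > 0"
    and "\<forall>p\<in>set ps. \<bar>fst p\<bar> \<le> 1"
  shows "\<exists>\<delta>>0. \<forall>t x z. 0 \<le> t \<and> t < \<delta> \<and> steers f C t ps x z \<longrightarrow>
    norm (\<phi> z - series_action f j t (word_series ps) \<phi> x) \<le> \<epsilon> * t ^ j"
  using assms(5,6)
proof (induction ps arbitrary: \<epsilon>)
  case Nil
  then show ?case by (auto intro!: exI[of _ 1] simp: series_action_one)
next
  case (Cons p ps)
  let ?S = "word_series ps" and ?E = "ncs_exp (fst p) (snd p)"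
  let ?W = "{w :: 'm list. length w \<le> j}"
  \<comment> \<open>each word has its own error \<open>\<epsilon>'\<close>, small enough for the weighted sum over all words\<close>
  define B where "B = 1 + (\<Sum>w\<in>?W. \<bar>ncs_nth ?S w\<bar>)"
  have B: "B > 0" unfolding B_def by (intro add_pos_nonneg sum_nonneg) auto
  define \<epsilon>' where "\<epsilon>' = \<epsilon> / 2 / B"
  have \<epsilon>': "\<epsilon>' > 0" using Cons.prems B by (simp add: \<epsilon>'_def)
  have \<epsilon>2: "\<epsilon> / 2 > 0" using Cons.prems by simp
  obtain d1 where d1: "d1 > 0" "\<And>t x z. 0 \<le> t \<Longrightarrow> t < d1 \<Longrightarrow> steers f C t ps x z \<Longrightarrow>
      norm (\<phi> z - series_action f j t ?S \<phi> x) \<le> \<epsilon> / 2 * t ^ j"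
    using Cons.IH[OF \<epsilon>2] Cons.prems(2) by auto
  have "\<forall>w\<in>?W. \<exists>\<delta>>0. \<forall>t y. 0 \<le> t \<and> t < \<delta> \<and> integral_curve f C t p y \<longrightarrow>
    norm (word_derivative f w \<phi> (y t) - series_action f (j - length w) t ?E (word_derivative f w \<phi>) (y 0))
      \<le> \<epsilon>' * t ^ (j - length w)"
    using integral_curve_expansion[OF C _ Cb_word_derivative[OF assms(3)] _ \<epsilon>', of p] Cons.prems(2) assms(4)
    by auto
  then obtain d where d: "\<And>w. w \<in> ?W \<Longrightarrow> d w > 0"
    "\<And>w t y. w \<in> ?W \<Longrightarrow> 0 \<le> t \<Longrightarrow> t < d w \<Longrightarrow> integral_curve f C t p y \<Longrightarrow>
    norm (word_derivative f w \<phi> (y t) - series_action f (j - length w) t ?E (word_derivative f w \<phi>) (y 0))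
      \<le> \<epsilon>' * t ^ (j - length w)"
    unfolding bchoice_iff by blast
  define \<delta> where "\<delta> = min d1 (Min (d ` ?W))"
  have ne: "?W \<noteq> {}" by (auto intro: exI[of _ "[]"])
  have \<delta>_le: "\<delta> \<le> d w" if "w \<in> ?W" for w
    using that finite_words[of j] by (auto simp: \<delta>_def intro!: min.coboundedI2 Min_le)
  have "Min (d ` ?W) > 0"
    by (subst Min_gr_iff) (use d(1) ne in \<open>auto simp: finite_words\<close>)
  then have \<delta>_pos: "\<delta> > 0" using d1(1) by (simp add: \<delta>_def)
  have "norm (\<phi> z - series_action f j t (word_series (p # ps)) \<phi> (y 0)) \<le> \<epsilon> * t ^ j"
    if t: "0 \<le> t" "t < \<delta>" and y: "integral_curve f C t p y" and z: "steers f C t ps (y t) z" for t y z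
  proof -
    let ?L = "\<lambda>w. word_derivative f w \<phi> (y t)"
    let ?R = "\<lambda>w. series_action f (j - length w) t ?E (word_derivative f w \<phi>) (y 0)"
    have 1: "norm (\<phi> z - series_action f j t ?S \<phi> (y t)) \<le> \<epsilon> / 2 * t ^ j"
      using d1(2)[OF t(1) _ z] t by (simp add: \<delta>_def)
    have "series_action f j t ?S \<phi> (y t) - series_action f j t (?E * ?S) \<phi> (y 0)
        = (\<Sum>w\<in>?W. (ncs_nth ?S w * t ^ length w) *\<^sub>R (?L w - ?R w))"
      unfolding series_action_mult by (simp add: series_action_def[of f j] sum_subtractf[symmetric] scaleR_diff_right)
    also have "norm \<dots> \<le> (\<Sum>w\<in>?W. \<bar>ncs_nth ?S w\<bar> * (\<epsilon>' * t ^ j))"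
    proof (rule sum_norm_le)
      fix w assume w: "w \<in> ?W"
      have "norm (?L w - ?R w) \<le> \<epsilon>' * t ^ (j - length w)"
        using d(2)[OF w t(1) _ y] \<delta>_le[OF w] t by simp
      then have "\<bar>ncs_nth ?S w\<bar> * t ^ length w * norm (?L w - ?R w)
          \<le> \<bar>ncs_nth ?S w\<bar> * t ^ length w * (\<epsilon>' * t ^ (j - length w))"
        using t by (intro mult_left_mono) auto
      also have "\<dots> = \<bar>ncs_nth ?S w\<bar> * (\<epsilon>' * (t ^ length w * t ^ (j - length w)))" by simp
      also have "t ^ length w * t ^ (j - length w) = t ^ j" using w by (simp add: power_add[symmetric])
      finally show "norm ((ncs_nth ?S w * t ^ length w) *\<^sub>R (?L w - ?R w)) \<le> \<bar>ncs_nth ?S w\<bar> * (\<epsilon>' * t ^ j)"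
        using t by (simp add: abs_mult)
    qed
    also have "\<dots> = (B - 1) * (\<epsilon>' * t ^ j)" by (simp add: B_def sum_distrib_right)
    also have "\<dots> \<le> B * (\<epsilon>' * t ^ j)" using \<epsilon>' t by (intro mult_right_mono) auto
    also have "\<dots> = \<epsilon> / 2 * t ^ j" using B by (simp add: \<epsilon>'_def)
    finally have 2: "norm (series_action f j t ?S \<phi> (y t) - series_action f j t (?E * ?S) \<phi> (y 0)) \<le> \<epsilon> / 2 * t ^ j" .
    have "norm (\<phi> z - series_action f j t (?E * ?S) \<phi> (y 0)) \<le> \<epsilon> / 2 * t ^ j + \<epsilon> / 2 * t ^ j"
      using norm_triangle_le[OF add_mono[OF 1 2]] by simp
    then show ?thesis by simp
  qed
  then show ?case using \<delta>_pos by auto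
qed

text \<open>
  Each bracket costs one derivative, and a factor of degree \<open>d\<close> can afford as many more as the degree
  of the other factor, which is at least 1.
\<close>

lemma bracket_value_Cb:
  "bracket_degree b \<le> k \<Longrightarrow> bracket_value f b \<in> Cb (k - bracket_degree b) D"
proof (induction b)
  case (Field i) then show ?case using fields_Cb by simp
next
  case (Br b c)
  have pos: "bracket_degree b \<ge> 1" "bracket_degree c \<ge> 1" by (rule bracket_degree_pos)+
  let ?j = "k - bracket_degree (Br b c)"
  have B: "bracket_value f b \<in> Cb (Suc ?j) D" and C: "bracket_value f c \<in> Cb (Suc ?j) D"
    by (rule Cb_antimono[OF _ Br.IH(1)] Cb_antimono[OF _ Br.IH(2)]; use Br.prems pos in simp)+
  have "(\<lambda>x. lie_derivative (bracket_value f b) (bracket_value f c) x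
      - lie_derivative (bracket_value f c) (bracket_value f b) x) \<in> Cb ?j D"
    by (intro Cb_diff Cb_lie_derivative open_D B C Cb_Suc_imp_Cb[OF B] Cb_Suc_imp_Cb[OF C])
  then show ?case by (simp add: lie_bracket_def[abs_def] lie_derivative_def)
qed

text \<open>
  Only the words of length \<open>bracket_degree c\<close> occur on the right, so the truncation order left for
  the other factor is the same for all of them and \<open>L\<^sub>B\<close> can be pulled out of the sum.
\<close>

lemma series_action_product_of_brackets:
  assumes x: "x \<in> D" and \<phi>: "\<phi> \<in> Cb j D" "j \<le> k" "bracket_degree b + bracket_degree c \<le> j"
    and b: "\<And>\<phi> j x. \<phi> \<in> Cb j D \<Longrightarrow> j \<le> k \<Longrightarrow> bracket_degree b \<le> j \<Longrightarrow> x \<in> D \<Longrightarrow>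
        series_action f j 1 (lie_polynomial b) \<phi> x = lie_derivative (bracket_value f b) \<phi> x"
    and c: "\<And>\<phi> j x. \<phi> \<in> Cb j D \<Longrightarrow> j \<le> k \<Longrightarrow> bracket_degree c \<le> j \<Longrightarrow> x \<in> D \<Longrightarrow>
        series_action f j 1 (lie_polynomial c) \<phi> x = lie_derivative (bracket_value f c) \<phi> x"
  shows "series_action f j 1 (lie_polynomial b * lie_polynomial c) \<phi> x
    = lie_derivative (bracket_value f b) (lie_derivative (bracket_value f c) \<phi>) x"
proof -
  let ?W = "{w :: 'm list. length w \<le> j}" and ?V = "{w :: 'm list. length w = bracket_degree c}"
  let ?p = "ncs_nth (lie_polynomial c)" and ?B = "bracket_value f b"
  have VW: "?V \<subseteq> ?W" using \<phi>(3) by auto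
  have finV: "finite ?V" using finite_subset[OF VW finite_words] .
  have zero: "?p w = 0" if "w \<in> ?W - ?V" for w
    using that by (auto intro: lie_polynomial_homogeneous)
  have d: "word_derivative f w \<phi> differentiable (at x)" if "w \<in> ?V" for w
  proof -
    have "word_derivative f w \<phi> \<in> Cb (Suc 0) D"
      by (rule Cb_antimono[OF _ Cb_word_derivative[OF \<phi>(1) _ \<phi>(2)]])
         (use that \<phi>(3) bracket_degree_pos[of b] in auto)
    then show ?thesis using x by simp
  qed
  have "series_action f j 1 (lie_polynomial b * lie_polynomial c) \<phi> x
      = (\<Sum>w\<in>?W. ?p w *\<^sub>R series_action f (j - length w) 1 (lie_polynomial b) (word_derivative f w \<phi>) x)"
    by (simp add: series_action_mult)
  also have "\<dots> = (\<Sum>w\<in>?V. ?p w *\<^sub>R series_action f (j - length w) 1 (lie_polynomial b) (word_derivative f w \<phi>) x)"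
    using zero by (intro sum.mono_neutral_right finite_words VW) auto
  also have "\<dots> = (\<Sum>w\<in>?V. ?p w *\<^sub>R lie_derivative ?B (word_derivative f w \<phi>) x)"
    using \<phi>(3) by (intro sum.cong refl arg_cong2[where f = scaleR] b Cb_word_derivative \<phi> x) (auto simp: \<phi>(2) le_diff_conv2 intro: order_trans[OF diff_le_self])
  also have "\<dots> = lie_derivative ?B (\<lambda>z. \<Sum>w\<in>?V. ?p w *\<^sub>R word_derivative f w \<phi> z) x"
  proof -
    have "((\<lambda>z. \<Sum>w\<in>?V. ?p w *\<^sub>R word_derivative f w \<phi> z) has_derivative
       (\<lambda>v. \<Sum>w\<in>?V. ?p w *\<^sub>R frechet_derivative (word_derivative f w \<phi>) (at x) v)) (at x)"
      using d by (intro has_derivative_sum has_derivative_scaleR_right) (auto simp: frechet_derivative_works)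
    from fun_cong[OF frechet_derivative_at[OF this], of "?B x"]
    show ?thesis by (simp add: lie_derivative_def)
  qed
  also have "\<dots> = lie_derivative ?B (lie_derivative (bracket_value f c) \<phi>) x"
  proof (rule lie_derivative_cong[OF open_D x])
    fix z assume z: "z \<in> D"
    have "(\<Sum>w\<in>?V. ?p w *\<^sub>R word_derivative f w \<phi> z) = series_action f j 1 (lie_polynomial c) \<phi> z"
      unfolding series_action_def using zero by (intro sum.mono_neutral_cong_left finite_words VW) auto
    also have "\<dots> = lie_derivative (bracket_value f c) \<phi> z" using \<phi> by (intro c z) auto
    finally show "(\<Sum>w\<in>?V. ?p w *\<^sub>R word_derivative f w \<phi> z) = lie_derivative (bracket_value f c) \<phi> z" .
  qed
  finally show ?thesis .
qed

text \<open>
  The formal commutator of the Lie polynomials becomes the commutator of Lie derivatives, which is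
  the Lie derivative along the bracket.
\<close>

lemma series_action_lie_polynomial:
  "\<phi> \<in> Cb j D \<Longrightarrow> j \<le> k \<Longrightarrow> bracket_degree b \<le> j \<Longrightarrow> x \<in> D \<Longrightarrow>
    series_action f j 1 (lie_polynomial b) \<phi> x = lie_derivative (bracket_value f b) \<phi> x"
proof (induction b arbitrary: \<phi> j x)
  case (Field i)
  have "series_action f j 1 (lie_polynomial (Field i)) \<phi> x
    = (\<Sum>w\<in>{w. length w \<le> j}. if w = [i] then lie_derivative (f i) \<phi> x else 0)"
    unfolding series_action_def by (intro sum.cong refl) (auto simp: ncs_letter.rep_eq)
  also have "\<dots> = lie_derivative (f i) \<phi> x" using Field by (simp add: finite_words)
  finally show ?case by simp
next
  case (Br b c)
  have pos: "bracket_degree b \<ge> 1" "bracket_degree c \<ge> 1" by (rule bracket_degree_pos)+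
  have b: "bracket_value f b \<in> Cb (Suc 0) D" and c: "bracket_value f c \<in> Cb (Suc 0) D"
    by (rule Cb_antimono[OF _ bracket_value_Cb]; use Br.prems pos in simp)+
  have \<phi>2: "\<phi> \<in> Cb (Suc (Suc 0)) D"
    by (rule Cb_antimono[OF _ Br.prems(1)]) (use Br.prems pos in simp)
  have deg: "bracket_degree b + bracket_degree c \<le> j" "bracket_degree c + bracket_degree b \<le> j"
    using Br.prems by auto
  have "series_action f j 1 (lie_polynomial (Br b c)) \<phi> x
      = lie_derivative (bracket_value f b) (lie_derivative (bracket_value f c) \<phi>) x
      - lie_derivative (bracket_value f c) (lie_derivative (bracket_value f b) \<phi>) x"
    unfolding lie_polynomial.simps series_action_diff
    using series_action_product_of_brackets[OF Br.prems(4,1,2) deg(1) Br.IH]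
      series_action_product_of_brackets[OF Br.prems(4,1,2) deg(2) Br.IH(2) Br.IH(1)] by simp
  also have "\<dots> = lie_derivative (bracket_value f (Br b c)) \<phi> x"
    using lie_derivative_lie_bracket[OF open_D Br.prems(4) \<phi>2, of "bracket_value f b" "bracket_value f c"]
      b c Br.prems(4) by simp
  finally show ?case .
qed

text \<open>
  The expansion of the identity map to order \<open>h = bracket_degree b\<close>, where \<open>L\<^sub>B\<close> of the identity
  is \<open>B\<close> itself.
\<close>

theorem bracket_word_expansion:
  assumes "bounded D" and C: "compact C" "C \<subseteq> D" and b: "bracket_degree b \<le> k"
  shows "realizes f C (bracket_word b) (bracket_degree b) (bracket_value f b)"
  unfolding realizes_def
proof (intro allI impI)
  fix \<epsilon> :: real assume "\<epsilon> > 0"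
  let ?h = "bracket_degree b"
  have id: "(\<lambda>x. x) \<in> Cb ?h D" by (rule Cb_id[OF assms(1)])
  have eq: "series_action f ?h t (word_series (bracket_word b)) (\<lambda>x. x) x = x + t ^ ?h *\<^sub>R bracket_value f b x"
    if "x \<in> D" for x t
  proof -
    define R where "R = word_series (bracket_word b) - 1 - lie_polynomial b"
    have "word_series (bracket_word b) = 1 + lie_polynomial b + R" by (simp add: R_def)
    moreover have "series_action f ?h t R (\<lambda>x. x) x = 0"
      using bracket_word_series[of b] by (intro series_action_vanishing) (simp add: R_def)
    moreover have "series_action f ?h t (lie_polynomial b) (\<lambda>x. x) x = t ^ ?h *\<^sub>R bracket_value f b x"
      by (subst series_action_homogeneous, subst series_action_lie_polynomial[OF id b order_refl that])
         (simp add: lie_derivative_def)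
    ultimately show ?thesis by (simp add: series_action_add series_action_one)
  qed
  have signs: "\<forall>p\<in>set (bracket_word b). \<bar>fst p\<bar> \<le> 1" using bracket_word_sign[of b] by auto
  obtain \<delta> where \<delta>: "\<delta> > 0" "\<And>t x z. 0 \<le> t \<Longrightarrow> t < \<delta> \<Longrightarrow> steers f C t (bracket_word b) x z \<Longrightarrow>
      norm (z - series_action f ?h t (word_series (bracket_word b)) (\<lambda>x. x) x) \<le> \<epsilon> * t ^ ?h"
    using word_expansion[OF C id b \<open>\<epsilon> > 0\<close> signs] by blast
  have "norm (z - x - t ^ ?h *\<^sub>R bracket_value f b x) \<le> \<epsilon> * t ^ ?h"
    if "0 \<le> t" "t < \<delta>" "x \<in> C" "steers f C t (bracket_word b) x z" for t x z
    using \<delta>(2)[OF that(1,2,4)] eq[of x t] that(3) C(2) by (simp add: subset_iff diff_diff_eq)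
  then show "\<exists>\<delta>>0. \<forall>t x z. 0 \<le> t \<and> t < \<delta> \<and> x \<in> C \<and> steers f C t (bracket_word b) x z \<longrightarrow>
      norm (z - x - t ^ ?h *\<^sub>R bracket_value f b x) \<le> \<epsilon> * t ^ ?h"
    using \<delta>(1) by blast
qed

lemma single_flow_expansion:
  assumes "bounded D" and C: "compact C" "C \<subseteq> D" and "k \<ge> 1" "\<bar>s\<bar> \<le> 1"
  shows "realizes f C [(s, i)] 1 (\<lambda>x. s *\<^sub>R f i x)"
  unfolding realizes_def
proof (intro allI impI)
  fix \<epsilon> :: real assume "\<epsilon> > 0"
  have id: "(\<lambda>x. x) \<in> Cb 1 D" by (rule Cb_id[OF assms(1)])
  have "series_action f 1 t (word_series [(s, i)]) (\<lambda>x. x) x = x + t *\<^sub>R s *\<^sub>R f i x" for x t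
    by (simp add: series_action_exp lie_derivative_def mult.commute)
  then show "\<exists>\<delta>>0. \<forall>t x z. 0 \<le> t \<and> t < \<delta> \<and> x \<in> C \<and> steers f C t [(s, i)] x z \<longrightarrow>
      norm (z - x - t ^ 1 *\<^sub>R s *\<^sub>R f i x) \<le> \<epsilon> * t ^ 1"
    using word_expansion[OF C id \<open>k \<ge> 1\<close> \<open>\<epsilon> > 0\<close>, of "[(s, i)]"] assms(5)
    by (simp add: diff_diff_eq del: steers.simps) blast
qed

end

section \<open>Descent directions of semiconcave functions\<close>

text \<open>
  The inequality of semiconcavity on a set all of whose segments are admitted.
\<close>

definition midpoint_semiconcave :: "'a::real_normed_vector set \<Rightarrow> real \<Rightarrow> ('a \<Rightarrow> real) \<Rightarrow> bool" where
  "midpoint_semiconcave B \<rho> F \<longleftrightarrow>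
     (\<forall>z1\<in>B. \<forall>z2\<in>B. F z1 + F z2 - 2 * F (midpoint z1 z2) \<le> \<rho> * (norm (z1 - z2))\<^sup>2)"

text \<open>
  Subtracting \<open>2\<rho> |\<cdot> - y|\<^sup>2\<close> makes the function midpoint concave.  Halving the segment repeatedly
  towards \<open>y\<close> then bounds the increment from \<open>y\<close> to \<open>z\<close> by the difference quotients at \<open>y\<close> with
  steps \<open>2\<^sup>-\<^sup>n\<close>, which converge to the derivative.
\<close>

lemma semiconcave_gradient_inequality:
  fixes F :: "'a::real_inner \<Rightarrow> real"
  assumes B: "convex B" "y \<in> B" "z \<in> B" and sc: "midpoint_semiconcave B \<rho> F" and G: "GDERIV F y :> G"
  shows "F z \<le> F y + G \<bullet> (z - y) + 2 * \<rho> * (norm (z - y))\<^sup>2"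
proof -
  define d where "d = z - y"
  define q where "q n = y + (1 / 2) ^ n *\<^sub>R d" for n :: nat
  define V where "V x = F x - 2 * \<rho> * (norm (x - y))\<^sup>2" for x
  have qB: "q n \<in> B" for n
  proof -
    have "q n = (1 - (1 / 2) ^ n) *\<^sub>R y + (1 / 2) ^ n *\<^sub>R z"
      by (simp add: q_def d_def algebra_simps)
    then show ?thesis using B by (simp add: convexD_alt power_le_one)
  qed
  have Vmid: "V y + V (q n) \<le> 2 * V (q (Suc n))" for n
  proof -
    have mid: "midpoint y (q n) = q (Suc n)"
      by (simp add: midpoint_def q_def algebra_simps scaleR_2[symmetric])
    have n1: "(norm (y - q n))\<^sup>2 = 4 * (norm (q (Suc n) - y))\<^sup>2"
      "(norm (q n - y))\<^sup>2 = 4 * (norm (q (Suc n) - y))\<^sup>2"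
      by (simp_all add: q_def power_mult_distrib power2_eq_square)
    have "F y + F (q n) - 2 * F (q (Suc n)) \<le> \<rho> * (norm (y - q n))\<^sup>2"
      using sc B(2) qB[of n] unfolding midpoint_semiconcave_def mid[symmetric] by blast
    then show ?thesis unfolding V_def n1 by simp
  qed
  have step: "(1 / 2) ^ n * (V z - V y) \<le> V (q n) - V y" for n
  proof (induction n)
    case 0 then show ?case by (simp add: q_def d_def)
  next
    case (Suc n) then show ?case using Vmid[of n] by simp
  qed
  have lower: "V z - V y \<le> (F (y + h *\<^sub>R d) - F y) / h - 2 * \<rho> * h * (norm d)\<^sup>2" if "h = (1 / 2) ^ n" for h n
  proof -
    have h: "h > 0" using that by simp
    have "h * (V z - V y) \<le> F (y + h *\<^sub>R d) - F y - 2 * \<rho> * (h * norm d)\<^sup>2"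
      using step[of n] h by (simp add: that V_def q_def)
    then show ?thesis using h by (simp add: field_simps power2_eq_square)
  qed
  have "((\<lambda>r. F (y + r *\<^sub>R d)) has_derivative (\<lambda>r. (r *\<^sub>R d) \<bullet> G)) (at 0)"
    by (rule has_derivative_compose[where f = "\<lambda>r. y + r *\<^sub>R d" and g = F])
       (use G in \<open>auto intro!: derivative_eq_intros simp: gderiv_def\<close>)
  then have "((\<lambda>r. F (y + r *\<^sub>R d)) has_field_derivative (G \<bullet> d)) (at 0)"
    by (simp add: has_field_derivative_def inner_commute mult.commute[of _ "G \<bullet> d"])
  then have "((\<lambda>h. (F (y + h *\<^sub>R d) - F y) / h) \<longlongrightarrow> G \<bullet> d) (at 0)"
    by (simp add: DERIV_def)
  moreover have "filterlim (\<lambda>n. (1 / 2 :: real) ^ n) (at 0) sequentially"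
    by (auto simp: filterlim_at intro!: LIMSEQ_realpow_zero)
  ultimately have "(\<lambda>n. (F (y + (1 / 2) ^ n *\<^sub>R d) - F y) / (1 / 2) ^ n) \<longlonglongrightarrow> G \<bullet> d"
    by (rule filterlim_compose)
  then have "(\<lambda>n. (F (y + (1 / 2) ^ n *\<^sub>R d) - F y) / (1 / 2) ^ n - 2 * \<rho> * (1 / 2) ^ n * (norm d)\<^sup>2)
      \<longlonglongrightarrow> G \<bullet> d - 2 * \<rho> * 0 * (norm d)\<^sup>2"
    by (intro tendsto_intros LIMSEQ_realpow_zero) auto
  then have "V z - V y \<le> G \<bullet> d - 2 * \<rho> * 0 * (norm d)\<^sup>2"
    by (rule LIMSEQ_le_const) (use lower in blast)
  then show ?thesis by (simp add: V_def d_def)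
qed

text \<open>
  Touching from below by a quadratic function bounds \<open>F (y + d)\<close> from below.  The same bound at
  \<open>y - d\<close>, fed into the semiconcavity inequality with midpoint \<open>y\<close>, bounds \<open>F (y + d)\<close> from above.
\<close>

lemma semiconcave_differentiable_at_quadratic_touching:
  fixes F :: "'a::real_inner \<Rightarrow> real"
  assumes sc: "midpoint_semiconcave (ball x e) \<rho> F" and y: "y \<in> ball x e" and c: "c \<ge> 0" "\<rho> \<ge> 0"
    and touch: "\<And>z. z \<in> ball x e \<Longrightarrow> F y + c * (norm (y - x))\<^sup>2 \<le> F z + c * (norm (z - x))\<^sup>2"
  shows "GDERIV F y :> (- 2 * c) *\<^sub>R (y - x)"
proof -
  define q where "q = (- 2 * c) *\<^sub>R (y - x)"
  have lower: "F y + q \<bullet> d - c * (norm d)\<^sup>2 \<le> F (y + d)" if "y + d \<in> ball x e" for d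
  proof -
    have "(norm (y + d - x))\<^sup>2 = (norm (y - x))\<^sup>2 + 2 * ((y - x) \<bullet> d) + (norm d)\<^sup>2"
      by (simp add: power2_norm_eq_inner algebra_simps inner_commute)
    then have "F y + c * (norm (y - x))\<^sup>2 \<le> F (y + d) + c * ((norm (y - x))\<^sup>2 + 2 * ((y - x) \<bullet> d) + (norm d)\<^sup>2)"
      using touch[OF that] by simp
    moreover have "q \<bullet> d = - 2 * c * ((y - x) \<bullet> d)" by (simp add: q_def)
    ultimately show ?thesis by (simp add: distrib_left)
  qed
  define R where "R = e - norm (y - x)"
  have R: "R > 0" using y by (simp add: R_def dist_norm norm_minus_commute)
  have est: "\<bar>F (y + d) - F y - q \<bullet> d\<bar> \<le> (c + 4 * \<rho>) * (norm d)\<^sup>2" if "norm d < R" for d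
  proof -
    have in1: "y + d \<in> ball x e" "y + (- d) \<in> ball x e"
      using that norm_triangle_ineq[of "y - x" d] norm_triangle_ineq[of "y - x" "- d"]
      by (auto simp: R_def dist_norm norm_minus_commute algebra_simps)
    have mid: "midpoint (y + d) (y + (- d)) = y"
      by (simp add: midpoint_def scaleR_2[symmetric])
    have nd: "norm (y + d - (y + (- d))) = 2 * norm d"
      by (metis add_diff_cancel_left diff_minus_eq_add norm_scaleR scaleR_2 abs_numeral)
    have "F (y + d) + F (y + (- d)) - 2 * F y \<le> \<rho> * (2 * norm d)\<^sup>2"
      using sc in1 unfolding midpoint_semiconcave_def by (metis mid nd)
    then show ?thesis using lower[OF in1(1)] lower[OF in1(2)] c
      by (simp add: power_mult_distrib algebra_simps abs_le_iff)
         (smt (verit) mult_nonneg_nonneg zero_le_power2)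
  qed
  have "(F has_derivative (\<lambda>h. h \<bullet> q)) (at y)"
    unfolding has_derivative_at_alt
  proof (intro conjI allI impI bounded_linear_inner_left)
    fix \<epsilon> :: real assume \<epsilon>: "\<epsilon> > 0"
    define \<delta> where "\<delta> = min R (\<epsilon> / (c + 4 * \<rho> + 1))"
    have pos: "c + 4 * \<rho> + 1 > 0" using c by simp
    have "norm (F z - F y - (z - y) \<bullet> q) \<le> \<epsilon> * norm (z - y)" if z: "norm (z - y) < \<delta>" for z
    proof -
      have "\<bar>F (y + (z - y)) - F y - q \<bullet> (z - y)\<bar> \<le> (c + 4 * \<rho>) * (norm (z - y))\<^sup>2"
        using z by (intro est) (simp add: \<delta>_def)
      also have "\<dots> \<le> (c + 4 * \<rho> + 1) * norm (z - y) * norm (z - y)"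
        using mult_right_mono[of "c + 4 * \<rho>" "c + 4 * \<rho> + 1" "norm (z - y) * norm (z - y)"]
        by (simp add: power2_eq_square mult.assoc)
      also have "\<dots> \<le> \<epsilon> * norm (z - y)"
        using z pos by (intro mult_right_mono) (auto simp: \<delta>_def field_simps)
      finally show ?thesis by (simp add: inner_commute)
    qed
    then show "\<exists>\<delta>>0. \<forall>z. norm (z - y) < \<delta> \<longrightarrow> norm (F z - F y - (z - y) \<bullet> q) \<le> \<epsilon> * norm (z - y)"
      using R \<epsilon> pos by (intro exI[of _ \<delta>]) (auto simp: \<delta>_def)
  qed
  then show ?thesis by (simp add: gderiv_def q_def)
qed

text \<open>
  A density statement in place of Rademacher's theorem: adding a steep quadratic centred near \<open>x\<close>
  forces the minimum over a small ball into its interior, and the minimizer is a point of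
  differentiability.  The excluded point \<open>a\<close> is needed because limiting gradients at \<open>a\<close> are
  limits along points different from \<open>a\<close>.
\<close>

lemma semiconcave_differentiable_nearby:
  fixes F :: "'a::euclidean_space \<Rightarrow> real"
  assumes cont: "continuous_on (cball x r) F" and sc: "midpoint_semiconcave (cball x r) \<rho> F"
    and "r > 0" "\<rho> \<ge> 0" "\<eta> > 0"
  shows "\<exists>y G. dist x y < \<eta> \<and> dist x y < r \<and> y \<noteq> a \<and> GDERIV F y :> G"
proof -
  define s where "s = min r \<eta>"
  have s: "s > 0" using assms by (simp add: s_def)
  obtain x0 where x0: "dist x x0 \<le> s / 4" "x0 \<noteq> a"
  proof (cases "x = a")
    case True
    obtain v :: 'a where "norm v = s / 4" using vector_choose_size[of "s / 4"] s by auto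
    then show ?thesis using that[of "x + v"] True s by (auto simp: dist_norm)
  next
    case False then show ?thesis using that[of x] s by auto
  qed
  define e where "e = min (s / 4) (dist x0 a / 2)"
  have e: "e > 0" "e \<le> s / 4" "e \<le> dist x0 a / 2" using s x0 by (auto simp: e_def)
  have near: "dist x z < s" if "z \<in> cball x0 e" for z
    using that e x0(1) s dist_triangle[of x z x0] by simp
  then have sub: "cball x0 e \<subseteq> cball x r" by (force simp: s_def)
  have na: "a \<notin> cball x0 e" using e x0(2) zero_less_dist_iff[of x0 a] by auto
  have cont0: "continuous_on (cball x0 e) F" by (rule continuous_on_subset[OF cont sub])
  obtain m where m: "\<And>z. z \<in> cball x0 e \<Longrightarrow> m \<le> F z"
    using continuous_attains_inf[OF compact_cball _ cont0] e(1) by force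
  \<comment> \<open>on the sphere of radius \<open>e\<close> the quadratic term exceeds the oscillation of \<open>F\<close>\<close>
  define c where "c = (F x0 - m + 1) / e\<^sup>2"
  have c: "c \<ge> 0" using m[of x0] e by (auto simp: c_def)
  have "continuous_on (cball x0 e) (\<lambda>z. F z + c * (norm (z - x0))\<^sup>2)"
    by (intro continuous_intros cont0)
  then obtain y where y: "y \<in> cball x0 e"
    "\<And>z. z \<in> cball x0 e \<Longrightarrow> F y + c * (norm (y - x0))\<^sup>2 \<le> F z + c * (norm (z - x0))\<^sup>2"
    using continuous_attains_inf[OF compact_cball, of x0 e "\<lambda>z. F z + c * (norm (z - x0))\<^sup>2"] e(1)
    by force
  have "norm (y - x0) \<noteq> e"
  proof
    assume "norm (y - x0) = e"
    then have "F y + (F x0 - m + 1) \<le> F x0" using y(2)[of x0] e(1) by (simp add: c_def)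
    then show False using m[OF y(1)] by simp
  qed
  then have yb: "y \<in> ball x0 e" using y(1) by (simp add: dist_norm norm_minus_commute)
  have "midpoint_semiconcave (ball x0 e) \<rho> F"
    using sc sub ball_subset_cball[of x0 e] by (force simp: midpoint_semiconcave_def)
  from semiconcave_differentiable_at_quadratic_touching[OF this yb c \<open>\<rho> \<ge> 0\<close> y(2)]
  have "GDERIV F y :> (- 2 * c) *\<^sub>R (y - x0)" by simp
  then show ?thesis using near[OF y(1)] na y(1) by (auto simp: s_def)
qed

text \<open>
  Evaluate the gradient inequality at the point at distance \<open>r / 2\<close> in the direction \<open>- G\<close>.
\<close>

lemma semiconcave_gradient_bound:
  fixes F :: "'a::real_inner \<Rightarrow> real"
  assumes sc: "midpoint_semiconcave (cball x r) \<rho> F" and "r > 0" "\<rho> \<ge> 0"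
    and m: "\<And>z. z \<in> cball x r \<Longrightarrow> \<bar>F z\<bar> \<le> m" and y: "dist x y \<le> r / 2" and G: "GDERIV F y :> G"
  shows "norm G \<le> 4 * m / r + \<rho> * r"
proof (cases "G = 0")
  case True
  have "m \<ge> 0" using m[of x] \<open>r > 0\<close> by force
  then show ?thesis using True \<open>\<rho> \<ge> 0\<close> \<open>r > 0\<close> by simp
next
  case False
  define z where "z = y - (r / 2 / norm G) *\<^sub>R G"
  have nz: "norm (z - y) = r / 2" using False \<open>r > 0\<close> by (simp add: z_def)
  have zB: "z \<in> cball x r"
    using dist_triangle[of x z y] y nz by (simp add: dist_norm norm_minus_commute)
  have yB: "y \<in> cball x r" using y \<open>r > 0\<close> by simp
  have "G \<bullet> (z - y) = - (r / 2) * norm G"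
    using False by (simp add: z_def power2_norm_eq_inner[symmetric] power2_eq_square)
  then have "F z \<le> F y - (r / 2) * norm G + 2 * \<rho> * (r / 2)\<^sup>2"
    using semiconcave_gradient_inequality[OF convex_cball yB zB sc G] nz by simp
  then have "(r / 2) * norm G \<le> 2 * m + \<rho> * r\<^sup>2 / 2"
    using m[OF zB] m[OF yB] by (simp add: power2_eq_square)
  then show ?thesis using \<open>r > 0\<close> by (simp add: field_simps power2_eq_square)
qed

text \<open>
  At a point of \<open>K\<close>, gradients at nearby points of differentiability are bounded and accumulate at
  some \<open>p\<close> which inherits the gradient inequality.  If no uniform \<open>\<mu>\<close> existed, a sequence of
  counterexamples \<open>x\<^sub>n\<close> would converge to some \<open>l\<close>; replacing each \<open>x\<^sub>n\<close> by a nearby point of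
  differentiability different from \<open>l\<close> produces a limiting gradient at \<open>l\<close> that is nonnegative on
  all fields, contrary to the hypothesis.
\<close>

theorem uniform_descent_direction:
  fixes U :: "real ^ 'n \<Rightarrow> real" and XS :: "(real ^ 'n \<Rightarrow> real ^ 'n) set"
  assumes E: "open E" "continuous_on E U" "locally_semiconcave_on E U"
    and XS: "finite XS" "\<And>X. X \<in> XS \<Longrightarrow> continuous_on E X"
    and neg: "\<And>x p. x \<in> E \<Longrightarrow> p \<in> limiting_gradients E U x \<Longrightarrow> \<exists>X\<in>XS. p \<bullet> X x < 0"
    and K: "compact K" "K \<subseteq> E" "K \<noteq> {}"
  obtains \<mu> L \<rho> r where "\<mu> > 0" "L \<ge> 0" "\<rho> \<ge> 0" "r > 0" "compact {x. infdist x K \<le> r}" "{x. infdist x K \<le> r} \<subseteq> E"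
    "\<forall>x\<in>K. \<exists>p. \<exists>X\<in>XS. norm p \<le> L \<and> p \<bullet> X x \<le> - \<mu> \<and>
       (\<forall>z\<in>cball x r. U z \<le> U x + p \<bullet> (z - x) + \<rho> * (norm (z - x))\<^sup>2)"
proof -
  obtain r where r: "r > 0" and NE: "{x. infdist x K \<le> r} \<subseteq> E"
    using compact_in_open_separated[OF K(3,1) E(1) K(2)] by blast
  define N where "N = {x. infdist x K \<le> r}"
  have N: "compact N" "N \<subseteq> E" using compact_infdist_le[OF K(3,1) r] NE by (auto simp: N_def)
  have ballN: "cball x r \<subseteq> N" if "x \<in> K" for x
  proof
    fix z assume "z \<in> cball x r"
    then show "z \<in> N" using infdist_le[OF that, of z] by (simp add: N_def dist_commute)
  qed
  obtain \<rho> where \<rho>: "\<rho> > 0" and sc: "\<And>z1 z2. z1 \<in> N \<Longrightarrow> z2 \<in> N \<Longrightarrow> closed_segment z1 z2 \<subseteq> N \<Longrightarrow>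
      U z1 + U z2 - 2 * U (midpoint z1 z2) \<le> \<rho> * (norm (z1 - z2))\<^sup>2"
    using E(3) N unfolding locally_semiconcave_on_def semiconcave_on_def by metis
  have scb: "midpoint_semiconcave (cball x r) \<rho> U" if "x \<in> K" for x
    unfolding midpoint_semiconcave_def
  proof (intro ballI)
    fix z1 z2 assume z: "z1 \<in> cball x r" "z2 \<in> cball x r"
    have "closed_segment z1 z2 \<subseteq> cball x r" by (rule closed_segment_subset[OF z convex_cball])
    then show "U z1 + U z2 - 2 * U (midpoint z1 z2) \<le> \<rho> * (norm (z1 - z2))\<^sup>2"
      using z ballN[OF that] by (intro sc) auto
  qed
  have contN: "continuous_on N U" by (rule continuous_on_subset[OF E(2) N(2)])
  have "bounded (U ` N)" by (intro compact_imp_bounded compact_continuous_image contN N)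
  then obtain m where m: "\<And>z. z \<in> N \<Longrightarrow> \<bar>U z\<bar> \<le> m" by (auto simp: bounded_iff)
  define L where "L = \<bar>4 * m / r + \<rho> * r\<bar>"
  define good where "good x p \<longleftrightarrow> norm p \<le> L \<and>
      (\<forall>z\<in>cball x r. U z \<le> U x + p \<bullet> (z - x) + 2 * \<rho> * (norm (z - x))\<^sup>2)" for x p
  have bound: "norm G \<le> L" if "x \<in> K" "dist x y \<le> r / 2" "GDERIV U y :> G" for x y G
  proof -
    have "norm G \<le> 4 * m / r + \<rho> * r"
      by (rule semiconcave_gradient_bound[OF scb[OF that(1)] r _ _ that(2,3)])
         (use \<rho> m ballN[OF that(1)] in auto)
    then show ?thesis by (simp add: L_def)
  qed
  have approx: "\<exists>Y G p. (\<forall>i. Y i \<noteq> a \<and> GDERIV U (Y i) :> G i) \<and> Y \<longlonglongrightarrow> x \<and> G \<longlonglongrightarrow> p \<and> good x p"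
    if x: "x \<in> K" for x a
  proof -
    have "\<exists>y G. dist x y < min (r / 2) (1 / (real i + 1)) \<and> dist x y < r \<and> y \<noteq> a \<and> GDERIV U y :> G" for i
      by (rule semiconcave_differentiable_nearby[OF continuous_on_subset[OF contN ballN[OF x]] scb[OF x]])
         (use r \<rho> in auto)
    then obtain Y G where YG: "\<And>i. dist x (Y i) < min (r / 2) (1 / (real i + 1))" "\<And>i. Y i \<noteq> a"
      "\<And>i. GDERIV U (Y i) :> G i" by metis
    have Y: "Y \<longlonglongrightarrow> x"
    proof (rule metric_tendsto_imp_tendsto[OF LIMSEQ_inverse_real_of_nat])
      show "\<forall>\<^sub>F i in sequentially. dist (Y i) x \<le> dist (inverse (real (Suc i))) 0"
        using YG(1) by (auto simp: dist_commute inverse_eq_divide less_imp_le add.commute intro!: always_eventually)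
    qed
    have GL: "norm (G i) \<le> L" for i
      by (rule bound[OF x _ YG(3)]) (use YG(1)[of i] in auto)
    then have "bounded (range G)" by (auto simp: bounded_iff)
    then obtain p \<sigma> where \<sigma>: "strict_mono \<sigma>" "(G \<circ> \<sigma>) \<longlonglongrightarrow> p"
      using bounded_imp_convergent_subsequence by blast
    have Y\<sigma>: "(\<lambda>i. Y (\<sigma> i)) \<longlonglongrightarrow> x" using LIMSEQ_subseq_LIMSEQ[OF Y \<sigma>(1)] by (simp add: o_def)
    have G\<sigma>: "(\<lambda>i. G (\<sigma> i)) \<longlonglongrightarrow> p" using \<sigma>(2) by (simp add: o_def)
    have "isCont U x" using E x K by (auto simp: continuous_on_eq_continuous_at)
    then have UY: "(\<lambda>i. U (Y (\<sigma> i))) \<longlonglongrightarrow> U x" using Y\<sigma> by (rule isCont_tendsto_compose)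
    have "U z \<le> U x + p \<bullet> (z - x) + 2 * \<rho> * (norm (z - x))\<^sup>2" if z: "z \<in> cball x r" for z
    proof (rule LIMSEQ_le_const)
      show "(\<lambda>i. U (Y (\<sigma> i)) + G (\<sigma> i) \<bullet> (z - Y (\<sigma> i)) + 2 * \<rho> * (norm (z - Y (\<sigma> i)))\<^sup>2)
        \<longlonglongrightarrow> U x + p \<bullet> (z - x) + 2 * \<rho> * (norm (z - x))\<^sup>2"
        by (intro tendsto_intros UY Y\<sigma> G\<sigma>)
      have "Y j \<in> cball x r" for j using YG(1)[of j] r by simp
      then show "\<exists>M. \<forall>i\<ge>M. U z \<le> U (Y (\<sigma> i)) + G (\<sigma> i) \<bullet> (z - Y (\<sigma> i)) + 2 * \<rho> * (norm (z - Y (\<sigma> i)))\<^sup>2"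
        using semiconcave_gradient_inequality[OF convex_cball _ z scb[OF x] YG(3)] by blast
    qed
    moreover have "norm p \<le> L"
      by (rule LIMSEQ_le_const2[OF tendsto_norm[OF G\<sigma>]]) (use GL in blast)
    ultimately have "good x p" by (simp add: good_def)
    then show ?thesis using YG Y\<sigma> G\<sigma> by (intro exI[of _ "\<lambda>i. Y (\<sigma> i)"] exI[of _ "\<lambda>i. G (\<sigma> i)"]) auto
  qed
  have XSc: "(\<lambda>i. X (Y i)) \<longlonglongrightarrow> X x" if "X \<in> XS" "x \<in> K" "Y \<longlonglongrightarrow> x" for X x and Y :: "nat \<Rightarrow> real ^ 'n"
  proof -
    have "isCont X x" using XS(2) that E K by (auto simp: continuous_on_eq_continuous_at)
    then show ?thesis using that(3) by (rule isCont_tendsto_compose)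
  qed
  have "\<exists>n::nat. \<forall>x\<in>K. \<exists>p. good x p \<and> (\<exists>X\<in>XS. p \<bullet> X x \<le> - (1 / (real n + 1)))"
  proof (rule ccontr)
    assume "\<not> ?thesis"
    then have "\<forall>n. \<exists>x\<in>K. \<forall>p. good x p \<longrightarrow> (\<forall>X\<in>XS. - (1 / (real n + 1)) < p \<bullet> X x)"
      by (metis not_le)
    then obtain x where x: "\<And>n. x n \<in> K"
      "\<And>n p X. good (x n) p \<Longrightarrow> X \<in> XS \<Longrightarrow> - (1 / (real n + 1)) < p \<bullet> X (x n)" by metis
    obtain l \<sigma> where l: "l \<in> K" and \<sigma>: "strict_mono \<sigma>" "(x \<circ> \<sigma>) \<longlonglongrightarrow> l"
      using K(1) x(1) unfolding compact_def by meson
    have "\<exists>y G. y \<noteq> l \<and> dist (x n) y < min (r / 2) (1 / (real n + 1)) \<and> GDERIV U y :> G \<and>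
        (\<forall>X\<in>XS. - (1 / (real n + 1)) < G \<bullet> X y)" for n
    proof -
      obtain Y G p where Y: "\<And>i. Y i \<noteq> l" "\<And>i. GDERIV U (Y i) :> G i" "Y \<longlonglongrightarrow> x n" "G \<longlonglongrightarrow> p" "good (x n) p"
        using approx[OF x(1)] by blast
      have "\<forall>\<^sub>F i in sequentially. - (1 / (real n + 1)) < G i \<bullet> X (Y i)" if "X \<in> XS" for X
        by (rule order_tendstoD(1)[OF tendsto_inner[OF Y(4) XSc[OF that x(1) Y(3)]] x(2)[OF Y(5) that]])
      then have "\<forall>\<^sub>F i in sequentially. \<forall>X\<in>XS. - (1 / (real n + 1)) < G i \<bullet> X (Y i)"
        using XS(1) by (simp add: eventually_ball_finite)
      moreover have "\<forall>\<^sub>F i in sequentially. dist (Y i) (x n) < min (r / 2) (1 / (real n + 1))"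
        by (rule tendstoD[OF Y(3)]) (use r in auto)
      ultimately have "\<forall>\<^sub>F i in sequentially. dist (Y i) (x n) < min (r / 2) (1 / (real n + 1)) \<and>
         (\<forall>X\<in>XS. - (1 / (real n + 1)) < G i \<bullet> X (Y i))" by eventually_elim simp
      then obtain i where "dist (Y i) (x n) < min (r / 2) (1 / (real n + 1))"
         "\<forall>X\<in>XS. - (1 / (real n + 1)) < G i \<bullet> X (Y i)"
        by (auto simp: eventually_sequentially)
      then show ?thesis using Y(1,2) by (metis dist_commute)
    qed
    then obtain y G where y: "\<And>n. y n \<noteq> l" "\<And>n. dist (x n) (y n) < min (r / 2) (1 / (real n + 1))"
        "\<And>n. GDERIV U (y n) :> G n" "\<And>n X. X \<in> XS \<Longrightarrow> - (1 / (real n + 1)) < G n \<bullet> X (y n)"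
      by metis
    have inv0: "(\<lambda>n. 1 / (real n + 1)) \<longlonglongrightarrow> 0"
      using LIMSEQ_inverse_real_of_nat by (simp add: inverse_eq_divide add.commute)
    have "norm (G n) \<le> L" for n by (rule bound[OF x(1)[of n] _ y(3)[of n]]) (use y(2)[of n] in auto)
    then have "bounded (range (G \<circ> \<sigma>))" by (auto simp: bounded_iff)
    then obtain p \<tau> where \<tau>: "strict_mono \<tau>" "((G \<circ> \<sigma>) \<circ> \<tau>) \<longlonglongrightarrow> p"
      using bounded_imp_convergent_subsequence by blast
    define s where "s i = \<sigma> (\<tau> i)" for i
    have s: "strict_mono s" using \<sigma>(1) \<tau>(1) by (auto simp: s_def strict_mono_def)
    have inv0s: "(\<lambda>i. 1 / (real (s i) + 1)) \<longlonglongrightarrow> 0"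
      using LIMSEQ_subseq_LIMSEQ[OF inv0 s] by (simp add: o_def)
    have Gs: "(\<lambda>i. G (s i)) \<longlonglongrightarrow> p" using \<tau>(2) by (simp add: o_def s_def)
    have xs: "(\<lambda>i. x (s i)) \<longlonglongrightarrow> l"
      using LIMSEQ_subseq_LIMSEQ[OF \<sigma>(2) \<tau>(1)] by (simp add: o_def s_def)
    have "(\<lambda>i. dist (x (s i)) (y (s i))) \<longlonglongrightarrow> 0"
    proof (rule tendsto_sandwich[OF _ _ tendsto_const inv0s])
      show "\<forall>\<^sub>F i in sequentially. dist (x (s i)) (y (s i)) \<le> 1 / (real (s i) + 1)"
        using y(2) by (intro always_eventually allI) (meson less_imp_le min_less_iff_conj)
    qed auto
    then have "(\<lambda>i. y (s i) - x (s i)) \<longlonglongrightarrow> 0"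
      by (intro tendsto_norm_zero_cancel[of "\<lambda>i. y (s i) - x (s i)"]) (simp add: dist_norm norm_minus_commute)
    from tendsto_add[OF xs this] have ys: "(\<lambda>i. y (s i)) \<longlonglongrightarrow> l" by simp
    have yE: "y n \<in> E" for n using y(2)[of n] ballN[OF x(1)[of n]] N(2) r by (auto simp: subset_iff)
    have "p \<in> limiting_gradients E U l"
      unfolding limiting_gradients_def using y(1,3) yE ys Gs
      by (intro CollectI exI[of _ "\<lambda>i. y (s i)"] exI[of _ "\<lambda>i. G (s i)"]) auto
    then obtain X where X: "X \<in> XS" "p \<bullet> X l < 0" using neg[of l p] l K(2) by blast
    have "- 0 \<le> p \<bullet> X l"
      by (rule LIMSEQ_le[OF tendsto_minus[OF inv0s] tendsto_inner[OF Gs XSc[OF X(1) l ys]]])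
         (use y(4)[OF X(1)] in \<open>auto simp: less_imp_le\<close>)
    then show False using X(2) by simp
  qed
  then obtain n :: nat where n: "\<And>x. x \<in> K \<Longrightarrow> \<exists>p. good x p \<and> (\<exists>X\<in>XS. p \<bullet> X x \<le> - (1 / (real n + 1)))"
    by blast
  show ?thesis
  proof (rule that[of "1 / (real n + 1)" L "2 * \<rho>" r])
    have "\<exists>p. \<exists>X\<in>XS. norm p \<le> L \<and> p \<bullet> X x \<le> - (1 / (real n + 1)) \<and>
       (\<forall>z\<in>cball x r. U z \<le> U x + p \<bullet> (z - x) + 2 * \<rho> * (norm (z - x))\<^sup>2)" if "x \<in> K" for x
      using n[OF that] unfolding good_def by blast
    then show "\<forall>x\<in>K. \<exists>p. \<exists>X\<in>XS. norm p \<le> L \<and> p \<bullet> X x \<le> - (1 / (real n + 1)) \<and>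
       (\<forall>z\<in>cball x r. U z \<le> U x + p \<bullet> (z - x) + 2 * \<rho> * (norm (z - x))\<^sup>2)" by blast
  qed (use r \<rho> N in \<open>auto simp: L_def N_def\<close>)
qed

section \<open>Existence of integral curves of continuous fields\<close>

text \<open>
  Tonelli's delayed equation.  Its Picard iterates stabilize: the iterate number \<open>j\<close> is final up to time
  \<open>j \<delta>\<close>, because the right-hand side looks back by \<open>\<delta>\<close>.
\<close>

lemma delayed_solution_exists:
  fixes g :: "real ^ 'n \<Rightarrow> real ^ 'n"
  assumes g: "continuous_on UNIV g" "\<And>z. norm (g z) \<le> M" and "\<delta> > 0"
  shows "\<exists>y. continuous_on UNIV y \<and> (\<forall>t\<le>0. y t = x) \<and> (\<forall>t\<in>{0..b}. y t = x + integral {0..t} (\<lambda>s. g (y (s - \<delta>))))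
     \<and> (\<forall>s\<ge>0. \<forall>t\<ge>0. norm (y t - y s) \<le> M * \<bar>t - s\<bar>)"
proof -
  define P where "P y t = x + integral {0..t} (\<lambda>s. g (y (s - \<delta>)))" for y :: "real \<Rightarrow> real ^ 'n" and t
  define Y where "Y j = (P ^^ j) (\<lambda>t. x)" for j
  have Y_simps: "Y 0 = (\<lambda>t. x)" "Y (Suc j) = P (Y j)" for j by (auto simp: Y_def)
  have M: "M \<ge> 0" using g(2)[of 0] norm_ge_zero order_trans by blast
  have gc: "continuous_on UNIV (\<lambda>s. g (y (s - \<delta>)))" if "continuous_on UNIV y" for y :: "real \<Rightarrow> real ^ 'n"
    by (intro continuous_on_compose2[OF g(1)] continuous_on_compose2[OF that] continuous_intros) auto
  have int: "(\<lambda>s. g (y (s - \<delta>))) integrable_on {a..b}" if "continuous_on UNIV y" for y :: "real \<Rightarrow> real ^ 'n" and a b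
    by (intro integrable_continuous_interval continuous_on_subset[OF gc[OF that]]) auto
  have P0: "P y t = x" if "t \<le> 0" for y t
    using that by (cases "t = 0") (auto simp: P_def)
  have lip: "norm (P y t - P y s) \<le> M * \<bar>t - s\<bar>" if y: "continuous_on UNIV y" for y s t
  proof -
    have *: "norm (P y t - P y s) \<le> M * (t - s)" if st: "0 \<le> s" "s \<le> t" for s t
    proof -
      have "P y t - P y s = integral {s..t} (\<lambda>s. g (y (s - \<delta>)))"
        using Henstock_Kurzweil_Integration.integral_combine[OF st int[OF y]] by (simp add: P_def algebra_simps)
      also have "norm \<dots> \<le> M * (t - s)"
        using integral_bound[of s t "\<lambda>s. g (y (s - \<delta>))" M] st g(2) continuous_on_subset[OF gc[OF y]] by auto
      finally show ?thesis .
    qed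
    have **: "norm (P y t - P y s) \<le> M * (t - s)" if st: "s \<le> t" for s t
    proof (cases "t \<le> 0")
      case True then show ?thesis using st M by (simp add: P0)
    next
      case False
      show ?thesis
      proof (cases "s \<ge> 0")
        case True then show ?thesis using * st by blast
      next
        case s: False
        have "norm (P y t - P y 0) \<le> M * (t - 0)" using *[of 0 t] False by simp
        also have "\<dots> \<le> M * (t - s)" using s M by (intro mult_left_mono) auto
        finally show ?thesis using s by (simp add: P0)
      qed
    qed
    show ?thesis using **[of s t] **[of t s] by (cases "s \<le> t") (auto simp: norm_minus_commute)
  qed
  have Pc: "continuous_on UNIV (P y)" if "continuous_on UNIV y" for y
    by (rule lipschitz_on_continuous_on[of M])
       (use lip[OF that] M in \<open>auto intro!: lipschitz_onI simp: dist_norm\<close>)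
  have Yc: "continuous_on UNIV (Y j)" for j
    by (induction j) (auto simp: Y_simps Pc)
  \<comment> \<open>each iterate fixes the solution on one further interval of length \<open>\<delta>\<close>\<close>
  have stable: "Y (Suc j) t = Y j t" if "t \<le> real j * \<delta>" for j t
    using that
  proof (induction j arbitrary: t)
    case 0 then show ?case by (simp add: Y_simps P0)
  next
    case (Suc j)
    have "Y (Suc j) (s - \<delta>) = Y j (s - \<delta>)" if "s \<in> {0..t}" for s
      using that Suc.prems by (intro Suc.IH) (auto simp: algebra_simps)
    then show ?case unfolding Y_simps(2)[of "Suc j"] Y_simps(2)[of j, symmetric]
      by (subst (2) Y_simps(2)) (auto simp: P_def intro!: integral_cong)
  qed
  obtain j :: nat where j: "b < real j * \<delta>" using reals_Archimedean3[OF \<open>\<delta> > 0\<close>] by blast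
  have "Y (Suc j) t = x + integral {0..t} (\<lambda>s. g (Y (Suc j) (s - \<delta>)))" if t: "t \<in> {0..b}" for t
  proof -
    have "Y (Suc j) (s - \<delta>) = Y j (s - \<delta>)" if "s \<in> {0..t}" for s
      using that t j \<open>\<delta> > 0\<close> by (intro stable) auto
    then have "integral {0..t} (\<lambda>s. g (Y (Suc j) (s - \<delta>))) = integral {0..t} (\<lambda>s. g (Y j (s - \<delta>)))"
      by (intro integral_cong) simp
    then show ?thesis by (simp add: Y_simps(2) P_def)
  qed
  then show ?thesis using Yc[of "Suc j"] lip[OF Yc[of j]] P0
    by (intro exI[of _ "Y (Suc j)"]) (auto simp: Y_simps(2))
qed

text \<open>
  The delayed solutions are equi-Lipschitz, so by the Arzela-Ascoli theorem a subsequence converges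
  uniformly as the delay tends to 0; the integral equation passes to the limit by dominated
  convergence.
\<close>

lemma integral_curve_of_bounded_continuous:
  fixes g :: "real ^ 'n \<Rightarrow> real ^ 'n"
  assumes g: "continuous_on UNIV g" "\<And>z. norm (g z) \<le> M" and "b \<ge> 0"
  shows "\<exists>y. y 0 = x \<and> (\<forall>t\<in>{0..b}. norm (y t - x) \<le> M * t \<and>
     (y has_vector_derivative g (y t)) (at t within {0..b}))"
proof -
  define \<delta> where "\<delta> n = inverse (real (Suc n))" for n
  have \<delta>: "\<delta> n > 0" "\<delta> \<longlonglongrightarrow> 0" for n
    using LIMSEQ_inverse_real_of_nat by (auto simp: \<delta>_def[abs_def])
  have M: "M \<ge> 0" using g(2)[of 0] norm_ge_zero order_trans by blast
  have "\<forall>n. \<exists>y. continuous_on UNIV y \<and> (\<forall>t\<le>0. y t = x) \<and>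
     (\<forall>t\<in>{0..b}. y t = x + integral {0..t} (\<lambda>s. g (y (s - \<delta> n))))
     \<and> (\<forall>s\<ge>0. \<forall>t\<ge>0. norm (y t - y s) \<le> M * \<bar>t - s\<bar>)"
    using delayed_solution_exists[OF g \<delta>(1)] by blast
  from choice[OF this] obtain Y where Y: "\<And>n. continuous_on UNIV (Y n) \<and> (\<forall>t\<le>0. Y n t = x) \<and>
     (\<forall>t\<in>{0..b}. Y n t = x + integral {0..t} (\<lambda>s. g (Y n (s - \<delta> n))))
     \<and> (\<forall>s\<ge>0. \<forall>t\<ge>0. norm (Y n t - Y n s) \<le> M * \<bar>t - s\<bar>)" by blast
  then have Yc: "\<And>n. continuous_on UNIV (Y n)" and Y0: "\<And>n t. t \<le> 0 \<Longrightarrow> Y n t = x"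
    and Yint: "\<And>n t. t \<in> {0..b} \<Longrightarrow> Y n t = x + integral {0..t} (\<lambda>s. g (Y n (s - \<delta> n)))"
    and Ylip: "\<And>n s t. s \<ge> 0 \<Longrightarrow> t \<ge> 0 \<Longrightarrow> norm (Y n t - Y n s) \<le> M * \<bar>t - s\<bar>"
    by blast+
  have Yx: "norm (Y n t - x) \<le> M * t" if "t \<ge> 0" for n t
    using Ylip[of 0 t n] Y0[of 0 n] that by simp
  have Yb: "norm (Y n t) \<le> norm x + M * b" if "t \<in> {0..b}" for n t
  proof -
    have "norm (Y n t) \<le> norm x + norm (Y n t - x)" by (metis add.commute diff_add_cancel norm_triangle_ineq)
    also have "\<dots> \<le> norm x + M * t" using Yx that by simp
    also have "\<dots> \<le> norm x + M * b" using that M by (simp add: mult_left_mono)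
    finally show ?thesis .
  qed
  have equi: "\<exists>d. 0 < d \<and> (\<forall>n s. s \<in> {0..b} \<and> norm (t - s) < d \<longrightarrow> norm (Y n t - Y n s) < e)"
    if t: "t \<in> {0..b}" and e: "0 < e" for t e
  proof (intro exI[of _ "e / (M + 1)"] conjI allI impI)
    show "0 < e / (M + 1)" using e M by simp
    fix n s assume s: "s \<in> {0..b} \<and> norm (t - s) < e / (M + 1)"
    have "norm (Y n t - Y n s) \<le> M * \<bar>t - s\<bar>" using s t by (intro Ylip) auto
    also have "\<dots> \<le> (M + 1) * \<bar>t - s\<bar>" by (simp add: mult_right_mono)
    also have "\<dots> < e" using s M by (simp add: field_simps)
    finally show "norm (Y n t - Y n s) < e" .
  qed
  obtain y k where y: "continuous_on {0..b} y" and k: "strict_mono (k :: nat \<Rightarrow> nat)"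
    and unif: "\<And>e. 0 < e \<Longrightarrow> \<exists>N. \<forall>n t. n \<ge> N \<and> t \<in> {0..b} \<longrightarrow> norm (Y (k n) t - y t) < e"
    by (rule Arzela_Ascoli[OF compact_Icc Yb equi]) blast+
  have lim: "(\<lambda>n. Y (k n) t) \<longlonglongrightarrow> y t" if "t \<in> {0..b}" for t
    using unif that by (force simp: lim_sequentially dist_norm)
  have \<delta>k: "(\<lambda>n. \<delta> (k n)) \<longlonglongrightarrow> 0" using LIMSEQ_subseq_LIMSEQ[OF \<delta>(2) k] by (simp add: o_def)
  have y0: "y 0 = x" using LIMSEQ_unique[OF lim[of 0]] Y0[of 0] \<open>b \<ge> 0\<close> by simp
  have lim\<delta>: "(\<lambda>n. Y (k n) (t - \<delta> (k n))) \<longlonglongrightarrow> y t" if t: "t \<in> {0..b}" for t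
  proof -
    have bd: "norm (Y (k n) (t - \<delta> (k n)) - Y (k n) t) \<le> M * \<delta> (k n)" for n
    proof (cases "t - \<delta> (k n) \<ge> 0")
      case True then show ?thesis using Ylip[of t "t - \<delta> (k n)" "k n"] t \<delta>(1)[of "k n"] by simp
    next
      case False
      then have "norm (Y (k n) (t - \<delta> (k n)) - Y (k n) t) \<le> M * t"
        using Yx[of t "k n"] t by (simp add: Y0 norm_minus_commute)
      also have "\<dots> \<le> M * \<delta> (k n)" using False M by (intro mult_left_mono) auto
      finally show ?thesis .
    qed
    have "(\<lambda>n. M * \<delta> (k n)) \<longlonglongrightarrow> 0" using tendsto_mult_right_zero[OF \<delta>k] by simp
    then have "(\<lambda>n. Y (k n) (t - \<delta> (k n)) - Y (k n) t) \<longlonglongrightarrow> 0"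
      by (rule Lim_null_comparison[rotated]) (use bd in auto)
    from tendsto_add[OF this lim[OF t]] show ?thesis by simp
  qed
  have gy: "continuous_on {0..b} (\<lambda>s. g (y s))"
    by (intro continuous_on_compose2[OF g(1) y]) auto
  have yint: "y t = x + integral {0..t} (\<lambda>s. g (y s))" if t: "t \<in> {0..b}" for t
  proof -
    have "(\<lambda>n. integral {0..t} (\<lambda>s. g (Y (k n) (s - \<delta> (k n))))) \<longlonglongrightarrow> integral {0..t} (\<lambda>s. g (y s))"
    proof (rule dominated_convergence(2)[where h = "\<lambda>s. M"])
      show "(\<lambda>s. g (Y (k n) (s - \<delta> (k n)))) integrable_on {0..t}" for n
        by (intro integrable_continuous_interval continuous_on_compose2[OF g(1)]
            continuous_on_compose2[OF Yc] continuous_intros) auto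
      show "(\<lambda>n. g (Y (k n) (s - \<delta> (k n)))) \<longlonglongrightarrow> g (y s)" if "s \<in> {0..t}" for s
      proof -
        have "isCont g (y s)" using g(1) by (simp add: continuous_on_eq_continuous_at)
        then show ?thesis by (rule isCont_tendsto_compose) (use lim\<delta> that t in auto)
      qed
    qed (use g(2) in auto)
    then have "(\<lambda>n. x + integral {0..t} (\<lambda>s. g (Y (k n) (s - \<delta> (k n))))) \<longlonglongrightarrow> x + integral {0..t} (\<lambda>s. g (y s))"
      by (intro tendsto_intros)
    then show ?thesis using LIMSEQ_unique[OF lim[OF t]] by (simp add: Yint[OF t])
  qed
  have "(y has_vector_derivative g (y t)) (at t within {0..b})" if t: "t \<in> {0..b}" for t
  proof (rule has_vector_derivative_transform[OF t])
    show "((\<lambda>t. x + integral {0..t} (\<lambda>s. g (y s))) has_vector_derivative g (y t)) (at t within {0..b})"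
      using integral_has_vector_derivative[OF gy t] by (auto intro!: derivative_eq_intros)
  qed (rule yint)
  moreover have "norm (y t - x) \<le> M * t" if t: "t \<in> {0..b}" for t
    by (rule LIMSEQ_le_const2[OF tendsto_norm[OF tendsto_diff[OF lim[OF t] tendsto_const]]])
       (use Yx t in auto)
  ultimately show ?thesis using y0 by blast
qed

text \<open>
  Composing \<open>g\<close> with the projection onto the ball gives a bounded continuous field on the whole
  space, and its integral curves cannot leave the ball before time \<open>b\<close>.
\<close>

theorem peano:
  fixes g :: "real ^ 'n \<Rightarrow> real ^ 'n"
  assumes g: "continuous_on (cball x (M * b)) g" "\<And>z. z \<in> cball x (M * b) \<Longrightarrow> norm (g z) \<le> M"
    and "b \<ge> 0" "M \<ge> 0"
  shows "\<exists>y. y 0 = x \<and> (\<forall>t\<in>{0..b}. y t \<in> cball x (M * b) \<and>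
     (y has_vector_derivative g (y t)) (at t within {0..b}))"
proof -
  let ?B = "cball x (M * b)"
  have ne: "?B \<noteq> {}" using mult_nonneg_nonneg[OF \<open>M \<ge> 0\<close> \<open>b \<ge> 0\<close>] by simp
  define h where "h z = g (closest_point ?B z)" for z
  have hc: "continuous_on UNIV h" unfolding h_def
    by (intro continuous_on_compose2[OF g(1) continuous_on_closest_point])
       (use ne closest_point_in_set[OF closed_cball ne] in auto)
  have hb: "norm (h z) \<le> M" for z
    unfolding h_def by (rule g(2)) (rule closest_point_in_set[OF closed_cball ne])
  obtain y where y: "y 0 = x" "\<And>t. t \<in> {0..b} \<Longrightarrow> norm (y t - x) \<le> M * t"
     "\<And>t. t \<in> {0..b} \<Longrightarrow> (y has_vector_derivative h (y t)) (at t within {0..b})"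
    using integral_curve_of_bounded_continuous[OF hc hb \<open>b \<ge> 0\<close>] by blast
  have yB: "y t \<in> ?B" if "t \<in> {0..b}" for t
  proof -
    have "norm (y t - x) \<le> M * b" using y(2)[OF that] that \<open>M \<ge> 0\<close>
      by (meson atLeastAtMost_iff mult_left_mono order_trans)
    then show ?thesis by (simp add: dist_norm norm_minus_commute)
  qed
  have "h (y t) = g (y t)" if "t \<in> {0..b}" for t
    using closest_point_self[OF yB[OF that]] by (simp add: h_def)
  then show ?thesis using y yB by metis
qed

section \<open>Uniform decrease of the Lyapunov function\<close>

text \<open>
  The pieces of which trajectories are composed.  The Lipschitz condition replaces absolute
  continuity, and the finite exceptional set contains the switching times.
\<close>

definition admissible_arc ::
    "(real ^ 'n) set \<Rightarrow> ('m::finite \<Rightarrow> real ^ 'n \<Rightarrow> real ^ 'n) \<Rightarrow> real \<Rightarrow>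
     (real \<Rightarrow> real ^ 'n) \<Rightarrow> (real \<Rightarrow> real ^ 'm) \<Rightarrow> bool" where
  "admissible_arc T f \<sigma> y \<alpha> \<longleftrightarrow> 0 < \<sigma> \<and> (\<exists>L. L-lipschitz_on {0..\<sigma>} y) \<and> (\<forall>t\<in>{0..\<sigma>}. y t \<notin> T) \<and>
     (\<exists>N. finite N \<and> (\<forall>t\<in>{0<..<\<sigma>} - N.
        (y has_vector_derivative (\<Sum>i\<in>UNIV. \<alpha> t $ i *\<^sub>R f i (y t))) (at t))) \<and>
     \<alpha> \<in> borel_measurable borel \<and> (\<forall>t. \<alpha> t \<in> control_set)"

text \<open>
  The bound 1 on the duration ties elapsed time to the number of steps; the bound \<open>2 * U x\<close> keeps
  the overshoot within a step under control.
\<close>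

definition can_lower ::
    "(real ^ 'n) set \<Rightarrow> ('m::finite \<Rightarrow> real ^ 'n \<Rightarrow> real ^ 'n) \<Rightarrow> (real ^ 'n \<Rightarrow> real) \<Rightarrow>
     real ^ 'n \<Rightarrow> real \<Rightarrow> bool" where
  "can_lower T f U x \<mu> \<longleftrightarrow> (\<exists>\<sigma> y \<alpha>. \<sigma> \<le> 1 \<and> admissible_arc T f \<sigma> y \<alpha> \<and> y 0 = x \<and>
     (\<forall>t\<in>{0..\<sigma>}. U (y t) \<le> 2 * U x) \<and> U (y \<sigma>) \<le> U x - \<mu>)"

lemma can_lower_mono:
  assumes "can_lower T f U x \<mu>" "\<mu>' \<le> \<mu>"
  shows "can_lower T f U x \<mu>'"
proof -
  obtain \<sigma> y \<alpha> where y: "\<sigma> \<le> 1" "admissible_arc T f \<sigma> y \<alpha>" "y 0 = x"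
      "\<forall>t\<in>{0..\<sigma>}. U (y t) \<le> 2 * U x" "U (y \<sigma>) \<le> U x - \<mu>"
    using assms(1) unfolding can_lower_def by (elim exE conjE) (rule that)
  have "U (y \<sigma>) \<le> U x - \<mu>'" using y(5) assms(2) by simp
  with y(1-4) show ?thesis unfolding can_lower_def by blast
qed

lemma has_vector_derivative_shift:
  assumes "(y has_vector_derivative v) (at (t - c))"
  shows "((\<lambda>t. y (t - c)) has_vector_derivative v) (at (t :: real))"
proof -
  have "((\<lambda>t. t - c) has_vector_derivative 1) (at t)"
    by (auto intro!: derivative_eq_intros)
  from vector_diff_chain_at[OF this, of y v] assms show ?thesis by (simp add: o_def)
qed

lemma lipschitz_on_shift:
  assumes "L-lipschitz_on {a..b} y"
  shows "L-lipschitz_on {a + c..b + c} (\<lambda>t. y (t - c :: real))"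
proof (rule lipschitz_onI)
  show "L \<ge> 0" using assms by (rule lipschitz_on_nonneg)
  fix s t assume "s \<in> {a + c..b + c}" "t \<in> {a + c..b + c}"
  then show "dist (y (s - c)) (y (t - c)) \<le> L * dist s t"
    using lipschitz_onD[OF assms, of "s - c" "t - c"] by (auto simp: dist_real_def)
qed

lemma admissible_arc_append:
  assumes 1: "admissible_arc T f \<sigma>1 y1 \<alpha>1" and 2: "admissible_arc T f \<sigma>2 y2 \<alpha>2" and join: "y1 \<sigma>1 = y2 0"
  shows "admissible_arc T f (\<sigma>1 + \<sigma>2) (\<lambda>t. if t \<le> \<sigma>1 then y1 t else y2 (t - \<sigma>1))
    (\<lambda>t. if t < \<sigma>1 then \<alpha>1 t else \<alpha>2 (t - \<sigma>1))" (is "admissible_arc _ _ _ ?y ?\<alpha>")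
proof -
  obtain L1 L2 where L: "L1-lipschitz_on {0..\<sigma>1} y1" "L2-lipschitz_on {0..\<sigma>2} y2"
    using 1 2 by (auto simp: admissible_arc_def)
  have "\<exists>N. finite N \<and> (\<forall>t\<in>{0<..<\<sigma>1} - N. (y1 has_vector_derivative (\<Sum>i\<in>UNIV. \<alpha>1 t $ i *\<^sub>R f i (y1 t))) (at t))"
    using 1 unfolding admissible_arc_def by (elim conjE)
  moreover have "\<exists>N. finite N \<and> (\<forall>t\<in>{0<..<\<sigma>2} - N. (y2 has_vector_derivative (\<Sum>i\<in>UNIV. \<alpha>2 t $ i *\<^sub>R f i (y2 t))) (at t))"
    using 2 unfolding admissible_arc_def by (elim conjE)
  ultimately obtain N1 N2 where N: "finite N1" "finite N2"
    "\<And>t. t \<in> {0<..<\<sigma>1} - N1 \<Longrightarrow> (y1 has_vector_derivative (\<Sum>i\<in>UNIV. \<alpha>1 t $ i *\<^sub>R f i (y1 t))) (at t)"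
    "\<And>t. t \<in> {0<..<\<sigma>2} - N2 \<Longrightarrow> (y2 has_vector_derivative (\<Sum>i\<in>UNIV. \<alpha>2 t $ i *\<^sub>R f i (y2 t))) (at t)"
    by blast
  have pos: "\<sigma>1 > 0" "\<sigma>2 > 0" and meas: "\<alpha>1 \<in> borel_measurable borel" "\<alpha>2 \<in> borel_measurable borel"
    using 1 2 by (auto simp: admissible_arc_def)
  have "(max L1 L2)-lipschitz_on {0..\<sigma>1 + \<sigma>2} ?y"
    by (rule lipschitz_on_concat_max[OF L(1)])
       (use lipschitz_on_shift[OF L(2), of \<sigma>1] join in \<open>auto simp: add.commute\<close>)
  moreover have "?y t \<notin> T" if "t \<in> {0..\<sigma>1 + \<sigma>2}" for t
    using 1 2 that by (auto simp: admissible_arc_def)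
  moreover have "(?y has_vector_derivative (\<Sum>i\<in>UNIV. ?\<alpha> t $ i *\<^sub>R f i (?y t))) (at t)"
    if t: "t \<in> {0<..<\<sigma>1 + \<sigma>2} - (insert \<sigma>1 (N1 \<union> (\<lambda>t. t + \<sigma>1) ` N2))" for t
  proof (cases "t < \<sigma>1")
    case True
    have "(y1 has_vector_derivative (\<Sum>i\<in>UNIV. \<alpha>1 t $ i *\<^sub>R f i (y1 t))) (at t)"
      using t True by (intro N(3)) auto
    from has_vector_derivative_transform_within_open[OF this, of "{..<\<sigma>1}" ?y]
    show ?thesis using True by simp
  next
    case False
    then have gt: "t > \<sigma>1" using t by auto
    have "t - \<sigma>1 \<in> {0<..<\<sigma>2} - N2" using t gt by (auto simp: image_iff)
    from has_vector_derivative_shift[OF N(4)[OF this]]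
    have "((\<lambda>t. y2 (t - \<sigma>1)) has_vector_derivative (\<Sum>i\<in>UNIV. \<alpha>2 (t - \<sigma>1) $ i *\<^sub>R f i (y2 (t - \<sigma>1)))) (at t)" .
    from has_vector_derivative_transform_within_open[OF this, of "{\<sigma>1<..}" ?y]
    show ?thesis using gt by simp
  qed
  moreover have "finite (insert \<sigma>1 (N1 \<union> (\<lambda>t. t + \<sigma>1) ` N2))" using N by simp
  moreover have "?\<alpha> \<in> borel_measurable borel" using meas by measurable
  moreover have "?\<alpha> t \<in> control_set" for t using 1 2 by (auto simp: admissible_arc_def)
  ultimately show ?thesis unfolding admissible_arc_def using pos
    by (intro conjI exI[of _ "max L1 L2"] exI[of _ "insert \<sigma>1 (N1 \<union> (\<lambda>t. t + \<sigma>1) ` N2)"]) auto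
qed

lemma integral_curve_admissible_arc:
  fixes f :: "'m::finite \<Rightarrow> real ^ 'n \<Rightarrow> real ^ 'n"
  assumes y: "integral_curve f C t p y" and p: "fst p = 1 \<or> fst p = - 1" and "t > 0" and C: "C \<inter> T = {}"
    and M: "\<And>i z. z \<in> C \<Longrightarrow> norm (f i z) \<le> M"
  shows "admissible_arc T f t y (\<lambda>_. fst p *\<^sub>R axis (snd p) 1)"
proof -
  have "0 \<in> {0..t}" using \<open>t > 0\<close> by simp
  then have "y 0 \<in> C" using y unfolding integral_curve_def by blast
  then have "M \<ge> 0" using M norm_ge_zero order_trans by blast
  have "M-lipschitz_on {0..t} y"
    using integral_curve_lipschitz[OF y M] p \<open>M \<ge> 0\<close> by (intro lipschitz_onI) (auto simp: dist_norm dist_real_def)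
  moreover have "(y has_vector_derivative (\<Sum>i\<in>UNIV. (fst p *\<^sub>R axis (snd p) 1 :: real ^ 'm) $ i *\<^sub>R f i (y \<tau>))) (at \<tau>)"
    if \<tau>: "\<tau> \<in> {0<..<t}" for \<tau>
  proof -
    have "(\<Sum>i\<in>UNIV. (fst p *\<^sub>R axis (snd p) 1 :: real ^ 'm) $ i *\<^sub>R f i (y \<tau>))
        = (\<Sum>i\<in>UNIV. if i = snd p then fst p *\<^sub>R f i (y \<tau>) else 0)"
      by (intro sum.cong refl) (auto simp: axis_def)
    also have "\<dots> = fst p *\<^sub>R f (snd p) (y \<tau>)" by simp
    finally have eq: "(\<Sum>i\<in>UNIV. (fst p *\<^sub>R axis (snd p) 1 :: real ^ 'm) $ i *\<^sub>R f i (y \<tau>)) = fst p *\<^sub>R f (snd p) (y \<tau>)" .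
    have "(y has_vector_derivative fst p *\<^sub>R f (snd p) (y \<tau>)) (at \<tau> within {0..t})"
      using y \<tau> by (simp add: integral_curve_def)
    moreover have "at \<tau> within {0..t} = at \<tau>" using \<tau> by (intro at_within_Icc_at) auto
    ultimately show ?thesis unfolding eq by simp
  qed
  moreover have "fst p *\<^sub>R axis (snd p) 1 \<in> (control_set :: (real ^ 'm) set)"
    using p by (auto simp: control_set_def)
  ultimately show ?thesis
    unfolding admissible_arc_def using \<open>t > 0\<close> y C by (auto simp: integral_curve_def intro!: exI[of _ "{}"])
qed

lemma steers_admissible_arc:
  assumes "t > 0" and C: "C \<inter> T = {}" and M: "\<And>i z. z \<in> C \<Longrightarrow> norm (f i z) \<le> M"
    and "steers f C t ps x z" "ps \<noteq> []" "\<forall>p\<in>set ps. fst p = 1 \<or> fst p = - 1"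
  shows "\<exists>y \<alpha>. admissible_arc T f (real (length ps) * t) y \<alpha> \<and> y 0 = x \<and> y (real (length ps) * t) = z \<and>
    (\<forall>\<tau>\<in>{0..real (length ps) * t}. y \<tau> \<in> C)"
  using assms(4-)
proof (induction ps arbitrary: x)
  case Nil then show ?case by simp
next
  case (Cons p ps)
  obtain y1 where y1: "integral_curve f C t p y1" "y1 0 = x" "steers f C t ps (y1 t) z"
    using Cons.prems by auto
  have a1: "admissible_arc T f t y1 (\<lambda>_. fst p *\<^sub>R axis (snd p) 1)"
    using Cons.prems by (intro integral_curve_admissible_arc[OF y1(1) _ \<open>t > 0\<close> C M]) auto
  have C1: "\<forall>\<tau>\<in>{0..t}. y1 \<tau> \<in> C" using y1(1) by (simp add: integral_curve_def)
  show ?case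
  proof (cases "ps = []")
    case True then show ?thesis using a1 C1 y1 by auto
  next
    case False
    then obtain y2 \<alpha>2 where y2: "admissible_arc T f (real (length ps) * t) y2 \<alpha>2" "y2 0 = y1 t"
      "y2 (real (length ps) * t) = z" "\<forall>\<tau>\<in>{0..real (length ps) * t}. y2 \<tau> \<in> C"
      using Cons.IH[OF y1(3)] Cons.prems by auto
    have len: "t + real (length ps) * t = real (length (p # ps)) * t" by (simp add: algebra_simps)
    have pos: "real (length ps) * t > 0" using False \<open>t > 0\<close> by simp
    show ?thesis
      using admissible_arc_append[OF a1 y2(1) y2(2)[symmetric]] y1(2) y2(3,4) C1 \<open>t > 0\<close> pos unfolding len[symmetric]
      by (intro exI conjI) (assumption, auto)
  qed
qed

text \<open>
  A curve moving with speed at most \<open>M\<close> for time \<open>length ps * t\<close> stays in the ball, so Peano's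
  theorem applies to each letter in turn.
\<close>

lemma steers_exists:
  assumes "t > 0" "M \<ge> 0"
    and "\<And>i. continuous_on (cball x (M * (real (length ps) * t))) (f i)"
    and "\<And>i z. z \<in> cball x (M * (real (length ps) * t)) \<Longrightarrow> norm (f i z) \<le> M"
    and "\<forall>p\<in>set ps. fst p = 1 \<or> fst p = - 1"
  shows "\<exists>z. steers f (cball x (M * (real (length ps) * t))) t ps x z"
  using assms(3-)
proof (induction ps arbitrary: x)
  case Nil then show ?case by simp
next
  case (Cons p ps)
  let ?B = "cball x (M * (real (length (p # ps)) * t))"
  have "M * t \<le> M * (real (length (p # ps)) * t)" using \<open>t > 0\<close> \<open>M \<ge> 0\<close>
    by (simp add: mult_left_mono algebra_simps)
  then have sub1: "cball x (M * t) \<subseteq> ?B" by auto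
  have "\<exists>y. y 0 = x \<and> (\<forall>\<tau>\<in>{0..t}. y \<tau> \<in> cball x (M * t) \<and>
     (y has_vector_derivative fst p *\<^sub>R f (snd p) (y \<tau>)) (at \<tau> within {0..t}))"
  proof (rule peano)
    show "continuous_on (cball x (M * t)) (\<lambda>z. fst p *\<^sub>R f (snd p) z)"
      by (intro continuous_intros continuous_on_subset[OF Cons.prems(1) sub1])
    show "norm (fst p *\<^sub>R f (snd p) z) \<le> M" if "z \<in> cball x (M * t)" for z
      using Cons.prems(2)[of z "snd p"] Cons.prems(3) that sub1 by auto
  qed (use assms in auto)
  then obtain y where y: "y 0 = x" "integral_curve f (cball x (M * t)) t p y"
    unfolding integral_curve_def by blast
  have "y t \<in> cball x (M * t)" using y(2) \<open>t > 0\<close> by (auto simp: integral_curve_def)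
  then have sub2: "cball (y t) (M * (real (length ps) * t)) \<subseteq> ?B"
    by (simp add: cball_subset_cball_iff algebra_simps dist_commute)
  obtain z where z: "steers f (cball (y t) (M * (real (length ps) * t))) t ps (y t) z"
    using Cons.IH[of "y t"] Cons.prems sub2 continuous_on_subset by (metis list.set_intros(2) subsetD)
  show ?case unfolding steers.simps
    using y(1) steers_mono[OF z sub2] integral_curve_mono[OF y(2) sub1]
    by (intro exI[of _ z] exI[of _ y] conjI)
qed

lemma finite_brackets: "finite {b :: 'm::finite bracket. bracket_degree b \<le> h}"
proof (induction h)
  case 0
  have "b \<notin> {b. bracket_degree b \<le> 0}" for b :: "'m bracket" using bracket_degree_pos[of b] by simp
  then have "{b :: 'm bracket. bracket_degree b \<le> 0} = {}" by blast
  then show ?case by (metis finite.emptyI)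
next
  case (Suc h)
  let ?S = "{b :: 'm bracket. bracket_degree b \<le> h}"
  have "b \<in> range Field \<union> (\<lambda>(b, c). Br b c) ` (?S \<times> ?S)" if "bracket_degree b \<le> Suc h" for b :: "'m bracket"
  proof (cases b)
    case (Br c d)
    then have "bracket_degree c \<le> h" "bracket_degree d \<le> h"
      using that bracket_degree_pos[of c] bracket_degree_pos[of d] by auto
    then show ?thesis using Br by auto
  qed auto
  then have "{b :: 'm bracket. bracket_degree b \<le> Suc h} \<subseteq> range Field \<union> (\<lambda>(b, c). Br b c) ` (?S \<times> ?S)"
    by blast
  then show ?case by (rule finite_subset) (use Suc in auto)
qed

lemma finite_bracket_family:
  fixes f :: "'m::finite \<Rightarrow> real ^ 'n \<Rightarrow> real ^ 'n"
  shows "finite (bracket_family f h)"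
proof -
  have "finite (bracket_value f ` {b. bracket_degree b \<le> h})" by (intro finite_imageI finite_brackets)
  then have "finite {bracket_value f b | b. 2 \<le> bracket_degree b \<and> bracket_degree b \<le> h}"
    by (rule rev_finite_subset) auto
  moreover have "finite (range f)" "finite (range (\<lambda>i x. - f i x))" by auto
  moreover have "{f i | i. True} = range f" "{(\<lambda>x. - f i x) | i. True} = range (\<lambda>i x. - f i x)" by auto
  ultimately show ?thesis by (simp add: bracket_family_def)
qed

lemma hamiltonian_neg_imp:
  fixes f :: "'m::finite \<Rightarrow> real ^ 'n \<Rightarrow> real ^ 'n"
  assumes "hamiltonian f h x p < 0"
  shows "\<exists>X\<in>bracket_family f h. p \<bullet> X x < 0"
proof -
  let ?S = "(\<lambda>v. p \<bullet> v) ` bracket_family_at f h x"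
  have fam: "bracket_family_at f h x = (\<lambda>X. X x) ` bracket_family f h"
    by (auto simp: bracket_family_at_def)
  have fin: "finite ?S" by (simp add: fam finite_bracket_family)
  have ne: "?S \<noteq> {}" by (auto simp: fam bracket_family_def)
  have "\<exists>s\<in>?S. s < 0"
    by (rule bexI[OF _ Min_in[OF fin ne]]) (use assms in \<open>simp add: hamiltonian_def cInf_eq_Min[OF fin ne]\<close>)
  then show ?thesis by (auto simp: fam)
qed

context Cb_fields
begin

lemma bracket_family_continuous:
  assumes "X \<in> bracket_family f k"
  shows "continuous_on D X"
proof -
  have "continuous_on D (f i)" for i using Cb_continuous[OF fields_Cb] .
  moreover have "continuous_on D (bracket_value f b)" if "bracket_degree b \<le> k" for b
    using Cb_continuous[OF bracket_value_Cb[OF that]] .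
  ultimately show ?thesis using assms by (auto simp: bracket_family_def intro!: continuous_intros)
qed

text \<open>
  A negated field is realized by its flow run backwards; every other member of the family is the
  value of a bracket, of degree 1 for the fields themselves.
\<close>

theorem bracket_family_realizable:
  assumes "bounded D" and C: "compact C" "C \<subseteq> D" and "k \<ge> 1" and X: "X \<in> bracket_family f k"
  shows "\<exists>ps h. ps \<noteq> [] \<and> h \<ge> 1 \<and> (\<forall>p\<in>set ps. fst p = 1 \<or> fst p = - 1) \<and>
    realizes f C ps h X"
proof -
  consider i where "X = (\<lambda>x. - f i x)" | b where "X = bracket_value f b" "bracket_degree b \<le> k"
  proof -
    have "f i = bracket_value f (Field i)" "bracket_degree (Field i) \<le> k" for i
      using \<open>k \<ge> 1\<close> by simp_all
    then show ?thesis using X that unfolding bracket_family_def by blast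
  qed
  then show ?thesis
  proof cases
    case (1 i)
    have "realizes f C [(- 1, i)] 1 X"
      using single_flow_expansion[OF assms(1) C \<open>k \<ge> 1\<close>, of "- 1" i] by (simp add: 1)
    then show ?thesis by (intro exI[of _ "[(- 1, i)]"] exI[of _ "1 :: nat"]) simp
  next
    case (2 b)
    then show ?thesis
      using bracket_word_expansion[OF assms(1) C 2(2)] bracket_word_nonempty[of b] bracket_word_sign[of b]
        bracket_degree_pos[of b]
      by (intro exI[of _ "bracket_word b"] exI[of _ "bracket_degree b"]) simp
  qed
qed

end

text \<open>
  For \<open>x\<close> in the annulus take \<open>p\<close> and \<open>X\<close> from the uniform descent direction and follow the control
  word of \<open>X\<close>, each letter for time \<open>t\<close>.  Since \<open>w = z - x\<close> is within \<open>\<epsilon> t\<^sup>h\<close> of \<open>t\<^sup>h X x\<close> for a small fixed \<open>\<epsilon>\<close>, one has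
  \<open>p \<bullet> w \<le> - (3/4) c\<^sub>0 t\<^sup>h\<close> and \<open>\<rho> |w|\<^sup>2 = O(t\<^bsup>2h\<^esup>) \<le> (1/4) c\<^sub>0 t\<^sup>h\<close> once \<open>t\<close> is small.
  A suitable \<open>t\<close> depends on \<open>X\<close> only, and there are finitely many \<open>X\<close>.
\<close>

theorem uniform_decrease_step:
  fixes f :: "'m::finite \<Rightarrow> real ^ 'n \<Rightarrow> real ^ 'n"
  assumes k: "k \<ge> 1" and T: "closed T"
    and f: "\<And>\<Omega> i. open \<Omega> \<Longrightarrow> bounded \<Omega> \<Longrightarrow> f i \<in> Cb (k - 1) (\<Omega> - T)"
    and U: "control_lyapunov_function k T f U" and a: "0 < a"
  shows "\<exists>\<mu>>0. \<forall>x. x \<notin> T \<and> a \<le> U x \<and> U x \<le> b \<longrightarrow> can_lower T f U x \<mu>"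
proof -
  define K where "K = {x \<in> closure (- T). U x \<in> {a..b}}"
  have K_iff: "x \<in> K \<longleftrightarrow> x \<notin> T \<and> a \<le> U x \<and> U x \<le> b" for x
  proof
    assume x: "x \<in> K"
    have "x \<notin> frontier T"
      using U x a by (auto simp: K_def control_lyapunov_function_def positive_definite_off_def)
    then show "x \<notin> T \<and> a \<le> U x \<and> U x \<le> b" using x T
      by (auto simp: K_def frontier_closures)
  qed (use closure_subset[of "- T"] in \<open>auto simp: K_def\<close>)
  have K: "compact K" "K \<subseteq> - T"
  proof -
    have "compact {a..b} \<and> {a..b} \<subseteq> {0..}" using a by auto
    then show "compact K" unfolding K_def
      using U unfolding control_lyapunov_function_def proper_off_def by blast
  qed (use K_iff in blast)
  have fields: "Cb_fields f k (\<Omega> - T)" if "open \<Omega>" "bounded \<Omega>" for \<Omega>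
    using that f T by unfold_locales (auto intro: open_Diff)
  show ?thesis
  proof (cases "K = {}")
    case True then show ?thesis using K_iff by (intro exI[of _ 1]) auto
  next
    case False
    let ?XS = "bracket_family f k"
    have XSc: "continuous_on (- T) X" if X: "X \<in> ?XS" for X
    proof (rule continuous_at_imp_continuous_on, rule ballI)
      fix x assume x: "x \<in> - T"
      have "continuous_on (ball x 1 - T) X"
        by (rule Cb_fields.bracket_family_continuous[OF fields X]) auto
      then show "isCont X x"
        using x T by (simp add: continuous_on_eq_continuous_at open_Diff)
    qed
    have CLF: "continuous_on (closure (- T)) U" "locally_semiconcave_on (- T) U"
      "\<And>x p. x \<notin> T \<Longrightarrow> p \<in> limiting_gradients (- T) U x \<Longrightarrow> hamiltonian f k x p < 0"
      using U by (auto simp: control_lyapunov_function_def)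
    have Uc: "continuous_on (- T) U" by (rule continuous_on_subset[OF CLF(1) closure_subset])
    have O: "open (- T)" using T by (rule open_Compl)
    have neg: "\<exists>X\<in>?XS. p \<bullet> X x < 0" if "x \<in> - T" "p \<in> limiting_gradients (- T) U x" for x p
      using hamiltonian_neg_imp CLF(3) that by blast
    obtain c0 L \<rho> r where r: "c0 > 0" "L \<ge> 0" "\<rho> \<ge> 0" "r > 0"
      and N: "compact {x. infdist x K \<le> r}" "{x. infdist x K \<le> r} \<subseteq> - T"
      and descent: "\<forall>x\<in>K. \<exists>p. \<exists>X\<in>?XS. norm p \<le> L \<and> p \<bullet> X x \<le> - c0 \<and>
       (\<forall>z\<in>cball x r. U z \<le> U x + p \<bullet> (z - x) + \<rho> * (norm (z - x))\<^sup>2)"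
      by (rule uniform_descent_direction[OF O Uc CLF(2) finite_bracket_family XSc neg K False])
    define C where "C = {x. infdist x K \<le> r}"
    have C: "compact C" "C \<subseteq> - T" using N by (auto simp: C_def)
    have ballC: "cball x s \<subseteq> C" if "x \<in> K" "s \<le> r" for x s
    proof
      fix z assume "z \<in> cball x s"
      then show "z \<in> C" using infdist_le[OF that(1), of z] that(2) by (simp add: C_def dist_commute)
    qed
    obtain R where R: "C \<subseteq> ball 0 R" using compact_imp_bounded[OF C(1)] bounded_subset_ballD by blast
    define D where "D = ball 0 R - T"
    have D: "bounded D" "C \<subseteq> D" using R C by (auto simp: D_def intro: bounded_subset[OF bounded_ball])
    interpret Cb_fields f k D unfolding D_def by (rule fields) auto
    obtain M where M: "M > 0" "\<And>i x. x \<in> D \<Longrightarrow> norm (f i x) \<le> M" using fields_bounded by blast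
    have "uniformly_continuous_on C U"
      using compact_uniformly_continuous[OF continuous_on_subset[OF Uc C(2)] C(1)] .
    then obtain r0 where r0: "r0 > 0" "\<And>u v. u \<in> C \<Longrightarrow> v \<in> C \<Longrightarrow> dist v u < r0 \<Longrightarrow> dist (U v) (U u) < a"
      using a unfolding uniformly_continuous_on_def by metis
    \<comment> \<open>within distance \<open>r'\<close> the value of \<open>U\<close> changes by less than \<open>a \<le> U x\<close>\<close>
    define r' where "r' = min r (r0 / 2)"
    have r': "r' > 0" "r' \<le> r" "r' < r0" using r(4) r0(1) by (auto simp: r'_def)
    define \<epsilon> where "\<epsilon> = min 1 (c0 / (4 * (L + 1)))"
    have \<epsilon>: "\<epsilon> > 0" "\<epsilon> \<le> 1" using r(1,2) by (auto simp: \<epsilon>_def)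
    have L\<epsilon>: "L * \<epsilon> \<le> c0 / 4"
    proof -
      have "L * \<epsilon> \<le> L * (c0 / (4 * (L + 1)))" using r(2) by (intro mult_left_mono) (auto simp: \<epsilon>_def)
      also have "\<dots> \<le> (L + 1) * (c0 / (4 * (L + 1)))" using r(1,2) by (intro mult_right_mono) auto
      also have "\<dots> = c0 / 4" using r(2) by (simp add: field_simps)
      finally show ?thesis .
    qed
    have "\<exists>\<mu>>0. \<forall>x\<in>K. \<forall>p. norm p \<le> L \<and> p \<bullet> X x \<le> - c0 \<and>
       (\<forall>z\<in>cball x r. U z \<le> U x + p \<bullet> (z - x) + \<rho> * (norm (z - x))\<^sup>2) \<longrightarrow>
       can_lower T f U x \<mu>" if X: "X \<in> ?XS" for X
    proof -
      obtain ps h where ps: "ps \<noteq> []" "\<forall>p\<in>set ps. fst p = 1 \<or> fst p = - 1" and h: "h \<ge> 1"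
        and "realizes f C ps h X"
        using bracket_family_realizable[OF D(1) C(1) D(2) k X] by (elim exE conjE) (rule that)
      then obtain \<delta> where \<delta>: "\<delta> > 0" and exp: "\<forall>t x z. 0 \<le> t \<and> t < \<delta> \<and> x \<in> C \<and> steers f C t ps x z \<longrightarrow>
          norm (z - x - t ^ h *\<^sub>R X x) \<le> \<epsilon> * t ^ h"
        using \<epsilon>(1) unfolding realizes_def by blast
      have "bounded (X ` C)"
        by (intro compact_imp_bounded compact_continuous_image continuous_on_subset[OF XSc[OF X] C(2)] C(1))
      then obtain B where B: "B > 0" "\<And>x. x \<in> C \<Longrightarrow> norm (X x) \<le> B" by (auto simp: bounded_pos)
      define n where "n = real (length ps)"
      have n: "n > 0" using ps(1) by (simp add: n_def)
      \<comment> \<open>the bounds on \<open>t\<close> ensure, in this order: the expansion is valid, powers of \<open>t\<close> decrease,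
        the arc lasts at most 1, it stays in the small ball, and the quadratic term is dominated\<close>
      define t where "t = Min {\<delta> / 2, 1, 1 / n, r' / (M * n), c0 / (4 * ((\<rho> + 1) * (B + 1)\<^sup>2))}"
      have t0: "t > 0" using \<delta> n r'(1) M(1) r(1,3) B(1) by (auto simp: t_def)
      have t_le: "t \<le> \<delta> / 2" "t \<le> 1" "t \<le> 1 / n" "t \<le> r' / (M * n)" "t \<le> c0 / (4 * ((\<rho> + 1) * (B + 1)\<^sup>2))"
        unfolding t_def by (rule Min_le; simp)+
      have Q: "4 * ((\<rho> + 1) * (B + 1)\<^sup>2) > 0" using r(3) B(1) by simp
      have t: "t < \<delta>" "t \<le> 1" "n * t \<le> 1" "M * (n * t) \<le> r'"
        using t_le(1-4) \<delta> n M(1) by (auto simp: field_simps)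
      have t5: "(\<rho> + 1) * (B + 1)\<^sup>2 * t \<le> c0 / 4"
        using t_le(5)[unfolded pos_le_divide_eq[OF Q]] by (simp add: mult_ac)
      define \<mu> where "\<mu> = c0 / 2 * t ^ h"
      have \<mu>: "\<mu> > 0" using r(1) t0 by (simp add: \<mu>_def)
      show ?thesis
      proof (rule exI[of _ \<mu>], rule conjI[OF \<mu>], intro ballI allI impI, elim conjE)
        fix x p assume x: "x \<in> K" and p: "norm p \<le> L" "p \<bullet> X x \<le> - c0"
          "\<forall>z\<in>cball x r. U z \<le> U x + p \<bullet> (z - x) + \<rho> * (norm (z - x))\<^sup>2"
        let ?S = "cball x (M * (n * t))"
        have SC: "?S \<subseteq> C" using ballC[OF x] t(4) r'(2) by simp
        have xC: "x \<in> C" using ballC[OF x order_refl] r(4) by auto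
        have Scont: "continuous_on ?S (f i)" for i
          by (rule continuous_on_subset[OF Cb_continuous[OF fields_Cb]]) (use SC D(2) in blast)
        have SM: "norm (f i u) \<le> M" if "u \<in> ?S" for i u using M(2) that SC D(2) by blast
        have ST: "?S \<inter> T = {}" using SC C(2) by blast
        have "\<exists>z. steers f ?S t ps x z" unfolding n_def
          by (rule steers_exists[OF t0 _ Scont[unfolded n_def] SM[unfolded n_def] ps(2)]) (use M(1) in simp_all)
        then obtain z where z: "steers f ?S t ps x z" by blast
        obtain y \<alpha> where y: "admissible_arc T f (n * t) y \<alpha>" "y 0 = x" "y (n * t) = z" "\<forall>\<tau>\<in>{0..n * t}. y \<tau> \<in> ?S"
          using steers_admissible_arc[OF t0 ST SM z ps] unfolding n_def[symmetric] by blast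
        have nt: "n * t > 0" using n t0 by simp
        have Uy: "U (y \<tau>) \<le> 2 * U x" if "\<tau> \<in> {0..n * t}" for \<tau>
        proof -
          have yS: "y \<tau> \<in> ?S" using y(4) that by blast
          then have "dist (U (y \<tau>)) (U x) < a"
            using r0(2)[OF xC, of "y \<tau>"] SC t(4) r'(3) by (auto simp: dist_commute)
          moreover have "a \<le> U x" using x K_iff by blast
          ultimately show ?thesis by (simp add: dist_real_def)
        qed
        define w where "w = z - x"
        have th: "t ^ h > 0" "t ^ h \<le> t"
          using t0 t(2) h power_decreasing[of 1 h t] by auto
        have w1: "norm (w - t ^ h *\<^sub>R X x) \<le> \<epsilon> * t ^ h"
          using exp t0 t(1) xC steers_mono[OF z SC] unfolding w_def by (meson less_imp_le)
        have w2: "norm w \<le> (B + 1) * t ^ h"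
        proof -
          have "norm w \<le> norm (w - t ^ h *\<^sub>R X x) + norm (t ^ h *\<^sub>R X x)"
            by (metis diff_add_cancel norm_triangle_ineq)
          also have "\<dots> \<le> \<epsilon> * t ^ h + t ^ h * B"
            using w1 B(2)[OF xC] th by (intro add_mono) (auto intro: mult_left_mono)
          also have "\<dots> \<le> 1 * t ^ h + t ^ h * B" using mult_right_mono[OF \<epsilon>(2), of "t ^ h"] th by simp
          finally show ?thesis by (simp add: algebra_simps)
        qed
        have "p \<bullet> w = t ^ h * (p \<bullet> X x) + p \<bullet> (w - t ^ h *\<^sub>R X x)" by (simp add: inner_diff_right)
        also have "\<dots> \<le> t ^ h * (- c0) + L * (\<epsilon> * t ^ h)"
        proof (rule add_mono)
          show "t ^ h * (p \<bullet> X x) \<le> t ^ h * (- c0)" using p(2) th by (intro mult_left_mono) auto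
          have "p \<bullet> (w - t ^ h *\<^sub>R X x) \<le> norm p * norm (w - t ^ h *\<^sub>R X x)" by (rule norm_cauchy_schwarz)
          also have "\<dots> \<le> L * (\<epsilon> * t ^ h)" using p(1) w1 r(2) by (intro mult_mono) auto
          finally show "p \<bullet> (w - t ^ h *\<^sub>R X x) \<le> L * (\<epsilon> * t ^ h)" .
        qed
        also have "\<dots> \<le> t ^ h * (- c0) + c0 / 4 * t ^ h"
          unfolding mult.assoc[symmetric] by (rule add_left_mono[OF mult_right_mono[OF L\<epsilon> less_imp_le[OF th(1)]]])
        finally have pw: "p \<bullet> w \<le> - (3 / 4) * c0 * t ^ h" by (simp add: algebra_simps)
        have "\<rho> * (norm w)\<^sup>2 \<le> (\<rho> + 1) * ((B + 1) * t ^ h)\<^sup>2"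
          using w2 r(3) by (intro mult_mono power_mono) auto
        also have "\<dots> = ((\<rho> + 1) * (B + 1)\<^sup>2 * t ^ h) * t ^ h" by (simp add: power2_eq_square mult_ac)
        also have "\<dots> \<le> ((\<rho> + 1) * (B + 1)\<^sup>2 * t) * t ^ h"
          using th r(3) by (intro mult_right_mono mult_left_mono) auto
        also have "\<dots> \<le> c0 / 4 * t ^ h" using t5 th by (intro mult_right_mono) auto
        finally have qw: "\<rho> * (norm w)\<^sup>2 \<le> c0 / 4 * t ^ h" .
        have "z \<in> ?S" using y(3,4) nt by auto
        then have "z \<in> cball x r" using t(4) r'(2) by simp
        then have "U z \<le> U x + p \<bullet> w + \<rho> * (norm w)\<^sup>2" using p(3) by (simp add: w_def)
        then have "U z \<le> U x - \<mu>" using pw qw by (simp add: \<mu>_def algebra_simps)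
        then show "can_lower T f U x \<mu>" unfolding can_lower_def
          using y Uy t(3) by (intro exI[of _ "n * t"] exI[of _ y] exI[of _ \<alpha>]) auto
      qed
    qed
    then obtain \<mu> where \<mu>: "\<And>X. X \<in> ?XS \<Longrightarrow> \<mu> X > 0" and step:
      "\<And>X x p. X \<in> ?XS \<Longrightarrow> x \<in> K \<Longrightarrow> norm p \<le> L \<Longrightarrow> p \<bullet> X x \<le> - c0 \<Longrightarrow>
       \<forall>z\<in>cball x r. U z \<le> U x + p \<bullet> (z - x) + \<rho> * (norm (z - x))\<^sup>2 \<Longrightarrow>
       can_lower T f U x (\<mu> X)"
      by metis
    define \<mu>0 where "\<mu>0 = Min (\<mu> ` ?XS)"
    have ne: "?XS \<noteq> {}" by (auto simp: bracket_family_def)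
    have "\<mu>0 > 0" unfolding \<mu>0_def
      by (subst Min_gr_iff) (use \<mu> ne in \<open>auto simp: finite_bracket_family\<close>)
    moreover have \<mu>0_le: "\<mu>0 \<le> \<mu> X" if "X \<in> ?XS" for X
      unfolding \<mu>0_def using that by (intro Min_le) (auto simp: finite_bracket_family)
    moreover have "can_lower T f U x \<mu>0" if x: "x \<in> K" for x
    proof -
      obtain p X where X: "X \<in> ?XS" and "norm p \<le> L" "p \<bullet> X x \<le> - c0"
       "\<forall>z\<in>cball x r. U z \<le> U x + p \<bullet> (z - x) + \<rho> * (norm (z - x))\<^sup>2"
        using descent x by blast
      from step[OF X x this(2-4)] show ?thesis using \<mu>0_le[OF X] by (rule can_lower_mono)
    qed
    ultimately show ?thesis using K_iff by blast
  qed
qed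

section \<open>A clock for the decrease\<close>

text \<open>
  The infimal convolution of \<open>\<mu>\<close> with the absolute value is Lipschitz; it is positive because
  a nearby \<open>u\<close> contributes a positive lower bound of \<open>\<mu>\<close> and a distant one its distance.
\<close>

lemma lipschitz_positive_minorant:
  fixes \<mu> :: "real \<Rightarrow> real"
  assumes pos: "\<And>a b. 0 < a \<Longrightarrow> \<exists>c>0. \<forall>u\<in>{a..b}. c \<le> \<mu> u"
  shows "\<exists>m. continuous_on {0<..} m \<and> (\<forall>v>0. 0 < m v) \<and> (\<forall>u>0. \<forall>v>0. 2 * m v \<le> \<mu> u + \<bar>u - v\<bar>)"
proof -
  have \<mu>0: "\<mu> u > 0" if "u > 0" for u using pos[OF that, of u] by auto
  define I where "I v = (INF u\<in>{0<..}. \<mu> u + \<bar>u - v\<bar>)" for v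
  have bdd: "bdd_below ((\<lambda>u. \<mu> u + \<bar>u - v\<bar>) ` {0<..})" for v
  proof (rule bdd_belowI[of _ 0])
    fix y assume "y \<in> (\<lambda>u. \<mu> u + \<bar>u - v\<bar>) ` {0<..}"
    then obtain u where "u > 0" "y = \<mu> u + \<bar>u - v\<bar>" by auto
    then show "0 \<le> y" using \<mu>0[of u] by simp
  qed
  have I_le: "I v \<le> \<mu> u + \<bar>u - v\<bar>" if "u > 0" for u v
    unfolding I_def by (rule cINF_lower[OF bdd]) (use that in simp)
  have I_pos: "I v > 0" if v: "v > 0" for v
  proof -
    obtain c where c: "c > 0" "\<And>u. u \<in> {v / 2..3 * v / 2} \<Longrightarrow> c \<le> \<mu> u" using pos[of "v / 2"] v by fastforce
    have "min c (v / 2) \<le> I v" unfolding I_def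
    proof (rule cINF_greatest)
      fix u :: real assume u: "u \<in> {0<..}"
      show "min c (v / 2) \<le> \<mu> u + \<bar>u - v\<bar>"
      proof (cases "\<bar>u - v\<bar> \<le> v / 2")
        case True
        then have "u \<in> {v / 2..3 * v / 2}" unfolding atLeastAtMost_iff by linarith
        then have "c \<le> \<mu> u" by (rule c(2))
        then show ?thesis by simp
      next
        case False
        then have "v / 2 \<le> \<mu> u + \<bar>u - v\<bar>" using \<mu>0[of u] u by simp
        then show ?thesis by (rule min.coboundedI2)
      qed
    qed auto
    then show ?thesis using c v by (auto simp: min_def split: if_splits)
  qed
  have I_lip: "I v \<le> I w + \<bar>v - w\<bar>" for v w
  proof -
    have "I v - \<bar>v - w\<bar> \<le> I w" unfolding I_def[of w]
    proof (rule cINF_greatest)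
      fix u :: real assume "u \<in> {0<..}"
      then show "I v - \<bar>v - w\<bar> \<le> \<mu> u + \<bar>u - w\<bar>" using I_le[of u v] by simp
    qed auto
    then show ?thesis by simp
  qed
  have "continuous_on {0<..} I"
    by (rule lipschitz_on_continuous_on[of 1])
       (use I_lip in \<open>auto intro!: lipschitz_onI simp: dist_real_def abs_le_iff algebra_simps\<close>,
        (smt (verit) I_lip)+)
  then show ?thesis using I_pos I_le
    by (intro exI[of _ "\<lambda>v. I v / 2"]) (auto intro!: continuous_intros)
qed

text \<open>
  Carries levels of \<open>U\<close> to clock readings.  The level 0 corresponds to the reading minus infinity, so
  that a reading which decreases without bound forces \<open>U\<close> to 0.
\<close>

locale clock =
  fixes \<tau> \<theta> :: "real \<Rightarrow> real"
  assumes \<tau>_less: "0 < u \<Longrightarrow> u < v \<Longrightarrow> \<tau> u < \<tau> v"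
    and \<tau>_cont: "continuous_on {0<..} \<tau>"
    and \<theta>_pos: "\<theta> s > 0"
    and \<tau>_\<theta>: "\<tau> (\<theta> s) = s"
    and \<theta>_\<tau>: "u > 0 \<Longrightarrow> \<theta> (\<tau> u) = u"
    and \<theta>_strict_mono: "strict_mono \<theta>"
    and \<theta>_cont: "continuous_on UNIV \<theta>"
begin

lemma \<tau>_mono: "0 < u \<Longrightarrow> u \<le> v \<Longrightarrow> \<tau> u \<le> \<tau> v"
  using \<tau>_less[of u v] by (cases "u = v") auto

lemma \<theta>_mono: "s \<le> t \<Longrightarrow> \<theta> s \<le> \<theta> t"
  using strict_mono_mono[OF \<theta>_strict_mono] by (rule monoD)

lemma \<theta>_less: "s < t \<Longrightarrow> \<theta> s < \<theta> t"
  using \<theta>_strict_mono by (rule strict_monoD)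

end

text \<open>
  Take \<open>\<tau>' = 1 / m\<close> with the minorant \<open>m\<close>.  On \<open>[u - \<mu> u, u]\<close> the bound
  \<open>2 m v \<le> \<mu> u + |u - v| \<le> 2 \<mu> u\<close> gives \<open>\<tau>' \<ge> 1 / \<mu> u\<close>, so \<open>\<tau>\<close> grows by at least 1 there.
  It is onto because \<open>m v \<le> v\<close> makes \<open>\<tau> - ln\<close> nondecreasing.
\<close>

theorem decrease_clock:
  fixes \<mu> :: "real \<Rightarrow> real"
  assumes pos: "\<And>a b. 0 < a \<Longrightarrow> \<exists>c>0. \<forall>u\<in>{a..b}. c \<le> \<mu> u" and half: "\<And>u. u > 0 \<Longrightarrow> \<mu> u \<le> u / 2"
  shows "\<exists>\<tau> \<theta>. clock \<tau> \<theta> \<and> (\<forall>u>0. \<tau> (u - \<mu> u) \<le> \<tau> u - 1)"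
proof -
  obtain m where m: "continuous_on {0<..} m" "\<And>v. v > 0 \<Longrightarrow> 0 < m v"
    "\<And>u v. u > 0 \<Longrightarrow> v > 0 \<Longrightarrow> 2 * m v \<le> \<mu> u + \<bar>u - v\<bar>"
    using lipschitz_positive_minorant[of \<mu>] pos by metis
  have \<mu>0: "\<mu> u > 0" if "u > 0" for u using pos[OF that, of u] by auto
  have "isCont (\<lambda>v. 1 / m v) v" if "v > 0" for v
  proof -
    have "isCont m v" using m(1) that by (simp add: continuous_on_eq_continuous_at)
    then show ?thesis using m(2)[OF that] by (intro continuous_intros) auto
  qed
  then obtain \<tau> where "\<forall>u::real. (0::ereal) < u \<longrightarrow> u < \<infinity> \<longrightarrow> (\<tau> has_vector_derivative (1 / m u)) (at u)"
    using einterval_antiderivative[of 0 "\<infinity>" "\<lambda>v. 1 / m v"] by auto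
  then have d\<tau>: "(\<tau> has_real_derivative (1 / m u)) (at u)" if "u > 0" for u
    using that by (simp add: has_real_derivative_iff_has_vector_derivative)
  have \<tau>_less: "\<tau> u < \<tau> v" if "0 < u" "u < v" for u v
    by (rule DERIV_pos_imp_increasing[OF that(2)])
       (use d\<tau> m(2) that in \<open>meson divide_pos_pos less_le_trans zero_less_one\<close>)
  have \<tau>_cont: "continuous_on {0<..} \<tau>"
    using d\<tau> by (intro continuous_at_imp_continuous_on) (auto intro: DERIV_isCont)
  have step: "\<tau> (u - \<mu> u) \<le> \<tau> u - 1" if u: "u > 0" for u
  proof -
    have lt: "u - \<mu> u < u" and gt: "0 < u - \<mu> u" using \<mu>0[OF u] half[OF u] u by auto
    obtain v where v: "u - \<mu> u < v" "v < u" "\<tau> u - \<tau> (u - \<mu> u) = (u - (u - \<mu> u)) * (1 / m v)"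
      using MVT2[OF lt, of \<tau> "\<lambda>v. 1 / m v"] d\<tau> gt by force
    have "2 * m v \<le> \<mu> u + \<bar>u - v\<bar>" using m(3)[OF u, of v] v gt by simp
    then have "m v \<le> \<mu> u" using v by simp
    then have "1 \<le> \<mu> u * (1 / m v)" using m(2)[of v] v gt by (simp add: field_simps)
    then show ?thesis using v(3) by simp
  qed
  have mle: "m v \<le> v" if "v > 0" for v using m(3)[OF that that] half[OF that] that by simp
  have ln_mono: "\<tau> u - ln u \<le> \<tau> v - ln v" if "0 < u" "u \<le> v" for u v
  proof (rule DERIV_nonneg_imp_nondecreasing[OF that(2)])
    fix x assume "u \<le> x" "x \<le> v"
    then have x: "x > 0" using that by simp
    show "\<exists>y. ((\<lambda>x. \<tau> x - ln x) has_real_derivative y) (at x) \<and> 0 \<le> y"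
    proof (intro exI conjI)
      show "((\<lambda>x. \<tau> x - ln x) has_real_derivative 1 / m x - 1 / x) (at x)"
        using d\<tau>[OF x] x by (auto intro!: derivative_eq_intros simp: divide_inverse)
      show "0 \<le> 1 / m x - 1 / x" using mle[OF x] m(2)[OF x] x by (simp add: frac_le)
    qed
  qed
  have onto: "\<exists>u>0. \<tau> u = s" for s
  proof -
    define r where "r = \<bar>s - \<tau> 1\<bar>"
    have r: "0 \<le> r" "\<tau> 1 - s \<le> r" "s - \<tau> 1 \<le> r" by (auto simp: r_def)
    have "\<tau> (exp (- r)) \<le> s" using ln_mono[of "exp (- r)" 1] r by simp
    moreover have "s \<le> \<tau> (exp r)" using ln_mono[of 1 "exp r"] r by simp
    moreover have "exp (- r) \<le> exp r" using r by simp
    moreover have "continuous_on {exp (- r)..exp r} \<tau>"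
      by (rule continuous_on_subset[OF \<tau>_cont]) (auto intro: less_le_trans[OF exp_gt_zero])
    ultimately obtain u where "exp (- r) \<le> u" "\<tau> u = s" using IVT'[of \<tau> "exp (- r)" s "exp r"] by blast
    then show ?thesis using less_le_trans[OF exp_gt_zero] by blast
  qed
  define \<theta> where "\<theta> s = (SOME u. u > 0 \<and> \<tau> u = s)" for s
  have \<theta>: "\<theta> s > 0" "\<tau> (\<theta> s) = s" for s
    using someI_ex[of "\<lambda>u. u > 0 \<and> \<tau> u = s"] onto[of s] by (auto simp: \<theta>_def)
  have \<theta>\<tau>: "\<theta> (\<tau> u) = u" if "u > 0" for u
    using \<tau>_less[of u "\<theta> (\<tau> u)"] \<tau>_less[of "\<theta> (\<tau> u)" u] \<theta>[of "\<tau> u"] that by (metis less_irrefl linorder_neqE)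
  have sm: "strict_mono \<theta>"
  proof (rule strict_monoI)
    fix s t :: real assume st: "s < t"
    show "\<theta> s < \<theta> t"
    proof (rule ccontr)
      assume "\<not> \<theta> s < \<theta> t"
      then have "\<tau> (\<theta> t) \<le> \<tau> (\<theta> s)" using \<tau>_less[of "\<theta> t" "\<theta> s"] \<theta>(1)[of t] by (cases "\<theta> t = \<theta> s") auto
      then show False using st \<theta>(2) by simp
    qed
  qed
  have "range \<theta> = {0<..}"
  proof
    show "{0<..} \<subseteq> range \<theta>" using rangeI[of \<theta> "\<tau> u" for u] \<theta>\<tau> by (metis greaterThan_iff subsetI)
  qed (use \<theta>(1) in auto)
  then have "continuous_on UNIV \<theta>"
    by (intro continuous_onI_mono) (auto intro: strict_mono_mono[OF sm, THEN monoD])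
  then have "clock \<tau> \<theta>" using \<tau>_less \<tau>_cont \<theta> \<theta>\<tau> sm by unfold_locales
  then show ?thesis using step by blast
qed

section \<open>Comparison functions\<close>

text \<open>
  The last clause is a normalization that makes the function unbounded.
\<close>

definition K_infinity :: "(real \<Rightarrow> real) \<Rightarrow> bool" where
  "K_infinity \<gamma> \<longleftrightarrow> continuous_on {0..} \<gamma> \<and> \<gamma> 0 = 0 \<and> strict_mono_on {0..} \<gamma> \<and> (\<forall>u\<ge>0. u \<le> \<gamma> u)"

text \<open>
  The supremum \<open>g u\<close> of \<open>Q\<close> over the sublevel set \<open>{P \<le> u}\<close> is finite, nondecreasing and tends to 0
  with \<open>u\<close> by compactness.  The mean \<open>\<integral>\<^sub>1\<^sup>2 g (u s) ds\<close> lies between \<open>g u\<close> and \<open>g (2 u)\<close> and is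
  continuous in \<open>u\<close>; adding \<open>u\<close> makes it strictly increasing.
\<close>

theorem K_infinity_majorant:
  fixes P Q :: "'a::heine_borel \<Rightarrow> real" and S :: "'a set"
  assumes cont: "continuous_on S P" "continuous_on S Q"
    and nonneg: "\<And>x. x \<in> S \<Longrightarrow> P x \<ge> 0" "\<And>x. x \<in> S \<Longrightarrow> Q x \<ge> 0"
    and zero: "\<And>x. x \<in> S \<Longrightarrow> P x = 0 \<Longrightarrow> Q x = 0"
    and sublevel: "\<And>c. compact {x \<in> S. P x \<le> c}"
  shows "\<exists>\<gamma>. K_infinity \<gamma> \<and> (\<forall>x\<in>S. Q x \<le> \<gamma> (P x))"
proof -
  define g where "g u = Sup (insert 0 (Q ` {x \<in> S. P x \<le> u}))" for u
  have bdd: "bdd_above (insert 0 (Q ` {x \<in> S. P x \<le> u}))" for u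
  proof -
    have "compact (Q ` {x \<in> S. P x \<le> u})"
      by (rule compact_continuous_image[OF continuous_on_subset[OF cont(2)] sublevel]) auto
    then show ?thesis using bounded_imp_bdd_above[OF compact_imp_bounded] by auto
  qed
  have g_ge: "Q x \<le> g u" if "x \<in> S" "P x \<le> u" for x u
    unfolding g_def using that by (intro cSup_upper[OF _ bdd]) auto
  have g0: "0 \<le> g u" for u unfolding g_def by (intro cSup_upper[OF _ bdd]) auto
  have g_mono: "g u \<le> g v" if "u \<le> v" for u v
    unfolding g_def by (rule cSup_subset_mono[OF _ bdd]) (use that in auto)
  have g_small: "\<exists>\<delta>>0. g \<delta> \<le> \<epsilon>" if "\<epsilon> > 0" for \<epsilon>
  proof (rule ccontr)
    assume neg: "\<not> ?thesis"
    let ?K = "\<lambda>n::nat. {x \<in> S. P x \<le> inverse (real (Suc n))} \<inter> {x \<in> S. \<epsilon> \<le> Q x}"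
    have ne: "?K n \<noteq> {}" for n
    proof
      assume e: "?K n = {}"
      have "g (inverse (real (Suc n))) \<le> \<epsilon>" unfolding g_def
      proof (rule cSup_least)
        fix q assume "q \<in> insert 0 (Q ` {x \<in> S. P x \<le> inverse (real (Suc n))})"
        then show "q \<le> \<epsilon>" using e \<open>\<epsilon> > 0\<close> by (force simp: not_le)
      qed simp
      then show False using neg by (metis inverse_positive_iff_positive of_nat_0_less_iff zero_less_Suc)
    qed
    have "compact (?K n)" for n
    proof -
      have "?K n = {x \<in> S. P x \<le> inverse (real (Suc n))} \<inter> Q -` {\<epsilon>..}" by auto
      moreover have "closedin (top_of_set {x \<in> S. P x \<le> inverse (real (Suc n))})
         ({x \<in> S. P x \<le> inverse (real (Suc n))} \<inter> Q -` {\<epsilon>..})"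
        by (rule continuous_closedin_preimage[OF continuous_on_subset[OF cont(2)]]) auto
      ultimately show ?thesis using closedin_compact[OF sublevel] by simp
    qed
    moreover have "?K n \<subseteq> ?K m" if "m \<le> n" for m n
    proof -
      have "inverse (real (Suc n)) \<le> inverse (real (Suc m))" using that by (intro le_imp_inverse_le) auto
      then have "P x \<le> inverse (real (Suc m))" if "P x \<le> inverse (real (Suc n))" for x
        using that by (rule order.trans[rotated])
      then show ?thesis by blast
    qed
    ultimately have "\<Inter> (range ?K) \<noteq> {}"
      using compact_nest[of ?K] ne by blast
    then obtain x where x: "\<And>n. x \<in> ?K n" by blast
    have "P x \<le> 0"
      by (rule LIMSEQ_le_const[OF LIMSEQ_inverse_real_of_nat]) (use x in blast)
    then have "Q x = 0" using x[of 0] nonneg(1)[of x] zero[of x] by auto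
    then show False using x[of 0] \<open>\<epsilon> > 0\<close> by auto
  qed
  have int: "(\<lambda>s. g (u * s)) integrable_on {a..b}" if "u \<ge> 0" for u a b
    by (intro integrable_on_mono_on mono_onI g_mono mult_left_mono) (use that in auto)
  define \<gamma> where "\<gamma> u = u + (if u = 0 then 0 else integral {1..2} (\<lambda>s. g (u * s)))" for u
  have lower: "u + g u \<le> \<gamma> u" if "u > 0" for u
  proof -
    have "integral {1..2} (\<lambda>s::real. g u) \<le> integral {1..2} (\<lambda>s. g (u * s))"
      by (intro integral_le int integrable_const_ivl g_mono) (use that in auto)
    then show ?thesis using that by (simp add: \<gamma>_def)
  qed
  have upper: "\<gamma> u \<le> u + g (2 * u)" if "u > 0" for u
  proof -
    have "integral {1..2} (\<lambda>s. g (u * s)) \<le> integral {1..2} (\<lambda>s::real. g (2 * u))"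
      by (intro integral_le int integrable_const_ivl g_mono) (use that in auto)
    then show ?thesis using that by (simp add: \<gamma>_def)
  qed
  have ge: "u \<le> \<gamma> u" if "u \<ge> 0" for u
    using lower[of u] g0[of u] that by (cases "u = 0") (auto simp: \<gamma>_def)
  have sm: "strict_mono_on {0..} \<gamma>"
  proof (rule strict_mono_onI)
    fix u v :: real assume uv: "u \<in> {0..}" "v \<in> {0..}" "u < v"
    show "\<gamma> u < \<gamma> v"
    proof (cases "u = 0")
      case True then show ?thesis using ge[of v] uv by (simp add: \<gamma>_def)
    next
      case False
      have "integral {1..2} (\<lambda>s. g (u * s)) \<le> integral {1..2} (\<lambda>s. g (v * s))"
        by (intro integral_le int g_mono mult_right_mono) (use uv in auto)
      then show ?thesis using False uv by (simp add: \<gamma>_def)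
    qed
  qed
  have "isCont \<gamma> u" if u: "u > 0" for u
  proof -
    let ?J = "\<lambda>v. integral {0..v} g"
    have gint: "g integrable_on {a..b}" for a b using int[of 1 a b] by simp
    have Jc: "continuous_on {0..4 * u} ?J" by (rule indefinite_integral_continuous_1[OF gint])
    \<comment> \<open>after a change of variables the mean is a difference of indefinite integrals\<close>
    have eq: "v + (?J (2 * v) - ?J v) / v = \<gamma> v" if v: "v \<in> {u / 2<..<2 * u}" for v
    proof -
      have v0: "v > 0" using v u by auto
      have img: "(\<lambda>x. x / v) ` {v..2 * v} = {1..2}"
        using image_divide_atLeastAtMost[OF v0, of v "2 * v"] v0 by (simp add: image_def)
      have "integral {1..2} (\<lambda>s. g (v * s)) = (1 / \<bar>v\<bar>) *\<^sub>R integral {v..2 * v} g"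
        using integral_stretch_real[of v v "2 * v" g] v0 unfolding img by simp
      moreover have "?J v + integral {v..2 * v} g = ?J (2 * v)"
        by (rule Henstock_Kurzweil_Integration.integral_combine) (use v0 gint in auto)
      ultimately show ?thesis using v0 by (simp add: \<gamma>_def field_simps)
    qed
    have "continuous_on {u / 2<..<2 * u} (\<lambda>v. v + (?J (2 * v) - ?J v) / v)"
      by (intro continuous_intros continuous_on_compose2[OF Jc]) (use u in auto)
    then have "continuous_on {u / 2<..<2 * u} \<gamma>" using eq by (subst continuous_on_cong[OF refl, symmetric]) auto
    then show ?thesis using u by (simp add: continuous_on_eq_continuous_at)
  qed
  moreover have "(\<gamma> \<longlongrightarrow> \<gamma> 0) (at 0 within {0..})"
    unfolding tendsto_iff
  proof (intro allI impI)
    fix e :: real assume e: "e > 0"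
    obtain \<delta> where \<delta>: "\<delta> > 0" "g \<delta> \<le> e / 2" using g_small[of "e / 2"] e by auto
    have "dist (\<gamma> u) (\<gamma> 0) < e" if "u \<in> {0..}" "u \<noteq> 0" "dist u 0 < min (\<delta> / 2) (e / 2)" for u
    proof -
      have u: "u > 0" "2 * u \<le> \<delta>" "u < e / 2" using that by auto
      have "\<gamma> u < e" using upper[OF u(1)] g_mono[OF u(2)] \<delta>(2) u(3) by linarith
      then show ?thesis using ge[of u] u by (simp add: dist_real_def \<gamma>_def)
    qed
    then show "\<forall>\<^sub>F u in at 0 within {0..}. dist (\<gamma> u) (\<gamma> 0) < e"
      unfolding eventually_at using \<delta> e by (intro exI[of _ "min (\<delta> / 2) (e / 2)"]) auto
  qed
  ultimately have "continuous_on {0..} \<gamma>"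
    unfolding continuous_on_def
    by (metis atLeast_iff continuous_at order_le_imp_less_or_eq tendsto_within_subset top_greatest)
  moreover have "Q x \<le> \<gamma> (P x)" if x: "x \<in> S" for x
  proof (cases "P x = 0")
    case True then show ?thesis using zero[OF x] by (simp add: \<gamma>_def)
  next
    case False
    then have "P x > 0" using nonneg(1)[OF x] by simp
    then show ?thesis using lower[of "P x"] g_ge[OF x order_refl] by simp
  qed
  ultimately show ?thesis using sm ge by (intro exI[of _ \<gamma>]) (auto simp: \<gamma>_def K_infinity_def)
qed

lemma K_infinity_small:
  assumes "K_infinity \<gamma>" "e > 0"
  shows "\<exists>d>0. \<forall>u. 0 \<le> u \<and> u < d \<longrightarrow> \<gamma> u < e"
proof -
  have "\<exists>d>0. \<forall>u\<in>{0..}. dist u 0 < d \<longrightarrow> dist (\<gamma> u) (\<gamma> 0) < e"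
    using assms unfolding K_infinity_def continuous_on_iff by (metis atLeast_iff order_refl)
  then obtain d where d: "d > 0" "\<And>u. u \<ge> 0 \<Longrightarrow> dist u 0 < d \<Longrightarrow> dist (\<gamma> u) (\<gamma> 0) < e" by auto
  have "\<gamma> u < e" if "0 \<le> u" "u < d" for u
    using d(2)[of u] that assms(1) by (auto simp: K_infinity_def dist_real_def)
  then show ?thesis using d(1) by blast
qed

lemma K_infinity_less: "K_infinity \<gamma> \<Longrightarrow> 0 \<le> u \<Longrightarrow> u < v \<Longrightarrow> \<gamma> u < \<gamma> v"
  by (auto simp: K_infinity_def intro: strict_mono_onD)

lemma K_infinity_mono: "K_infinity \<gamma> \<Longrightarrow> 0 \<le> u \<Longrightarrow> u \<le> v \<Longrightarrow> \<gamma> u \<le> \<gamma> v"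
  using K_infinity_less[of \<gamma> u v] by (cases "u = v") auto

lemma K_infinity_nonneg: "K_infinity \<gamma> \<Longrightarrow> 0 \<le> u \<Longrightarrow> 0 \<le> \<gamma> u"
  unfolding K_infinity_def by force

text \<open>
  Strict monotonicity, decay and unboundedness come from \<open>\<tau>\<close> being an increasing bijection with
  inverse \<open>\<theta>\<close>.  Continuity at \<open>\<delta> = 0\<close> holds since \<open>\<tau>\<close> tends to minus infinity at 0, uniformly
  in \<open>s \<ge> 0\<close> because the function decreases in \<open>s\<close>.
\<close>

theorem (in clock) class_KL_of_clock:
  assumes \<gamma>: "K_infinity \<gamma>1" "K_infinity \<gamma>2"
  shows "(\<lambda>\<delta> s. \<gamma>1 (if \<delta> \<le> 0 then 0 else 2 * \<theta> (\<tau> (\<gamma>2 \<delta>) + 1 - s))) \<in> class_KL"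
proof -
  define \<zeta> where "\<zeta> \<delta> s = (if \<delta> \<le> 0 then 0 else 2 * \<theta> (\<tau> (\<gamma>2 \<delta>) + 1 - s))" for \<delta> s
  have \<gamma>2_pos: "\<gamma>2 \<delta> > 0" if "\<delta> > 0" for \<delta> using K_infinity_less[OF \<gamma>(2), of 0 \<delta>] \<gamma>(2) that by (simp add: K_infinity_def)
  have \<zeta>0: "\<zeta> \<delta> s \<ge> 0" for \<delta> s using \<theta>_pos by (simp add: \<zeta>_def less_imp_le)
  have \<zeta>_less: "\<zeta> \<delta> s < \<zeta> \<delta>' s" if "0 \<le> \<delta>" "\<delta> < \<delta>'" for \<delta> \<delta>' s
  proof (cases "\<delta> = 0")
    case True then show ?thesis using that \<theta>_pos by (simp add: \<zeta>_def)
  next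
    case False
    then have "\<tau> (\<gamma>2 \<delta>) < \<tau> (\<gamma>2 \<delta>')"
      using that by (intro \<tau>_less \<gamma>2_pos K_infinity_less[OF \<gamma>(2)]) auto
    then show ?thesis using False that \<theta>_less by (simp add: \<zeta>_def)
  qed
  have \<zeta>_anti: "\<zeta> \<delta> t \<le> \<zeta> \<delta> s" if "s \<le> t" for \<delta> s t
    using \<theta>_mono that by (simp add: \<zeta>_def)
  have \<zeta>_small: "\<exists>d>0. \<forall>\<delta> s. 0 \<le> \<delta> \<and> \<delta> < d \<and> 0 \<le> s \<longrightarrow> \<zeta> \<delta> s < e" if e: "e > 0" for e
  proof -
    obtain d where d: "d > 0" "\<And>u. 0 \<le> u \<Longrightarrow> u < d \<Longrightarrow> \<gamma>2 u < \<theta> (\<tau> (e / 2) - 1)"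
      using K_infinity_small[OF \<gamma>(2) \<theta>_pos] by blast
    have "\<zeta> \<delta> s < e" if \<delta>: "0 \<le> \<delta>" "\<delta> < d" "0 \<le> s" for \<delta> s
    proof (cases "\<delta> = 0")
      case True then show ?thesis using e by (simp add: \<zeta>_def)
    next
      case False
      have "\<tau> (\<gamma>2 \<delta>) < \<tau> (\<theta> (\<tau> (e / 2) - 1))" using d(2)[of \<delta>] \<delta> False by (intro \<tau>_less \<gamma>2_pos) auto
      then have "\<tau> (\<gamma>2 \<delta>) + 1 - s < \<tau> (e / 2)" using \<tau>_\<theta> \<delta>(3) by simp
      from \<theta>_less[OF this] show ?thesis using \<theta>_\<tau>[of "e / 2"] e False \<delta>(1) by (simp add: \<zeta>_def)
    qed
    then show ?thesis using d(1) by blast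
  qed
  have "continuous (at z within {0..} \<times> {0..}) (\<lambda>(\<delta>, s). \<zeta> \<delta> s)" if z: "z \<in> {0..} \<times> {0..}" for z
  proof (cases "fst z = 0")
    case False
    let ?A = "{0::real<..} \<times> (UNIV :: real set)"
    have "continuous_on {0..} \<gamma>2" using \<gamma>(2) by (simp add: K_infinity_def)
    then have c1: "continuous_on ?A (\<lambda>z. \<gamma>2 (fst z))"
      by (rule continuous_on_compose2[OF _ continuous_on_fst[OF continuous_on_id]]) auto
    have c2: "continuous_on ?A (\<lambda>z. \<tau> (\<gamma>2 (fst z)))"
    proof (rule continuous_on_compose2[OF \<tau>_cont c1], rule image_subsetI)
      fix z assume "z \<in> ?A"
      then have "fst z > 0" by auto
      from \<gamma>2_pos[OF this] show "\<gamma>2 (fst z) \<in> {0<..}" by simp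
    qed
    have c3: "continuous_on ?A (\<lambda>z. \<tau> (\<gamma>2 (fst z)) + 1 - snd z)"
      by (intro continuous_intros c2)
    have c4: "continuous_on ?A (\<lambda>z. \<theta> (\<tau> (\<gamma>2 (fst z)) + 1 - snd z))"
      by (rule continuous_on_compose2[OF \<theta>_cont c3]) simp
    have "continuous_on ?A (\<lambda>z. 2 * \<theta> (\<tau> (\<gamma>2 (fst z)) + 1 - snd z))"
      by (intro continuous_intros c4)
    then have "continuous_on ({0<..} \<times> UNIV) (\<lambda>(\<delta>, s). \<zeta> \<delta> s)"
      by (rule continuous_on_eq) (auto simp: \<zeta>_def)
    moreover have "open ({0<..} \<times> (UNIV :: real set) :: (real \<times> real) set)" by (intro open_Times) auto
    moreover have "z \<in> {0<..} \<times> UNIV" using z False by (cases z) auto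
    ultimately have "isCont (\<lambda>(\<delta>, s). \<zeta> \<delta> s) z" using continuous_on_eq_continuous_at by blast
    then show ?thesis by (rule continuous_at_imp_continuous_at_within)
  next
    case True
    show ?thesis unfolding continuous_within_eps_delta
    proof (intro allI impI)
      fix e :: real assume "e > 0"
      then obtain d where d: "d > 0" "\<And>\<delta> s. 0 \<le> \<delta> \<Longrightarrow> \<delta> < d \<Longrightarrow> 0 \<le> s \<Longrightarrow> \<zeta> \<delta> s < e" using \<zeta>_small by blast
      have "dist (\<zeta> (fst w) (snd w)) (\<zeta> (fst z) (snd z)) < e" if "w \<in> {0..} \<times> {0..}" "dist w z < d" for w
      proof -
        have "dist (fst w) (fst z) < d" using dist_fst_le[of w z] that(2) by simp
        then have "\<zeta> (fst w) (snd w) < e" using that(1) True by (intro d(2)) (auto simp: dist_real_def)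
        then show ?thesis using \<zeta>0 True by (simp add: \<zeta>_def[of 0] dist_real_def)
      qed
      then show "\<exists>d>0. \<forall>w\<in>{0..} \<times> {0..}. dist w z < d \<longrightarrow> dist (case w of (\<delta>, s) \<Rightarrow> \<zeta> \<delta> s) (case z of (\<delta>, s) \<Rightarrow> \<zeta> \<delta> s) < e"
        using d(1) by (auto simp: case_prod_beta)
    qed
  qed
  then have \<zeta>_cont: "continuous_on ({0..} \<times> {0..}) (\<lambda>(\<delta>, s). \<zeta> \<delta> s)"
    by (simp add: continuous_on_eq_continuous_within)
  have "continuous_on ({0..} \<times> {0..}) (\<lambda>z. \<gamma>1 (case z of (\<delta>, s) \<Rightarrow> \<zeta> \<delta> s))"
    by (rule continuous_on_compose2[OF _ \<zeta>_cont, of "{0..}"]) (use \<gamma>(1) \<zeta>0 in \<open>auto simp: K_infinity_def\<close>)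
  then have "continuous_on ({0..} \<times> {0..}) (\<lambda>(\<delta>, s). \<gamma>1 (\<zeta> \<delta> s))" by (simp add: case_prod_beta)
  moreover have "\<gamma>1 (\<zeta> \<delta> s) \<ge> 0" for \<delta> s by (rule K_infinity_nonneg[OF \<gamma>(1) \<zeta>0])
  moreover have "\<gamma>1 (\<zeta> 0 s) = 0" for s using \<gamma>(1) by (simp add: \<zeta>_def K_infinity_def)
  moreover have "strict_mono_on {0..} (\<lambda>\<delta>. \<gamma>1 (\<zeta> \<delta> s))" for s
    by (intro strict_mono_onI K_infinity_less[OF \<gamma>(1) \<zeta>0] \<zeta>_less) auto
  moreover have "\<not> bounded ((\<lambda>\<delta>. \<gamma>1 (\<zeta> \<delta> s)) ` {0..})" for s
  proof
    assume "bounded ((\<lambda>\<delta>. \<gamma>1 (\<zeta> \<delta> s)) ` {0..})"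
    then obtain B where "\<forall>v\<in>(\<lambda>\<delta>. \<gamma>1 (\<zeta> \<delta> s)) ` {0..}. norm v \<le> B" unfolding bounded_iff by blast
    then have B: "\<gamma>1 (\<zeta> \<delta> s) \<le> B" if "\<delta> \<ge> 0" for \<delta> using that by (auto simp: abs_le_iff)
    define M where "M = max B 1"
    define \<delta> where "\<delta> = \<theta> (\<tau> M - 1 + s)"
    have \<delta>: "\<delta> > 0" using \<theta>_pos by (simp add: \<delta>_def)
    have "\<tau> \<delta> \<le> \<tau> (\<gamma>2 \<delta>)" using \<delta> \<gamma>(2) by (intro \<tau>_mono) (auto simp: K_infinity_def)
    then have "\<tau> M \<le> \<tau> (\<gamma>2 \<delta>) + 1 - s" using \<tau>_\<theta> by (simp add: \<delta>_def)
    from \<theta>_mono[OF this] have "M \<le> \<theta> (\<tau> (\<gamma>2 \<delta>) + 1 - s)" using \<theta>_\<tau>[of M] by (simp add: M_def)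
    then have "2 * M \<le> \<zeta> \<delta> s" using \<delta> by (simp add: \<zeta>_def)
    also have "\<dots> \<le> \<gamma>1 (\<zeta> \<delta> s)" using \<gamma>(1) \<zeta>0 by (simp add: K_infinity_def)
    also have "\<dots> \<le> B" using B \<delta> by simp
    finally show False by (simp add: M_def max_def split: if_splits)
  qed
  moreover have "antimono_on {0..} (\<lambda>s. \<gamma>1 (\<zeta> \<delta> s))" for \<delta>
    by (intro monotone_onI K_infinity_mono[OF \<gamma>(1) \<zeta>0] \<zeta>_anti)
  moreover have "((\<lambda>s. \<gamma>1 (\<zeta> \<delta> s)) \<longlongrightarrow> 0) at_top" for \<delta>
    unfolding tendsto_iff
  proof (intro allI impI)
    fix e :: real assume "e > 0"
    then obtain d where d: "d > 0" "\<And>u. 0 \<le> u \<Longrightarrow> u < d \<Longrightarrow> \<gamma>1 u < e"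
      using K_infinity_small[OF \<gamma>(1)] by blast
    have "\<zeta> \<delta> s < d" if "s > \<tau> (\<gamma>2 \<delta>) + 1 - \<tau> (d / 2)" for s
    proof -
      have "\<theta> (\<tau> (\<gamma>2 \<delta>) + 1 - s) < \<theta> (\<tau> (d / 2))" using that by (intro \<theta>_less) simp
      then show ?thesis using \<theta>_\<tau>[of "d / 2"] d(1) by (simp add: \<zeta>_def)
    qed
    then have "dist (\<gamma>1 (\<zeta> \<delta> s)) 0 < e" if "s > \<tau> (\<gamma>2 \<delta>) + 1 - \<tau> (d / 2)" for s
      using that d(2)[OF \<zeta>0] K_infinity_nonneg[OF \<gamma>(1) \<zeta>0] by simp
    then show "\<forall>\<^sub>F s in at_top. dist (\<gamma>1 (\<zeta> \<delta> s)) 0 < e"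
      using eventually_gt_at_top[of "\<tau> (\<gamma>2 \<delta>) + 1 - \<tau> (d / 2)"] by (rule eventually_mono[rotated])
  qed
  ultimately have "(\<lambda>\<delta> s. \<gamma>1 (\<zeta> \<delta> s)) \<in> class_KL" unfolding class_KL_def by simp
  then show ?thesis by (simp add: \<zeta>_def)
qed

section \<open>Concatenation of arcs\<close>

lemma lipschitz_imp_abs_continuous_on_interval:
  fixes y :: "real \<Rightarrow> real ^ 'n"
  assumes "L-lipschitz_on {a..b} y"
  shows "abs_continuous_on_interval a b y"
  unfolding abs_continuous_on_interval_def
proof (intro allI impI)
  fix \<epsilon> :: real assume \<epsilon>: "\<epsilon> > 0"
  have L: "L \<ge> 0" using assms by (rule lipschitz_on_nonneg)
  show "\<exists>\<delta>>0. \<forall>I. finite I \<and> (\<forall>(u, v)\<in>I. a \<le> u \<and> u \<le> v \<and> v \<le> b) \<and>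
        disjoint_family_on (\<lambda>(u, v). {u<..<v}) I \<and> (\<Sum>(u, v)\<in>I. v - u) < \<delta>
        \<longrightarrow> (\<Sum>(u, v)\<in>I. norm (y v - y u)) < \<epsilon>"
  proof (intro exI[of _ "\<epsilon> / (L + 1)"] conjI allI impI)
    show "\<epsilon> / (L + 1) > 0" using \<epsilon> L by simp
    fix I :: "(real \<times> real) set"
    assume I: "finite I \<and> (\<forall>(u, v)\<in>I. a \<le> u \<and> u \<le> v \<and> v \<le> b) \<and>
        disjoint_family_on (\<lambda>(u, v). {u<..<v}) I \<and> (\<Sum>(u, v)\<in>I. v - u) < \<epsilon> / (L + 1)"
    have "(\<Sum>(u, v)\<in>I. norm (y v - y u)) \<le> (\<Sum>(u, v)\<in>I. (L + 1) * (v - u))"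
    proof (rule sum_mono, clarify)
      fix u v assume "(u, v) \<in> I"
      then have uv: "a \<le> u" "u \<le> v" "v \<le> b" using I by auto
      then have "norm (y v - y u) \<le> L * (v - u)" using lipschitz_onD[OF assms, of v u] by (simp add: dist_norm)
      also have "\<dots> \<le> (L + 1) * (v - u)" using uv by (intro mult_right_mono) auto
      finally show "norm (y v - y u) \<le> (L + 1) * (v - u)" .
    qed
    also have "\<dots> = (L + 1) * (\<Sum>(u, v)\<in>I. v - u)" by (simp add: sum_distrib_left case_prod_beta)
    also have "\<dots> < \<epsilon>" using I L by (simp add: field_simps)
    finally show "(\<Sum>(u, v)\<in>I. norm (y v - y u)) < \<epsilon>" .
  qed
qed

lemma concatenation_index:
  fixes S :: "nat \<Rightarrow> real"
  assumes "S 0 = 0" "0 \<le> t" "\<exists>i. t < S (Suc i)"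
  defines "i \<equiv> LEAST i. t < S (Suc i)"
  shows "S i \<le> t" "t < S (Suc i)"
proof -
  show "t < S (Suc i)" unfolding i_def by (rule LeastI_ex[OF assms(3)])
  show "S i \<le> t"
  proof (cases i)
    case 0 then show ?thesis using assms by simp
  next
    case (Suc j)
    then have "\<not> t < S (Suc j)" using not_less_Least[of j "\<lambda>i. t < S (Suc i)"] by (simp add: i_def)
    then show ?thesis using Suc by simp
  qed
qed

text \<open>
  The arcs may have a finite total duration.  The curve is then constant from that time on, with an
  arbitrarily prescribed value.
\<close>

theorem concatenate_arcs:
  fixes f :: "'m::finite \<Rightarrow> real ^ 'n \<Rightarrow> real ^ 'n"
  assumes arcs: "\<And>i. admissible_arc T f (\<sigma> i) (Y i) (A i)" and join: "\<And>i. Y i (\<sigma> i) = Y (Suc i) 0"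
  defines "S \<equiv> \<lambda>i. \<Sum>j<i. \<sigma> j"
  shows "\<exists>y \<alpha>. \<alpha> \<in> borel_measurable borel \<and> (\<forall>t. \<alpha> t \<in> control_set) \<and>
    solution_on T f (SUP i. ereal (S i)) \<alpha> y \<and>
    (\<forall>i. \<forall>t\<in>{S i..S (Suc i)}. y t = Y i (t - S i)) \<and>
    (\<forall>t. (SUP i. ereal (S i)) \<le> ereal t \<longrightarrow> y t = x')"
proof -
  have S0: "S 0 = 0" and S_Suc: "S (Suc i) = S i + \<sigma> i" for i by (simp_all add: S_def)
  have \<sigma>: "\<sigma> i > 0" for i using arcs[of i] by (simp add: admissible_arc_def)
  have S_less: "S i < S (Suc i)" for i using \<sigma> by (simp add: S_Suc)
  have S_mono: "S i \<le> S j" if "i \<le> j" for i j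
    by (rule lift_Suc_mono_le[of S, OF less_imp_le[OF S_less] that])
  have S_nonneg: "S i \<ge> 0" for i using S_mono[of 0 i] S0 by simp
  have less_SUP: "ereal t < (SUP i. ereal (S i)) \<longleftrightarrow> (\<exists>i. t < S (Suc i))" for t
  proof -
    have "(\<exists>i. t < S i) \<longleftrightarrow> (\<exists>i. t < S (Suc i))" using S_less by (meson less_trans)
    then show ?thesis by (simp add: less_SUP_iff)
  qed
  define idx where "idx t = (LEAST i. t < S (Suc i))" for t
  define y where "y t = (if \<exists>i. t < S (Suc i) then Y (idx t) (t - S (idx t)) else x')" for t
  define \<alpha> where "\<alpha> t = (if \<exists>i. t < S (Suc i) then A (idx t) (t - S (idx t)) else axis undefined 1)" for t
  have idx: "S (idx t) \<le> t" "t < S (Suc (idx t))" if "0 \<le> t" "\<exists>i. t < S (Suc i)" for t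
    using concatenation_index[of S, OF S0 that] by (auto simp: idx_def)
  have idx_eq: "idx t = i" if "S i \<le> t" "t < S (Suc i)" for t i
    unfolding idx_def
  proof (rule Least_equality)
    show "i \<le> j" if "t < S (Suc j)" for j
    proof (rule ccontr)
      assume "\<not> i \<le> j"
      then have "S (Suc j) \<le> S i" by (intro S_mono) simp
      then show False using that \<open>S i \<le> t\<close> by simp
    qed
  qed (rule that(2))
  have y_eq_less: "y t = Y i (t - S i)" if "S i \<le> t" "t < S (Suc i)" for t i
    using idx_eq[OF that] that by (auto simp: y_def)
  have \<alpha>_eq: "\<alpha> t = A i (t - S i)" if "S i \<le> t" "t < S (Suc i)" for t i
    using idx_eq[OF that] that by (auto simp: \<alpha>_def)
  \<comment> \<open>the right end point is included because consecutive arcs join\<close>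
  have y_eq: "y t = Y i (t - S i)" if "t \<in> {S i..S (Suc i)}" for t i
  proof (cases "t = S (Suc i)")
    case True
    have "y t = Y (Suc i) 0" using y_eq_less[of "Suc i" t] S_less[of "Suc i"] True by simp
    then show ?thesis using join[of i] True by (simp add: S_Suc)
  next
    case False then show ?thesis using that by (intro y_eq_less) auto
  qed
  have [measurable]: "A i \<in> borel_measurable borel" for i using arcs[of i] by (simp add: admissible_arc_def)
  have [measurable]: "idx \<in> measurable borel (count_space UNIV)"
    unfolding idx_def by measurable
  have "(\<lambda>t. A (idx t) (t - S (idx t))) \<in> borel_measurable borel"
    by (rule measurable_compose_countable[where f = "\<lambda>i t. A i (t - S i)"]) measurable
  then have meas: "\<alpha> \<in> borel_measurable borel" unfolding \<alpha>_def by measurable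
  have ctrl: "\<alpha> t \<in> control_set" for t
    using arcs by (auto simp: \<alpha>_def admissible_arc_def control_set_def)
  have lip: "\<exists>L. L-lipschitz_on {0..S n} y" for n
  proof (induction n)
    case 0
    then show ?case by (intro exI[of _ 0]) (simp add: S0 lipschitz_on_def)
  next
    case (Suc n)
    then obtain L where L: "L-lipschitz_on {0..S n} y" by blast
    obtain L' where L': "L'-lipschitz_on {0..\<sigma> n} (Y n)" using arcs[of n] by (auto simp: admissible_arc_def)
    have "L'-lipschitz_on {S n..S (Suc n)} (\<lambda>t. Y n (t - S n))"
      using lipschitz_on_shift[OF L', of "S n"] by (simp add: S_Suc add.commute)
    then have "L'-lipschitz_on {S n..S (Suc n)} y"
      by (rule lipschitz_on_transform) (simp add: y_eq)
    from lipschitz_on_concat_max[OF L this refl] show ?case by (auto simp: if_distrib)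
  qed
  have N_ex: "\<forall>i. \<exists>N. finite N \<and> (\<forall>t\<in>{0<..<\<sigma> i} - N.
        (Y i has_vector_derivative (\<Sum>j\<in>UNIV. A i t $ j *\<^sub>R f j (Y i t))) (at t))"
    using arcs unfolding admissible_arc_def by blast
  from choice[OF N_ex] obtain N where N: "\<And>i. finite (N i)"
    "\<And>i t. t \<in> {0<..<\<sigma> i} - N i \<Longrightarrow> (Y i has_vector_derivative (\<Sum>j\<in>UNIV. A i t $ j *\<^sub>R f j (Y i t))) (at t)"
    by blast
  define Z where "Z = range S \<union> (\<Union>i. (\<lambda>t. t + S i) ` N i)"
  have "countable Z" unfolding Z_def using N(1) by (auto intro: countable_finite)
  then have "Z \<in> null_sets lebesgue" by (intro null_sets_completionI countable_imp_null_set_lborel)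
  then have "AE t in lebesgue. t \<notin> Z" by (rule AE_not_in)
  moreover have der: "(y has_vector_derivative (\<Sum>j\<in>UNIV. \<alpha> t $ j *\<^sub>R f j (y t))) (at t)"
    if t: "t \<notin> Z" "0 < t" "ereal t < (SUP i. ereal (S i))" for t
  proof -
    define i where "i = idx t"
    have i: "S i \<le> t" "t < S (Suc i)" using idx[of t] t by (auto simp: i_def less_SUP)
    have "t \<noteq> S i" using t(1) by (auto simp: Z_def)
    then have si: "S i < t" using i by simp
    have "t - S i \<notin> N i"
    proof
      assume "t - S i \<in> N i"
      then have "t - S i + S i \<in> (\<lambda>t. t + S i) ` N i" by (rule imageI)
      then show False using t(1) by (auto simp: Z_def)
    qed
    then have "t - S i \<in> {0<..<\<sigma> i} - N i" using si i(2) by (simp add: S_Suc)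
    from has_vector_derivative_shift[OF N(2)[OF this]]
    have "((\<lambda>t. Y i (t - S i)) has_vector_derivative (\<Sum>j\<in>UNIV. A i (t - S i) $ j *\<^sub>R f j (Y i (t - S i)))) (at t)" .
    from has_vector_derivative_transform_within_open[OF this, of "{S i<..<S (Suc i)}" y]
    show ?thesis using si i y_eq_less[OF i] \<alpha>_eq[OF i] y_eq_less[of i] by simp
  qed
  ultimately have "AE t in lebesgue. 0 < t \<and> ereal t < (SUP i. ereal (S i)) \<longrightarrow>
        (y has_vector_derivative (\<Sum>j\<in>UNIV. \<alpha> t $ j *\<^sub>R f j (y t))) (at t)"
    by (auto elim: eventually_mono)
  moreover have "y t \<notin> T" if "0 \<le> t" "ereal t < (SUP i. ereal (S i))" for t
  proof -
    have i: "S (idx t) \<le> t" "t < S (Suc (idx t))" using idx[of t] that by (auto simp: less_SUP)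
    then have "t - S (idx t) \<in> {0..\<sigma> (idx t)}" by (simp add: S_Suc)
    then have "Y (idx t) (t - S (idx t)) \<notin> T" using arcs[of "idx t"] unfolding admissible_arc_def by blast
    then show ?thesis using y_eq_less[OF i] by simp
  qed
  moreover have "abs_continuous_on_interval 0 b y" if b: "0 \<le> b" "ereal b < (SUP i. ereal (S i))" for b
  proof -
    obtain i where i: "b < S (Suc i)" using b(2) unfolding less_SUP by (elim exE)
    obtain L where "L-lipschitz_on {0..S (Suc i)} y" using lip by blast
    then have "L-lipschitz_on {0..b} y" by (rule lipschitz_on_subset) (use i in auto)
    then show ?thesis by (rule lipschitz_imp_abs_continuous_on_interval)
  qed
  ultimately have sol: "solution_on T f (SUP i. ereal (S i)) \<alpha> y" unfolding solution_on_def by simp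
  have "y t = x'" if "(SUP i. ereal (S i)) \<le> ereal t" for t
    using that less_SUP[of t] by (simp add: y_def not_less[symmetric])
  then show ?thesis
    by (intro exI[of _ y] exI[of _ \<alpha>] conjI allI ballI impI meas ctrl sol y_eq)
qed

section \<open>Global asymptotic controllability\<close>

text \<open>
  The segment from a point outside \<open>T\<close> to a nearest point of \<open>T\<close> meets the frontier, so such a point
  is as close to the compact frontier as to \<open>T\<close>.
\<close>

lemma infdist_sublevel_compact:
  fixes T :: "'a::euclidean_space set"
  assumes "closed T" "T \<noteq> {}" "compact (frontier T)"
  shows "compact {x \<in> closure (- T). infdist x T \<le> c}"
proof -
  obtain R where R: "frontier T \<subseteq> ball 0 R"
    using compact_imp_bounded[OF assms(3)] bounded_subset_ballD by blast
  have "norm x \<le> R + c" if x: "x \<in> closure (- T)" "infdist x T \<le> c" for x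
  proof -
    obtain z where z: "z \<in> T" "infdist x T = dist x z" using infdist_attains_inf[OF assms(1,2)] by blast
    obtain w where w: "w \<in> frontier T" "dist x w \<le> dist x z"
    proof (cases "x \<in> T")
      case True
      then have "x \<in> frontier T" using x closure_subset[of T] by (auto simp: frontier_closures)
      then show ?thesis by (intro that[of x]) auto
    next
      case False
      then have "closed_segment x z \<inter> frontier T \<noteq> {}" using z(1)
        by (intro connected_Int_frontier) auto
      then obtain w where w: "w \<in> closed_segment x z" "w \<in> frontier T" by blast
      then show ?thesis using that[of w] dist_in_closed_segment[OF w(1)] by (simp add: dist_commute)
    qed
    have "norm x \<le> norm w + dist x w" by (metis dist_norm norm_triangle_sub)
    also have "\<dots> \<le> R + c" using w R z x(2) by (intro add_mono) (auto simp: less_imp_le)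
    finally show ?thesis .
  qed
  then have "bounded {x \<in> closure (- T). infdist x T \<le> c}" by (auto simp: bounded_iff)
  moreover have "closed {x \<in> closure (- T). infdist x T \<le> c}"
  proof -
    have "closed (closure (- T) \<inter> {x. infdist x T \<le> c})"
      by (intro closed_Int closed_closure closed_Collect_le continuous_intros)
    then show ?thesis by (simp add: Int_def)
  qed
  ultimately show ?thesis by (simp add: compact_eq_bounded_closed)
qed

text \<open>
  Half the supremum of the feasible decreases at a level is itself feasible, and it is bounded below
  on compact intervals of levels by the uniform decrease step.
\<close>

lemma decrease_rate_exists:
  fixes f :: "'m::finite \<Rightarrow> real ^ 'n \<Rightarrow> real ^ 'n"
  assumes k: "k \<ge> 1" and T: "closed T"
    and f: "\<And>\<Omega> i. open \<Omega> \<Longrightarrow> bounded \<Omega> \<Longrightarrow> f i \<in> Cb (k - 1) (\<Omega> - T)"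
    and U: "control_lyapunov_function k T f U"
  shows "\<exists>\<mu>. (\<forall>a b. 0 < a \<longrightarrow> (\<exists>c>0. \<forall>u\<in>{a..b}. c \<le> \<mu> u)) \<and> (\<forall>u>0. \<mu> u \<le> u / 2) \<and>
    (\<forall>x. x \<notin> T \<longrightarrow> can_lower T f U x (\<mu> (U x)))"
proof -
  define M where "M u = {m. m \<le> u / 2 \<and> (\<forall>x. x \<notin> T \<and> U x = u \<longrightarrow> can_lower T f U x m)}" for u
  have M_loc: "\<exists>c>0. \<forall>u\<in>{a..b}. c \<in> M u" if a: "0 < a" for a b
  proof -
    obtain c where c: "c > 0" "\<And>x. x \<notin> T \<Longrightarrow> a \<le> U x \<Longrightarrow> U x \<le> b \<Longrightarrow> can_lower T f U x c"
      using uniform_decrease_step[OF k T f U a, of b] by blast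
    have "min c (a / 2) \<in> M u" if "u \<in> {a..b}" for u
      using that c(2) can_lower_mono[of T f U _ c "min c (a / 2)"] by (auto simp: M_def)
    then show ?thesis using c(1) a by (intro exI[of _ "min c (a / 2)"]) auto
  qed
  have bdd: "bdd_above (M u)" for u by (rule bdd_aboveI[of _ "u / 2"]) (simp add: M_def)
  define \<mu> where "\<mu> u = Sup (M u) / 2" for u
  have pos: "\<exists>c>0. \<forall>u\<in>{a..b}. c \<le> \<mu> u" if a: "0 < a" for a b
  proof -
    obtain c where c: "c > 0" "\<And>u. u \<in> {a..b} \<Longrightarrow> c \<in> M u" using M_loc[OF a] by blast
    have "c / 2 \<le> \<mu> u" if "u \<in> {a..b}" for u
      using cSup_upper[OF c(2)[OF that] bdd] by (simp add: \<mu>_def)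
    then show ?thesis using c(1) by (intro exI[of _ "c / 2"]) auto
  qed
  have ne: "M u \<noteq> {}" if "u > 0" for u using M_loc[OF that, of u] by auto
  have "\<mu> u \<le> u / 2" if u: "u > 0" for u
  proof -
    have "Sup (M u) \<le> u / 2" by (rule cSup_least[OF ne[OF u]]) (simp add: M_def)
    then show ?thesis using u by (simp add: \<mu>_def)
  qed
  moreover have "can_lower T f U x (\<mu> (U x))" if x: "x \<notin> T" for x
  proof -
    have Ux: "U x > 0" using U x by (simp add: control_lyapunov_function_def positive_definite_off_def)
    have "\<mu> (U x) > 0" using pos[OF Ux, of "U x"] by auto
    then have "\<mu> (U x) < Sup (M (U x))" by (simp add: \<mu>_def)
    then obtain m where "m \<in> M (U x)" "\<mu> (U x) < m" using less_cSup_iff[OF ne[OF Ux] bdd] by blast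
    then show ?thesis using x can_lower_mono[of T f U x m "\<mu> (U x)"] by (auto simp: M_def)
  qed
  ultimately show ?thesis using pos by blast
qed

theorem theorem1p2:
  fixes k :: nat
    and T :: "(real ^ 'n) set"
    and f :: "'m::finite \<Rightarrow> real ^ 'n \<Rightarrow> real ^ 'n"
  assumes "k \<ge> 1"
    and "closed T" and "T \<noteq> {}" and "compact (frontier T)"
    and "\<And>\<Omega> i. open \<Omega> \<Longrightarrow> bounded \<Omega> \<Longrightarrow> f i \<in> Cb (k - 1) (\<Omega> - T)"
    and "\<exists>U. control_lyapunov_function k T f U"
  shows "GAC T f"
proof -
  obtain U where U: "control_lyapunov_function k T f U" using assms(6) by blast
  let ?E = "closure (- T)"
  have Uc: "continuous_on ?E U" and Upos: "\<And>x. x \<notin> T \<Longrightarrow> U x > 0" and U0: "\<And>x. x \<in> frontier T \<Longrightarrow> U x = 0"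
    and Uprop: "\<And>K. compact K \<Longrightarrow> K \<subseteq> {0..} \<Longrightarrow> compact {x \<in> ?E. U x \<in> K}"
    using U by (auto simp: control_lyapunov_function_def positive_definite_off_def proper_off_def)
  have E_cases: "x \<notin> T \<or> x \<in> frontier T" if "x \<in> ?E" for x
    using that closure_subset[of T] by (auto simp: frontier_closures)
  have U_nonneg: "U x \<ge> 0" if "x \<in> ?E" for x using E_cases[OF that] Upos[of x] U0[of x] by auto
  have d0: "infdist x T = 0 \<longleftrightarrow> x \<in> T" for x
    using in_closed_iff_infdist_zero[OF assms(2,3)] by blast
  have dc: "continuous_on ?E (\<lambda>x. infdist x T)" by (intro continuous_intros)
  have "compact {x \<in> ?E. U x \<le> c}" for c
  proof -
    have "{x \<in> ?E. U x \<le> c} = {x \<in> ?E. U x \<in> {0..c}}" using U_nonneg by auto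
    then show ?thesis using Uprop[of "{0..c}"] by auto
  qed
  moreover have "infdist x T = 0" if "x \<in> ?E" "U x = 0" for x using d0 Upos[of x] that by auto
  ultimately obtain \<gamma>1 where \<gamma>1: "K_infinity \<gamma>1" "\<And>x. x \<in> ?E \<Longrightarrow> infdist x T \<le> \<gamma>1 (U x)"
    using K_infinity_majorant[OF Uc dc U_nonneg infdist_nonneg] by blast
  have "U x = 0" if "x \<in> ?E" "infdist x T = 0" for x using d0 E_cases[OF that(1)] U0 that by auto
  then obtain \<gamma>2 where \<gamma>2: "K_infinity \<gamma>2" "\<And>x. x \<in> ?E \<Longrightarrow> U x \<le> \<gamma>2 (infdist x T)"
    using K_infinity_majorant[OF dc Uc infdist_nonneg U_nonneg _ infdist_sublevel_compact[OF assms(2-4)]] by blast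
  obtain \<mu> where \<mu>: "\<And>a b. 0 < a \<Longrightarrow> \<exists>c>0. \<forall>u\<in>{a..b}. c \<le> \<mu> u" "\<And>u. u > 0 \<Longrightarrow> \<mu> u \<le> u / 2"
    and step: "\<forall>x. x \<notin> T \<longrightarrow> can_lower T f U x (\<mu> (U x))"
    using decrease_rate_exists[OF assms(1,2,5) U] by blast
  have "\<exists>\<tau> \<theta>. clock \<tau> \<theta> \<and> (\<forall>u>0. \<tau> (u - \<mu> u) \<le> \<tau> u - 1)"
    by (rule decrease_clock[OF \<mu>])
  then obtain \<tau> \<theta> where "clock \<tau> \<theta>" and tick: "\<And>u. u > 0 \<Longrightarrow> \<tau> (u - \<mu> u) \<le> \<tau> u - 1"
    by blast
  interpret clock \<tau> \<theta> by fact
  \<comment> \<open>the summand 1 compensates for the running step, of which only the initial value is bounded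
    by the clock; the factor 2 is the overshoot allowed within a step\<close>
  define \<beta> where "\<beta> \<delta> s = \<gamma>1 (if \<delta> \<le> 0 then 0 else 2 * \<theta> (\<tau> (\<gamma>2 \<delta>) + 1 - s))" for \<delta> s
  have \<beta>: "\<beta> \<in> class_KL" unfolding \<beta>_def[abs_def] by (rule class_KL_of_clock[OF \<gamma>1(1) \<gamma>2(1)])
  have "\<exists>y \<alpha>. admissible_pair T f x y \<alpha> \<and> (\<forall>t\<ge>0. infdist (y t) T \<le> \<beta> (infdist x T) t)" if x: "x \<notin> T" for x
  proof -
    have "\<forall>x. \<exists>\<sigma> y \<alpha>. x \<notin> T \<longrightarrow> \<sigma> \<le> 1 \<and> admissible_arc T f \<sigma> y \<alpha> \<and> y 0 = x \<and>
       (\<forall>t\<in>{0..\<sigma>}. U (y t) \<le> 2 * U x) \<and> U (y \<sigma>) \<le> U x - \<mu> (U x)" using step unfolding can_lower_def by blast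
    then obtain dur cur ctl where next_step: "\<And>x. x \<notin> T \<Longrightarrow> dur x \<le> 1 \<and> admissible_arc T f (dur x) (cur x) (ctl x) \<and>
       cur x 0 = x \<and> (\<forall>t\<in>{0..dur x}. U (cur x t) \<le> 2 * U x) \<and> U (cur x (dur x)) \<le> U x - \<mu> (U x)"
      unfolding choice_iff by blast
    define X where "X i = ((\<lambda>x. cur x (dur x)) ^^ i) x" for i
    have X_simps: "X 0 = x" "X (Suc i) = cur (X i) (dur (X i))" for i by (simp_all add: X_def)
    have end_off: "cur x (dur x) \<notin> T" if "x \<notin> T" for x
      using next_step[OF that] by (auto simp: admissible_arc_def)
    have XT: "X i \<notin> T" for i by (induction i) (auto simp: X_simps x end_off)
    \<comment> \<open>the clock reading drops by at least 1 in each step\<close>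
    have X_decr: "\<tau> (U (X i)) \<le> \<tau> (U x) - real i" for i
    proof (induction i)
      case 0 then show ?case by (simp add: X_simps)
    next
      case (Suc i)
      have "\<tau> (U (X (Suc i))) \<le> \<tau> (U (X i) - \<mu> (U (X i)))"
        using next_step[OF XT[of i]] Upos[OF XT[of "Suc i"]] by (intro \<tau>_mono) (auto simp: X_simps)
      also have "\<dots> \<le> \<tau> (U (X i)) - 1" by (rule tick[OF Upos[OF XT]])
      finally show ?case using Suc by simp
    qed
    define S where "S i = (\<Sum>j<i. dur (X j))" for i
    define Sup where "Sup = (SUP i. ereal (S i))"
    have S_Suc: "S (Suc i) = S i + dur (X i)" for i by (simp add: S_def)
    have dur: "0 < dur (X i)" "dur (X i) \<le> 1" for i using next_step[OF XT[of i]] by (auto simp: admissible_arc_def)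
    have S_le: "S i \<le> real i" for i
    proof (induction i)
      case (Suc i) then show ?case using dur(2)[of i] by (simp add: S_Suc)
    qed (simp add: S_def)
    have S_less: "S i < S (Suc i)" for i using dur(1) by (simp add: S_Suc)
    have "frontier T \<noteq> {}" using assms(3) x by (auto simp: frontier_eq_empty)
    then obtain x' where x': "x' \<in> frontier T" by blast
    have arcs: "admissible_arc T f (dur (X i)) (cur (X i)) (ctl (X i))" for i using next_step[OF XT] by blast
    have join: "cur (X i) (dur (X i)) = cur (X (Suc i)) 0" for i
      using next_step[OF XT[of "Suc i"]] by (simp add: X_simps)
    obtain y \<alpha> where meas: "\<alpha> \<in> borel_measurable borel" and ctrl: "\<And>t. \<alpha> t \<in> control_set"
      and sol: "solution_on T f Sup \<alpha> y" and y_eq: "\<And>i t. t \<in> {S i..S (Suc i)} \<Longrightarrow> y t = cur (X i) (t - S i)"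
      and y_end: "\<And>t. Sup \<le> ereal t \<Longrightarrow> y t = x'"
      using concatenate_arcs[of T f "\<lambda>i. dur (X i)" "\<lambda>i. cur (X i)" "\<lambda>i. ctl (X i)" x', OF arcs join]
      unfolding S_def[symmetric] Sup_def by blast
    have Uy: "U (y t) \<le> 2 * \<theta> (\<tau> (U x) - real i)" "y t \<notin> T" if "t \<in> {S i..S (Suc i)}" for t i
    proof -
      have t: "t - S i \<in> {0..dur (X i)}" using that by (simp add: S_Suc)
      have "U (y t) \<le> 2 * U (X i)" unfolding y_eq[OF that] using next_step[OF XT[of i]] t by blast
      also have "U (X i) = \<theta> (\<tau> (U (X i)))" using \<theta>_\<tau>[OF Upos[OF XT]] by simp
      also have "\<theta> (\<tau> (U (X i))) \<le> \<theta> (\<tau> (U x) - real i)" by (rule \<theta>_mono[OF X_decr])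
      finally show "U (y t) \<le> 2 * \<theta> (\<tau> (U x) - real i)" by simp
      show "y t \<notin> T" unfolding y_eq[OF that] using arcs[of i] t unfolding admissible_arc_def by blast
    qed
    have dy: "infdist (y t) T \<le> \<gamma>1 (2 * \<theta> (\<tau> (U x) - real i))" if "t \<in> {S i..S (Suc i)}" for t i
    proof -
      have yE: "y t \<in> ?E" using Uy(2)[OF that] closure_subset[of "- T"] by auto
      have "infdist (y t) T \<le> \<gamma>1 (U (y t))" by (rule \<gamma>1(2)[OF yE])
      also have "\<dots> \<le> \<gamma>1 (2 * \<theta> (\<tau> (U x) - real i))"
        by (rule K_infinity_mono[OF \<gamma>1(1) U_nonneg[OF yE] Uy(1)[OF that]])
      finally show ?thesis .
    qed
    have index: "\<exists>i. t \<in> {S i..S (Suc i)}" if t: "0 \<le> t" "ereal t < Sup" for t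
    proof -
      obtain j where "t < S j" using t(2) by (auto simp: Sup_def less_SUP_iff)
      then have "t < S (Suc j)" using S_less[of j] by simp
      then show ?thesis using concatenation_index[of S t] t(1) by (force simp: S_def)
    qed
    have dpos: "infdist x T > 0" using d0[of x] x infdist_nonneg[of x T] by (simp add: less_le)
    have bound: "infdist (y t) T \<le> \<beta> (infdist x T) t" if t: "t \<ge> 0" for t
    proof (cases "ereal t < Sup")
      case True
      obtain i where i: "t \<in> {S i..S (Suc i)}" using index[OF t True] by blast
      have xE: "x \<in> ?E" using x closure_subset[of "- T"] by auto
      have "t \<le> real i + 1" using i S_le[of "Suc i"] by simp
      moreover have "\<tau> (U x) \<le> \<tau> (\<gamma>2 (infdist x T))" by (rule \<tau>_mono[OF Upos[OF x] \<gamma>2(2)[OF xE]])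
      ultimately have "\<theta> (\<tau> (U x) - real i) \<le> \<theta> (\<tau> (\<gamma>2 (infdist x T)) + 1 - t)" by (intro \<theta>_mono) simp
      then have "\<gamma>1 (2 * \<theta> (\<tau> (U x) - real i)) \<le> \<gamma>1 (2 * \<theta> (\<tau> (\<gamma>2 (infdist x T)) + 1 - t))"
        using \<theta>_pos[of "\<tau> (U x) - real i"] by (intro K_infinity_mono[OF \<gamma>1(1)]) auto
      then show ?thesis using dy[OF i] dpos by (simp add: \<beta>_def)
    next
      case False
      then have "y t = x'" by (intro y_end) simp
      moreover have "x' \<in> T" using x' assms(2) frontier_subset_closed by blast
      ultimately have "infdist (y t) T = 0" using d0 by simp
      moreover have "\<beta> (infdist x T) t \<ge> 0" using \<beta> dpos t by (auto simp: class_KL_def)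
      ultimately show ?thesis by simp
    qed
    have Sup_gt: "ereal (S i) < Sup" for i
      unfolding Sup_def less_SUP_iff using S_less[of i] by (auto intro: exI[of _ "Suc i"])
    have "((\<lambda>t. infdist (y t) T) \<longlongrightarrow> 0) (filtercomap ereal (at_left Sup))"
      unfolding tendsto_iff
    proof (intro allI impI)
      fix e :: real assume e: "e > 0"
      obtain d where d: "d > 0" "\<And>u. 0 \<le> u \<Longrightarrow> u < d \<Longrightarrow> \<gamma>1 u < e" using K_infinity_small[OF \<gamma>1(1) e] by blast
      obtain n :: nat where n: "\<tau> (U x) - \<tau> (d / 2) < real n" using reals_Archimedean2 by blast
      have "infdist (y t) T < e" if t: "ereal (S n) < ereal t" "ereal t < Sup" for t
      proof -
        have Sn: "S n \<ge> 0" unfolding S_def using dur(1) by (intro sum_nonneg) (auto intro: less_imp_le)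
        obtain i where i: "t \<in> {S i..S (Suc i)}" using index[of t] t Sn by auto
        have "n \<le> i"
        proof (rule ccontr)
          assume "\<not> n \<le> i"
          then have "S (Suc i) \<le> S n" by (intro lift_Suc_mono_le[of S, OF less_imp_le[OF S_less]]) simp
          then show False using i t by simp
        qed
        then have "\<theta> (\<tau> (U x) - real i) < \<theta> (\<tau> (d / 2))" using n by (intro \<theta>_less) simp
        then have "2 * \<theta> (\<tau> (U x) - real i) < d" using \<theta>_\<tau>[of "d / 2"] d(1) by simp
        then show ?thesis using dy[OF i] d(2)[of "2 * \<theta> (\<tau> (U x) - real i)"] \<theta>_pos[of "\<tau> (U x) - real i"] by simp
      qed
      moreover have "\<forall>\<^sub>F z in at_left Sup. ereal (S n) < z \<and> z < Sup"
        using Sup_gt[of n] by (auto simp: eventually_at_left)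
      ultimately show "\<forall>\<^sub>F t in filtercomap ereal (at_left Sup). dist (infdist (y t) T) 0 < e"
        unfolding eventually_filtercomap by (intro exI[of _ "\<lambda>z. ereal (S n) < z \<and> z < Sup"]) (auto simp: infdist_nonneg)
    qed
    moreover have "0 < Sup" using Sup_gt[of 0] by (simp add: S_def zero_ereal_def)
    moreover have "y 0 = x" using y_eq[of 0 0] dur(1)[of 0] next_step[OF x] by (simp add: S_def X_simps)
    moreover have "\<alpha> \<in> borel_measurable (lebesgue_on {0..})"
    proof -
      have "\<alpha> \<in> borel_measurable lebesgue" using meas by (intro measurable_completion) simp
      then show ?thesis by (rule measurable_restrict_space1)
    qed
    ultimately have "admissible_pair T f x y \<alpha>"
      unfolding admissible_pair_def using ctrl sol x' y_end by blast
    then show ?thesis using bound by blast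
  qed
  then show ?thesis unfolding GAC_def using \<beta> by blast
qed

end
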